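(* Let $\mathcal O$ be the ring of integers of an imaginary quadratic field of discriminant $d_{\mathcal O}$, let $H=\mathrm{diag}(a_1,\dots,a_m)$ with $a_i\in\mathbb Z\setminus\{0\}$ be a diagonal hermitian form over $\mathcal O$, and let $k\in\mathbb Z$, $k\neq 0$. Write $k=\pm\prod_pp^{\tau_p}$ with $\tau_p\in\mathbb Z_{\geq0}$, $\tau_p=0$ for almost all $p$. If $m$ is odd, then \[ \delta(H,k)=\frac{1}{L(m,d_{\mathcal O})}\prod_{p\mid 2d_{\mathcal O}\det(H)}\frac{\delta_p(H,k)}{1-\left(\frac{d_{\mathcal O}}{p}\right)p^{-m}}\prod_{\substack{p\mid k\\ p\nmid 2d_{\mathcal O}\det(H)}}\frac{1-\left(\frac{d_{\mathcal O}}{p}\right)^{\tau_p+1}p^{-(\tau_p+1)(m-1)}}{1-\left(\frac{d_{\mathcal O}}{p}\right)p^{-(m-1)}}. \] If $m$ is even, then \[ \delta(H,k)=\frac{1}{\zeta(m)}\prod_{p\mid 2d_{\mathcal O}\det(H)}\frac{\delta_p(H,k)}{1-p^{-m}}\prod_{\substack{p\mid k\\ p\nmid 2d_{\mathcal O}\det(H)}}\frac{1-p^{-(\tau_p+1)(m-1)}}{1-p^{-(m-1)}}. \]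
   Context: $H[z]=a_1|z_1|^2+\dots+a_m|z_m|^2$ for $z\in\mathcal O^m$. For a prime $p$, $\delta_p(H,k)=\lim_{j\to\infty}\#\{z\in(\mathcal O/p^j\mathcal O)^m: H[z]\equiv k\bmod p^j\mathcal O\}/p^{j(2m-1)}$, and $\delta(H,k)=\prod_p\delta_p(H,k)$ over all primes. All products are over primes $p$. $\zeta$ is the Riemann zeta function, $\left(\frac{d_{\mathcal O}}{\cdot}\right)$ the Kronecker symbol, and $L(s,d_{\mathcal O})=\sum_{n\geq1}\left(\frac{d_{\mathcal O}}{n}\right)n^{-s}$.
   Formalization: For m = 1 and a prime p | k, p not dividing 2 d det(H), with Kronecker symbol (d/p) = 1, the quotient in the last product is 0/0; it is read as its limit value tau_p + 1. The product over all primes is taken in increasing order. *)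

theory Defs
  imports "HOL-Analysis.Analysis" "HOL-Number_Theory.Number_Theory"
    "HOL-Computational_Algebra.Computational_Algebra"
begin

text \<open>
  Imaginary quadratic fields are taken as subfields of \<open>\<complex>\<close>, so that \<open>\<bar>z\<bar>\<^sup>2\<close> is the square of the
  complex absolute value.
\<close>

definition subfield_of_complex :: "complex set \<Rightarrow> bool" where
  "subfield_of_complex K \<longleftrightarrow>
     0 \<in> K \<and> 1 \<in> K \<and>
     (\<forall>x\<in>K. \<forall>y\<in>K. x - y \<in> K \<and> x * y \<in> K) \<and> (\<forall>x\<in>K. inverse x \<in> K)"

text \<open>Degree 2 over the rationals is expressed by a basis \<open>1, \<theta>\<close>; linear independence and
  \<open>\<not> K \<subseteq> \<real>\<close> are both contained in \<open>\<theta> \<notin> \<real>\<close>.\<close>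

definition imaginary_quadratic_field :: "complex set \<Rightarrow> bool" where
  "imaginary_quadratic_field K \<longleftrightarrow>
     subfield_of_complex K \<and>
     (\<exists>\<theta>. \<theta> \<notin> \<real> \<and> K = {of_rat x + of_rat y * \<theta> | x y. True})"

definition ring_of_integers :: "complex set \<Rightarrow> complex set" where
  "ring_of_integers K = {z \<in> K. algebraic_int z}"

text \<open>
  The discriminant of an imaginary quadratic field: the squared determinant of the matrix of
  conjugates of an integral basis \<open>\<alpha>, \<beta>\<close>. The nontrivial automorphism is complex conjugation, and
  two generators of the ring of integers as an abelian group automatically form a basis.
\<close>

definition field_discriminant :: "complex set \<Rightarrow> int" where
  "field_discriminant K =
     (THE d. \<exists>\<alpha> \<beta>. ring_of_integers K = {of_int x * \<alpha> + of_int y * \<beta> | x y. True} \<and>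
                   of_int d = (\<alpha> * cnj \<beta> - \<beta> * cnj \<alpha>)\<^sup>2)"

definition herm_form :: "nat \<Rightarrow> (nat \<Rightarrow> int) \<Rightarrow> (nat \<Rightarrow> complex) \<Rightarrow> complex" where
  "herm_form m a z = (\<Sum>i\<in>{1..m}. of_int (a i) * of_real ((cmod (z i))\<^sup>2))"

definition cong_rel :: "complex set \<Rightarrow> nat \<Rightarrow> (complex \<times> complex) set" where
  "cong_rel R n = {(x, y). x \<in> R \<and> y \<in> R \<and> (\<exists>w\<in>R. x - y = of_nat n * w)}"

text \<open>
  The solutions in \<open>(R / nR)\<^sup>m\<close> of \<open>H[z] \<equiv> k\<close> modulo \<open>nR\<close>. An element of \<open>(R / nR)\<^sup>m\<close> is a tuple \<open>Z\<close> of
  residue classes; whether the congruence holds does not depend on the representatives \<open>z\<close>.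
\<close>

definition solutions_mod ::
    "complex set \<Rightarrow> nat \<Rightarrow> (nat \<Rightarrow> int) \<Rightarrow> int \<Rightarrow> nat \<Rightarrow> (nat \<Rightarrow> complex set) set" where
  "solutions_mod R m a k n =
     {Z \<in> {1..m} \<rightarrow>\<^sub>E R // cong_rel R n.
        \<exists>z. (\<forall>i\<in>{1..m}. z i \<in> Z i) \<and> (\<exists>w\<in>R. herm_form m a z - of_int k = of_nat n * w)}"

definition local_density :: "complex set \<Rightarrow> nat \<Rightarrow> (nat \<Rightarrow> int) \<Rightarrow> int \<Rightarrow> nat \<Rightarrow> real" where
  "local_density R m a k p =
     lim (\<lambda>j. real (card (solutions_mod R m a k (p ^ j))) / real p ^ (j * (2 * m - 1)))"

text \<open>The product over all primes, in increasing order (for \<open>m = 1\<close> it need not converge absolutely).\<close>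

definition hermitian_density :: "complex set \<Rightarrow> nat \<Rightarrow> (nat \<Rightarrow> int) \<Rightarrow> int \<Rightarrow> real" where
  "hermitian_density R m a k = (\<Prod>p. if prime p then local_density R m a k p else 1)"

definition kronecker_prime :: "int \<Rightarrow> nat \<Rightarrow> int" where
  "kronecker_prime d p =
     (if p = 2 then (if even d then 0 else if d mod 8 \<in> {1, 7} then 1 else -1)
      else Legendre d (int p))"

definition kronecker :: "int \<Rightarrow> nat \<Rightarrow> int" where
  "kronecker d n =
     (if n = 0 then (if \<bar>d\<bar> = 1 then 1 else 0)
      else (\<Prod>p\<in>prime_factors n. kronecker_prime d p ^ multiplicity p n))"

definition L_kronecker :: "real \<Rightarrow> int \<Rightarrow> real" where
  "L_kronecker s d = (\<Sum>n. of_int (kronecker d (Suc n)) * real (Suc n) powr (- s))"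

text \<open>The Riemann zeta function on its half-line of convergence \<open>s > 1\<close>.\<close>

definition zeta_real :: "real \<Rightarrow> real" where
  "zeta_real s = (\<Sum>n. real (Suc n) powr (- s))"

end

theory Submission
  imports Defs "HOL-Real_Asymp.Real_Asymp"
begin

text \<open>
  Detect the congruence \<open>H[z] \<equiv> k\<close> modulo \<open>p\<^sup>j\<close> by additive characters. For \<open>p\<close> prime to \<open>2d det H\<close>, the
  sum of \<open>e(c N(x + y\<omega>)/p\<^sup>s)\<close> over \<open>x, y\<close> modulo \<open>p\<^sup>s\<close> is \<open>(\<eta>(p) p)\<^sup>s\<close> for every unit \<open>c\<close>, where \<open>\<eta>\<close> is the
  Kronecker symbol of \<open>d\<close>. Only Ramanujan sums in \<open>k\<close> remain, and the density at \<open>p\<close> becomes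
  \<open>(1 - \<epsilon>p\<^sup>-\<^sup>m) \<Sum>\<^sub>i (\<epsilon>p\<^sup>1\<^sup>-\<^sup>m)\<^sup>i\<close> with \<open>i \<le> \<tau>\<^sub>p\<close> and \<open>\<epsilon> = \<eta>(p)\<^sup>m\<close>.

  The product over all \<open>p\<close> is then the inverse of an Euler product, changed at finitely many primes. It
  converges absolutely unless \<open>m = 1\<close>. For \<open>m = 1\<close>, quadratic reciprocity makes \<open>\<eta>\<close> periodic and odd, so
  its partial sums are bounded; hence \<open>L(1) \<noteq> 0\<close>, Mertens' theorem holds for \<open>\<eta>\<close>, and the Euler
  product converges conditionally to \<open>L(1)\<close>.
\<close>

section \<open>Partial summation and Euler products\<close>

text \<open>The variables are summed in pairs because a one-variable Gauss sum depends on the class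
  of its coefficient, while the sum over a norm form does not. So the \<open>a i\<close> drop out at
  good primes and only the \<open>m\<close>-th power of the symbol survives; its parity selects L or
  zeta. As \<open>k\<close> is nonzero, the Ramanujan sums vanish once the exponent exceeds
  \<open>\<tau> + 1\<close>, so the normalized counts are eventually constant. At primes dividing
  \<open>2 * d * D\<close> nothing is shown about the density: it is carried as an opaque number,
  possibly zero.

  For \<open>m = 1\<close> the difficulty is to let \<open>s\<close> tend to 1 inside a product over
  primes. Bounded partial sums over all integers give no direct control of sums over primes;
  logarithmic weights do. L(1) being nonzero bounds the sums of \<eta>(p) ln p / p, and dividing the
  weight \<open>ln p\<close> out again by partial summation gives a tail estimate uniform in
  \<open>s\<close>. Nonvanishing itself is elementary for real characters, so neither complex
  analysis nor a class number formula enters.\<close>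

lemma sum_divisors_swap:
  fixes g :: "nat \<Rightarrow> nat \<Rightarrow> 'a::comm_monoid_add"
  shows "(\<Sum>n\<in>{1..N}. \<Sum>d | d dvd n. g d (n div d)) = (\<Sum>d\<in>{1..N}. \<Sum>j\<in>{1..N div d}. g d j)"
proof -
  have "(\<Sum>n\<in>{1..N}. \<Sum>d | d dvd n. g d (n div d)) =
        (\<Sum>(n, d)\<in>(SIGMA n:{1..N}. {d. d dvd n}). g d (n div d))"
    by (subst sum.Sigma) auto
  also have "\<dots> = (\<Sum>(d, j)\<in>(SIGMA d:{1..N}. {1..N div d}). g d j)"
  proof (rule sum.reindex_bij_witness[where i = "\<lambda>(d, j). (d * j, d)" and j = "\<lambda>(n, d). (d, n div d)"], goal_cases)
    case (2 x)
    obtain n d where x: "x = (n, d)" by force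
    with 2 obtain j where j: "n = d * j" "n \<ge> 1" "n \<le> N" by (auto elim: dvdE)
    hence "d \<ge> 1" "j \<ge> 1" by (auto simp: Suc_le_eq intro!: Nat.gr0I)
    moreover from this have "d \<le> N" "j \<le> N div d"
      using j by (auto simp: less_eq_div_iff_mult_less_eq mult.commute intro: order.trans[OF _ j(3)])
    ultimately show ?case using x j by auto
  next
    case (4 x)
    thus ?case by (auto simp: less_eq_div_iff_mult_less_eq mult.commute)
  qed auto
  also have "\<dots> = (\<Sum>d\<in>{1..N}. \<Sum>j\<in>{1..N div d}. g d j)"
    by (subst sum.Sigma) auto
  finally show ?thesis .
qed

text \<open>Abel's inequality: after summation by parts the weights \<open>f b\<close> and
  \<open>f i - f (Suc i)\<close> are nonnegative and add up to \<open>f a\<close>.\<close>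

lemma summation_by_parts_bound:
  fixes c f :: "nat \<Rightarrow> real"
  assumes c: "\<And>n. \<bar>\<Sum>i\<in>{a..n}. c i\<bar> \<le> C"
    and dec: "\<And>n. n \<ge> a \<Longrightarrow> f (Suc n) \<le> f n" and pos: "\<And>n. n \<ge> a \<Longrightarrow> f n \<ge> 0"
  shows "\<bar>\<Sum>i\<in>{a..b}. c i * f i\<bar> \<le> C * f a"
proof (cases "a \<le> b")
  case True
  define G where "G = (\<lambda>n. \<Sum>i\<in>{a..n}. c i)"
  have eq: "(\<Sum>i\<in>{a..b}. c i * f i) = G b * f b + (\<Sum>i\<in>{a..<b}. G i * (f i - f (Suc i)))"
    using True
  proof (induction b rule: dec_induct)
    case (step n)
    have "(\<Sum>i\<in>{a..Suc n}. c i * f i) = (\<Sum>i\<in>{a..n}. c i * f i) + c (Suc n) * f (Suc n)"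
      using step by simp
    moreover have "G (Suc n) = G n + c (Suc n)" using step by (simp add: G_def)
    ultimately show ?case using step by (simp add: algebra_simps)
  qed (simp add: G_def)
  have *: "f b + (\<Sum>i\<in>{a..<b}. f i - f (Suc i)) = f a"
    using True by (induction b rule: dec_induct) auto
  have "\<bar>\<Sum>i\<in>{a..b}. c i * f i\<bar> \<le> \<bar>G b * f b\<bar> + (\<Sum>i\<in>{a..<b}. \<bar>G i * (f i - f (Suc i))\<bar>)"
    unfolding eq by (intro order.trans[OF abs_triangle_ineq] add_left_mono sum_abs)
  also have "\<dots> \<le> C * f b + (\<Sum>i\<in>{a..<b}. C * (f i - f (Suc i)))"
    unfolding abs_mult using c pos dec True
    by (intro add_mono sum_mono mult_mono) (auto simp: G_def intro: order.trans[OF abs_ge_zero])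
  also have "\<dots> = C * (f b + (\<Sum>i\<in>{a..<b}. f i - f (Suc i)))"
    by (simp add: sum_distrib_left distrib_left)
  finally show ?thesis by (simp only: *)
next
  case False
  have "C \<ge> 0" using c[of a] by (meson abs_ge_zero order.trans)
  thus ?thesis using False pos[of a] by simp
qed

text \<open>A block of terms is a difference of two initial segments, whence the factor 2.\<close>

lemma tail_bound:
  fixes c f :: "nat \<Rightarrow> real"
  assumes c: "\<And>n. \<bar>\<Sum>i\<in>{1..n}. c i\<bar> \<le> C" and a: "a \<ge> 1"
    and dec: "\<And>n. n \<ge> a \<Longrightarrow> f (Suc n) \<le> f n" and pos: "\<And>n. n \<ge> a \<Longrightarrow> f n \<ge> 0"
  shows "\<bar>\<Sum>i\<in>{a..b}. c i * f i\<bar> \<le> 2 * C * f a"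
proof (rule summation_by_parts_bound)
  fix n
  show "\<bar>\<Sum>i\<in>{a..n}. c i\<bar> \<le> 2 * C"
  proof (cases "a \<le> n")
    case True
    have "{1..n} = {1..a-1} \<union> {a..n}" "{1..a-1} \<inter> {a..n} = {}" using a True by auto
    hence "(\<Sum>i\<in>{1..n}. c i) = (\<Sum>i\<in>{1..a-1}. c i) + (\<Sum>i\<in>{a..n}. c i)"
      by (simp add: sum.union_disjoint)
    thus ?thesis using c[of n] c[of "a-1"] by linarith
  next
    case False
    thus ?thesis using order.trans[OF abs_ge_zero c[of 0]] by simp
  qed
qed (use dec pos in auto)

text \<open>The Weierstrass test is of no use for series that need not converge absolutely at
  \<open>s = 1\<close>; a bound on blocks that is uniform in \<open>s\<close> takes its
  place.\<close>

lemma uniform_tail_continuous: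
  fixes u :: "nat \<Rightarrow> real \<Rightarrow> real"
  assumes cont: "\<And>n. continuous_on S (u n)"
    and tail: "\<And>N M s. N \<ge> start \<Longrightarrow> s \<in> S \<Longrightarrow> \<bar>\<Sum>n\<in>{N..M}. u n s\<bar> \<le> \<epsilon> N"
    and \<epsilon>: "\<epsilon> \<longlonglongrightarrow> 0"
  shows "continuous_on S (\<lambda>s. \<Sum>n. u n s)" "\<And>s. s \<in> S \<Longrightarrow> summable (\<lambda>n. u n s)"
proof -
  have "uniformly_Cauchy_on S (\<lambda>n s. \<Sum>i<n. u i s)"
    unfolding uniformly_Cauchy_on_def
  proof (intro allI impI)
    fix e :: real assume "e > 0"
    then obtain K where K: "\<And>n. n \<ge> K \<Longrightarrow> \<bar>\<epsilon> n\<bar> < e"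
      using LIMSEQ_D[OF \<epsilon>, of e] by auto
    have *: "dist (\<Sum>i<m. u i s) (\<Sum>i<n. u i s) < e"
      if s: "s \<in> S" and mn: "m \<ge> max K start" "n \<ge> m" for s m n
    proof (cases "n = m")
      case False
      have "(\<Sum>i<n. u i s) = (\<Sum>i<m. u i s) + (\<Sum>i\<in>{m..n-1}. u i s)"
        using mn False by (subst sum.union_disjoint[symmetric]) (auto intro!: sum.cong)
      thus ?thesis using tail[of m s "n - 1"] K[of m] s mn by (auto simp: dist_real_def)
    qed (use \<open>e > 0\<close> in auto)
    show "\<exists>M. \<forall>s\<in>S. \<forall>m\<ge>M. \<forall>n\<ge>M. dist (\<Sum>i<m. u i s) (\<Sum>i<n. u i s) < e"
    proof (intro exI[of _ "max K start"] ballI allI impI)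
      fix s m n assume "s \<in> S" "m \<ge> max K start" "n \<ge> max K start"
      thus "dist (\<Sum>i<m. u i s) (\<Sum>i<n. u i s) < e"
        using *[of s m n] *[of s n m] by (cases "m \<le> n") (auto simp: dist_commute)
    qed
  qed
  then obtain l where l: "uniform_limit S (\<lambda>n s. \<Sum>i<n. u i s) l sequentially"
    using Cauchy_uniformly_convergent uniformly_convergent_on_def by blast
  have sums: "(\<lambda>n. u n s) sums l s" if "s \<in> S" for s
    using tendsto_uniform_limitI[OF l that] by (simp add: sums_def)
  thus "\<And>s. s \<in> S \<Longrightarrow> summable (\<lambda>n. u n s)" by (auto simp: sums_iff)
  have "continuous_on S l"
    by (rule uniform_limit_theorem[OF _ l]) (auto intro!: continuous_on_sum cont always_eventually)
  thus "continuous_on S (\<lambda>s. \<Sum>n. u n s)"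
    by (rule continuous_on_eq) (use sums in \<open>auto simp: sums_iff\<close>)
qed

text \<open>
  If the sum over the integers prime to all primes below \<open>N\<close> is denoted by \<open>S\<^sub>N\<close>, then removing the
  multiples of the next prime \<open>p\<close> multiplies it by \<open>1 - f p\<close>, and \<open>S\<^sub>N \<rightarrow> f 1\<close>.
\<close>

lemma euler_product:
  fixes f :: "nat \<Rightarrow> real"
  assumes mult: "\<And>m n. m > 0 \<Longrightarrow> n > 0 \<Longrightarrow> f (m * n) = f m * f n" and f1: "f 1 = 1"
    and summ: "(\<lambda>n. norm (f n)) summable_on {1..}"
  shows "(\<lambda>N. (\<Sum>\<^sub>\<infinity>n\<in>{1..}. f n) * (\<Prod>p\<le>N. if prime p then 1 - f p else 1)) \<longlonglongrightarrow> 1"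
proof -
  define A where "A = (\<lambda>N. {n::nat. n \<ge> 1 \<and> (\<forall>p\<le>N. prime p \<longrightarrow> \<not> p dvd n)})"
  have summ': "f summable_on X" if "X \<subseteq> {1..}" for X
    using summable_on_subset_banach[OF abs_summable_summable[OF summ] that] .
  have summn: "(\<lambda>n. norm (f n)) summable_on X" if "X \<subseteq> {1..}" for X
    using summable_on_subset_banach[OF summ that] .
  have A_sub: "A N \<subseteq> {1..}" for N by (auto simp: A_def)
  have step: "infsum f (A (Suc N)) = infsum f (A N) * (if prime (Suc N) then 1 - f (Suc N) else 1)" for N
  proof (cases "prime (Suc N)")
    case True
    define q where "q = Suc N"
    have q: "prime q" "q > 0" using True by (auto simp: q_def)
    have "A N = A (Suc N) \<union> (*) q ` A N"
    proof (intro equalityI subsetI)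
      fix n assume n: "n \<in> A N"
      show "n \<in> A (Suc N) \<union> (*) q ` A N"
      proof (cases "q dvd n")
        case True
        then obtain k where k: "n = q * k" by auto
        hence "k \<in> A N" using n by (auto simp: A_def intro!: Nat.gr0I simp: Suc_le_eq)
        thus ?thesis using k by auto
      next
        case False
        thus ?thesis using n by (auto simp: A_def q_def le_Suc_eq)
      qed
    next
      fix n assume "n \<in> A (Suc N) \<union> (*) q ` A N"
      thus "n \<in> A N"
      proof
        assume "n \<in> (*) q ` A N"
        then obtain k where k: "n = q * k" "k \<in> A N" by auto
        have "\<not> p dvd n" if "p \<le> N" "prime p" for p
        proof
          assume "p dvd n"
          hence "p dvd q \<or> p dvd k" using k that by (simp add: prime_dvd_mult_iff)
          moreover have "\<not> p dvd k" using k that by (auto simp: A_def)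
          ultimately have "p = q" using q that by (simp add: primes_dvd_imp_eq)
          thus False using that by (simp add: q_def)
        qed
        thus "n \<in> A N" using k q by (auto simp: A_def)
      qed (auto simp: A_def)
    qed
    moreover have "\<not> q dvd x" if "x \<in> A (Suc N)" for x
      using that q(1) unfolding A_def q_def by blast
    hence "A (Suc N) \<inter> (*) q ` A N = {}" by fastforce
    ultimately have "infsum f (A N) = infsum f (A (Suc N)) + infsum f ((*) q ` A N)"
      using infsum_Un_disjoint[of f "A (Suc N)" "(*) q ` A N"] A_sub summ'
      by (metis Un_subset_iff)
    also have "infsum f ((*) q ` A N) = infsum (f \<circ> (*) q) (A N)"
      using q by (intro infsum_reindex) (auto simp: inj_on_def)
    also have "\<dots> = infsum (\<lambda>n. f q * f n) (A N)"
      using q by (intro infsum_cong) (auto simp: A_def mult)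
    also have "\<dots> = f q * infsum f (A N)"
      by (rule infsum_cmult_right) (rule summ'[OF A_sub])
    finally have "infsum f (A (Suc N)) = infsum f (A N) - f q * infsum f (A N)" by linarith
    thus ?thesis using True by (simp add: q_def algebra_simps)
  next
    case False
    hence "A (Suc N) = A N" by (auto simp: A_def le_Suc_eq)
    thus ?thesis using False by simp
  qed
  have eq: "infsum f (A N) = infsum f {1..} * (\<Prod>p\<le>N. if prime p then 1 - f p else 1)" for N
  proof (induction N)
    case 0
    have "A 0 = {1..}" by (auto simp: A_def)
    thus ?case by simp
  next
    case (Suc N)
    show ?case unfolding step Suc.IH by simp
  qed
  \<comment> \<open>Every member of \<open>A N\<close> except 1 has a prime factor above
    \<open>N\<close>, so beyond 1 only a tail of an absolutely convergent sum is left.\<close>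
  have "(\<lambda>N. infsum f (A N)) \<longlonglongrightarrow> 1"
  proof (rule LIMSEQ_I)
    fix e :: real assume e: "e > 0"
    from summ have "((\<lambda>n. norm (f n)) has_sum (infsum (\<lambda>n. norm (f n)) {1..})) {1..}" by simp
    then obtain X where X: "finite X" "X \<subseteq> {1..}"
      and Y: "\<And>Y. finite Y \<Longrightarrow> X \<subseteq> Y \<Longrightarrow> Y \<subseteq> {1..} \<Longrightarrow>
           dist (sum (\<lambda>n. norm (f n)) Y) (infsum (\<lambda>n. norm (f n)) {1..}) < e"
      using e unfolding has_sum_def tendsto_iff eventually_finite_subsets_at_top by meson
    show "\<exists>no. \<forall>n\<ge>no. norm (infsum f (A n) - 1) < e"
    proof (intro exI[of _ "Max (insert 1 X)"] allI impI)
      fix N assume N: "N \<ge> Max (insert 1 X)"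
      have X': "x \<le> N" if "x \<in> X" for x using N that X by auto
      have one: "1 \<in> A N" by (auto simp: A_def)
      have "infsum f (A N) = infsum f {1} + infsum f (A N - {1})"
        using one by (subst infsum_Un_disjoint[symmetric]) (auto simp: insert_absorb A_def intro!: summ')
      hence "norm (infsum f (A N) - 1) = norm (infsum f (A N - {1}))" using f1 by simp
      also have "\<dots> \<le> infsum (\<lambda>n. norm (f n)) (A N - {1})"
        by (intro norm_infsum_bound summn) (auto simp: A_def)
      also have "\<dots> \<le> infsum (\<lambda>n. norm (f n)) ({1..} - insert 1 X)"
      proof (rule infsum_mono2)
        show "A N - {1} \<subseteq> {1..} - insert 1 X"
        proof
          fix x assume x: "x \<in> A N - {1}"
          then obtain p where p: "prime p" "p dvd x" by (metis DiffD2 prime_factor_nat singletonI)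
          hence "p > N" using x by (force simp: A_def)
          moreover have "p \<le> x" using p x by (auto simp: A_def intro!: dvd_imp_le)
          ultimately show "x \<in> {1..} - insert 1 X" using x X'[of x] by (auto simp: A_def)
        qed
      qed (auto simp: A_def simp del: real_norm_def intro!: summn)
      also have "\<dots> = infsum (\<lambda>n. norm (f n)) {1..} - sum (\<lambda>n. norm (f n)) (insert 1 X)"
      proof -
        have "infsum (\<lambda>n. norm (f n)) {1..} = infsum (\<lambda>n. norm (f n)) (insert 1 X \<union> ({1..} - insert 1 X))"
          using X by (intro arg_cong2[where f = infsum]) auto
        also have "\<dots> = infsum (\<lambda>n. norm (f n)) (insert 1 X) + infsum (\<lambda>n. norm (f n)) ({1..} - insert 1 X)"
          using X by (intro infsum_Un_disjoint summn) auto
        finally show ?thesis using X by simp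
      qed
      also have "\<dots> < e" using Y[OF _ subset_insertI, of 1] X by (auto simp: dist_real_def)
      finally show "norm (infsum f (A N) - 1) < e" .
    qed
  qed
  thus ?thesis unfolding eq .
qed

section \<open>Real characters with bounded partial sums\<close>

text \<open>Bounded partial sums stand in for periodicity: they are what the argument consumes, and
  they also rule out a principal character.\<close>

locale bounded_real_character =
  fixes \<eta> :: "nat \<Rightarrow> real" and B :: real
  assumes eta_mult: "m > 0 \<Longrightarrow> n > 0 \<Longrightarrow> \<eta> (m * n) = \<eta> m * \<eta> n"
    and eta_0 [simp]: "\<eta> 0 = 0" and eta_1 [simp]: "\<eta> (Suc 0) = 1"
    and eta_range: "\<eta> n \<in> {-1, 0, 1}"
    and eta_sum: "\<bar>\<Sum>i\<in>{1..n}. \<eta> i\<bar> \<le> B"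
begin

lemma abs_eta_le: "\<bar>\<eta> n\<bar> \<le> 1"
  using eta_range[of n] by auto

lemma eta_power: "n > 0 \<Longrightarrow> \<eta> (n ^ k) = \<eta> n ^ k"
  by (induction k) (auto simp: eta_mult)

lemma B_ge_1: "B \<ge> 1"
  using eta_sum[of 1] by simp

text \<open>The divisors of \<open>p ^ k * m\<close> are uniquely of the form
  \<open>p ^ i * d\<close>. This is multiplicativity of the convolution of 1 with \<eta>, in the
  form that strips off one prime at a time.\<close>

lemma divisor_sum_split:
  assumes p: "prime p" and m: "\<not> p dvd m" "m > 0"
  shows "(\<Sum>d | d dvd p ^ k * m. \<eta> d) = (\<Sum>i\<le>k. \<eta> p ^ i) * (\<Sum>d | d dvd m. \<eta> d)"
proof -
  have p0: "p > 0" using p prime_gt_0_nat by blast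
  have "bij_betw (\<lambda>(i, d). p ^ i * d) ({..k} \<times> {d. d dvd m}) {d. d dvd p ^ k * m}"
    unfolding bij_betw_def
  proof
    show "inj_on (\<lambda>(i, d). p ^ i * d) ({..k} \<times> {d. d dvd m})"
    proof (rule inj_onI, clarify)
      fix i d j e assume "d dvd m" "e dvd m" and eq: "p ^ i * d = p ^ j * e"
      hence d: "\<not> p dvd d" "\<not> p dvd e" using m by (auto dest: dvd_trans)
      hence nz: "d \<noteq> 0" "e \<noteq> 0" by (auto intro: Nat.gr0I)
      have "multiplicity p (p ^ i * d) = i" "multiplicity p (p ^ j * e) = j"
        using d nz p by (auto simp: multiplicity_times_same not_dvd_imp_multiplicity_0
          prime_elem_multiplicity_mult_distrib)
      hence "i = j" using eq by simp
      thus "i = j \<and> d = e" using eq p0 by simp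
    qed
    show "(\<lambda>(i, d). p ^ i * d) ` ({..k} \<times> {d. d dvd m}) = {d. d dvd p ^ k * m}"
    proof (intro equalityI subsetI)
      fix x assume "x \<in> {d. d dvd p ^ k * m}"
      then obtain y z where yz: "x = y * z" "y dvd p ^ k" "z dvd m"
        by (auto elim: dvd_productE)
      then obtain i where "i \<le> k" "y = p ^ i" using p by (auto simp: divides_primepow_nat)
      thus "x \<in> (\<lambda>(i, d). p ^ i * d) ` ({..k} \<times> {d. d dvd m})" using yz by force
    next
      fix x assume "x \<in> (\<lambda>(i, d). p ^ i * d) ` ({..k} \<times> {d. d dvd m})"
      thus "x \<in> {d. d dvd p ^ k * m}" by (auto intro!: mult_dvd_mono le_imp_power_dvd)
    qed
  qed
  hence "(\<Sum>d | d dvd p ^ k * m. \<eta> d) = (\<Sum>(i, d)\<in>{..k} \<times> {d. d dvd m}. \<eta> (p ^ i * d))"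
    by (subst sum.reindex_bij_betw[symmetric]) (auto simp: case_prod_unfold)
  also have "\<dots> = (\<Sum>(i, d)\<in>{..k} \<times> {d. d dvd m}. \<eta> p ^ i * \<eta> d)"
    using p0 m by (intro sum.cong) (auto simp: eta_mult eta_power dvd_pos_nat)
  also have "\<dots> = (\<Sum>i\<le>k. \<eta> p ^ i) * (\<Sum>d | d dvd m. \<eta> d)"
    by (simp add: sum_product sum.cartesian_product)
  finally show ?thesis .
qed

text \<open>For \<open>x\<close> in {-1, 0, 1} the sum of \<open>x ^ i\<close> over
  \<open>i \<le> k\<close> is 0, 1 or \<open>k + 1\<close>, and it is at least 1 for even
  \<open>k\<close>; the divisor sum is a product of such factors.\<close>

lemma divisor_sum_nonneg: "n > 0 \<Longrightarrow> (\<Sum>d | d dvd n. \<eta> d) \<ge> 0"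
  and divisor_sum_square: "n > 0 \<Longrightarrow> (\<Sum>d | d dvd n ^ 2. \<eta> d) \<ge> 1"
proof -
  have geo: "(\<Sum>i\<le>k. x ^ i) \<ge> 0 \<and> (even k \<longrightarrow> (\<Sum>i\<le>k. x ^ i) \<ge> 1)" if "x \<in> {-1, 0, 1}" for x :: real and k
  proof -
    have "(\<Sum>i\<le>k. (-1) ^ i :: real) = (if even k then 1 else 0)" by (induction k) auto
    moreover have "(\<Sum>i\<le>k. 0 ^ i :: real) = 1" by (induction k) auto
    ultimately show ?thesis using that by auto
  qed
  have "n > 0 \<Longrightarrow> (\<Sum>d | d dvd n. \<eta> d) \<ge> 0 \<and> (\<Sum>d | d dvd n ^ 2. \<eta> d) \<ge> 1"
  proof (induction n rule: less_induct)
    case (less n)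
    show ?case
    proof (cases "n = 1")
      case False
      then obtain p where p: "prime p" "p dvd n" using prime_factor_nat by blast
      obtain m where m: "n = p ^ multiplicity p n * m" "\<not> p dvd m"
        using multiplicity_decompose'[of n p] p less.prems
        by (metis not_prime_unit not_less_zero)
      define k where "k = multiplicity p n"
      have nk: "n = p ^ k * m" using m by (simp add: k_def)
      have k: "k > 0" using p less.prems by (simp add: k_def prime_multiplicity_gt_zero_iff)
      have mpos: "m > 0" using m less.prems by (intro Nat.gr0I) auto
      have "m < n" using k p mpos unfolding nk
        by (metis One_nat_def less_1_mult mult_less_cancel2 nat_mult_1 one_less_power prime_gt_1_nat)
      note IH = less.IH[OF this mpos]
      have "\<not> p dvd m ^ 2" using m p prime_dvd_power_nat by blast
      have n2: "n ^ 2 = p ^ (2 * k) * m ^ 2" by (simp add: nk power_mult_distrib mult.commute flip: power_mult)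
      have "(\<Sum>d | d dvd n. \<eta> d) = (\<Sum>i\<le>k. \<eta> p ^ i) * (\<Sum>d | d dvd m. \<eta> d)"
        unfolding nk by (rule divisor_sum_split) (use p m mpos in auto)
      moreover have "(\<Sum>d | d dvd n ^ 2. \<eta> d) = (\<Sum>i\<le>2*k. \<eta> p ^ i) * (\<Sum>d | d dvd m ^ 2. \<eta> d)"
        unfolding n2 by (rule divisor_sum_split) (use p \<open>\<not> p dvd m ^ 2\<close> mpos in auto)
      ultimately show ?thesis
        using geo[OF eta_range[of p], of k] geo[OF eta_range[of p], of "2 * k"] IH mult_mono[of 1 "\<Sum>i\<le>2*k. \<eta> p ^ i" 1]
        by simp
    qed simp
  qed
  thus "n > 0 \<Longrightarrow> (\<Sum>d | d dvd n. \<eta> d) \<ge> 0" "n > 0 \<Longrightarrow> (\<Sum>d | d dvd n ^ 2. \<eta> d) \<ge> 1" by auto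
qed

definition L1 :: real where "L1 = (\<Sum>n. \<eta> n / real n)"

text \<open>Partial summation against \<open>1 / n\<close> yields not only convergence but a rate;
  the rate keeps the error bounded when \<open>L1\<close> is split off in
  \<open>mertens_mangoldt\<close>.\<close>

lemma L1_sums: "(\<lambda>n. \<eta> n / real n) sums L1"
  and L1_approx: "\<bar>(\<Sum>j\<in>{1..N}. \<eta> j / real j) - L1\<bar> \<le> 2 * B / real (N + 1)"
proof -
  have tail: "\<bar>\<Sum>n\<in>{N..M}. \<eta> n / real n\<bar> \<le> 2 * B / real N" if "N \<ge> 1" for N M
    using tail_bound[of \<eta> B N "\<lambda>n. 1 / real n" M] eta_sum that by (auto simp: field_simps)
  have "summable (\<lambda>n. \<eta> n / real n)"
    by (rule uniform_tail_continuous(2)[where S = UNIV and u = "\<lambda>n _. \<eta> n / real n" and start = 1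
          and \<epsilon> = "\<lambda>N. 2 * B / real N"])
       (use tail in \<open>auto intro!: continuous_on_const lim_const_over_n\<close>)
  thus L: "(\<lambda>n. \<eta> n / real n) sums L1" unfolding L1_def by (rule summable_sums)
  have lim: "(\<lambda>M. \<bar>\<Sum>j\<in>{N+1..M}. \<eta> j / real j\<bar>) \<longlonglongrightarrow> \<bar>L1 - (\<Sum>j\<in>{1..N}. \<eta> j / real j)\<bar>"
  proof (rule tendsto_rabs, rule Lim_transform_eventually)
    show "(\<lambda>M. (\<Sum>j\<le>M. \<eta> j / real j) - (\<Sum>j\<in>{1..N}. \<eta> j / real j)) \<longlonglongrightarrow> L1 - (\<Sum>j\<in>{1..N}. \<eta> j / real j)"
      using L by (intro tendsto_intros) (simp add: sums_def_le)
    show "\<forall>\<^sub>F M in sequentially. (\<Sum>j\<le>M. \<eta> j / real j) - (\<Sum>j\<in>{1..N}. \<eta> j / real j) =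
            (\<Sum>j\<in>{N+1..M}. \<eta> j / real j)"
    proof (rule eventually_mono[OF eventually_ge_at_top[of N]])
      fix M assume "N \<le> M"
      hence "{..M} = {0} \<union> {1..N} \<union> {N+1..M}" by auto
      thus "(\<Sum>j\<le>M. \<eta> j / real j) - (\<Sum>j\<in>{1..N}. \<eta> j / real j) = (\<Sum>j\<in>{N+1..M}. \<eta> j / real j)"
        by (simp add: sum.union_disjoint)
    qed
  qed
  have "\<bar>L1 - (\<Sum>j\<in>{1..N}. \<eta> j / real j)\<bar> \<le> 2 * B / real (N + 1)"
    by (rule tendsto_upperbound[OF lim]) (use tail[of "N+1"] in \<open>auto intro!: always_eventually\<close>)
  thus "\<bar>(\<Sum>j\<in>{1..N}. \<eta> j / real j) - L1\<bar> \<le> 2 * B / real (N + 1)" by (simp add: abs_minus_commute)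
qed

end

section \<open>Nonvanishing of L(1)\<close>

lemma geometric_sum_ge:
  fixes t :: real assumes "0 < t" "t < 1"
  shows "(\<Sum>i<n. t ^ i) \<ge> real n * sqrt t ^ (n - 1)"
proof (cases "n = 0")
  case False
  define u where "u = sqrt t"
  have u: "u ^ 2 = t" "u \<ge> 0" using assms by (auto simp: u_def)
  \<comment> \<open>Arithmetic-geometric mean for the terms \<open>i\<close> and
    \<open>n - 1 - i\<close>, whose product is \<open>t ^ (n - 1)\<close> for every
    \<open>i\<close>.\<close>
  have amgm: "2 * u ^ (n - 1) \<le> t ^ i + t ^ (n - Suc i)" if "i < n" for i
  proof -
    have "0 \<le> (u ^ i - u ^ (n - Suc i)) ^ 2" by simp
    also have "\<dots> = t ^ i + t ^ (n - Suc i) - 2 * u ^ (i + (n - Suc i))"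
      by (simp add: power2_eq_square algebra_simps power_add power_mult_distrib flip: u(1))
    also have "i + (n - Suc i) = n - 1" using that by simp
    finally show ?thesis by simp
  qed
  have "2 * (real n * u ^ (n - 1)) = (\<Sum>i<n. 2 * u ^ (n - 1))" by simp
  also have "\<dots> \<le> (\<Sum>i<n. t ^ i + t ^ (n - Suc i))" by (intro sum_mono amgm) auto
  also have "\<dots> = 2 * (\<Sum>i<n. t ^ i)"
    by (simp add: sum.distrib sum.nat_diff_reindex)
  finally show ?thesis by (simp add: u_def)
qed auto

text \<open>\<open>b n\<close> compares the Lambert kernel with its pole at \<open>t = 1\<close>.
  Multiplied by \<open>1 - t\<close> it is \<open>1 / n - t ^ n / S n\<close> with
  \<open>S n = 1 + ... + t ^ (n - 1)\<close>, and monotonicity becomes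
  \<open>n * (n + 1) * t ^ n \<le> S n * S (n + 1)\<close>, which the geometric mean bound
  supplies.\<close>

lemma lambert_kernel_antimono:
  fixes t :: real assumes t: "0 < t" "t < 1" and n: "n \<ge> 1"
  defines "b \<equiv> (\<lambda>n. 1 / (real n * (1 - t)) - t ^ n / (1 - t ^ n))"
  shows "b (Suc n) \<le> b n" "b n \<ge> 0"
proof -
  define S where "S = (\<lambda>n. \<Sum>i<n. t ^ i)"
  have S: "1 - t ^ n = (1 - t) * S n" for n unfolding S_def by (rule one_diff_power_eq)
  have S_ge: "S n \<ge> real n * sqrt t ^ (n - 1)" for n unfolding S_def using geometric_sum_ge[OF t] .
  have Spos: "S n > 0" if "n \<ge> 1" for n
  proof -
    have "0 < real n * sqrt t ^ (n - 1)" using t that by simp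
    thus ?thesis using S_ge[of n] by linarith
  qed
  have "sqrt t < 1" using t by (simp add: real_sqrt_lt_1_iff)
  have sq: "sqrt t ^ (2 * k) = t ^ k" for k using t by (simp add: power_mult)
  \<comment> \<open>Giving away one factor \<open>sqrt t\<close> leaves the exponent
    \<open>2 * n - 1 = (n - 1) + n\<close>, which matches the lower bounds for \<open>S n\<close>
    and \<open>S (Suc n)\<close>.\<close>
  have "real n * (real n + 1) * t ^ n \<le> real n * (real n + 1) * sqrt t ^ (2 * n - 1)"
    unfolding sq[symmetric] using \<open>sqrt t < 1\<close> t by (intro mult_left_mono power_decreasing) auto
  also have "sqrt t ^ (2 * n - 1) = sqrt t ^ (n - 1) * sqrt t ^ (Suc n - 1)"
    using n by (simp flip: power_add) (simp add: mult_2)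
  also have "real n * (real n + 1) * \<dots> = (real n * sqrt t ^ (n - 1)) * (real (Suc n) * sqrt t ^ (Suc n - 1))"
    by simp
  also have "\<dots> \<le> S n * S (Suc n)"
    by (intro mult_mono S_ge less_imp_le[OF Spos] n) (use t in auto)
  finally have key: "real n * (real n + 1) * t ^ n \<le> S n * S (Suc n)" .
  have S_Suc: "S (Suc n) = S n + t ^ n" by (simp add: S_def)
  have "t ^ n / (S n * S (Suc n)) \<le> 1 / (real n * (real n + 1))"
    using key n Spos[OF n] Spos[of "Suc n"] by (simp add: divide_le_eq pos_le_divide_eq) (simp add: mult_ac)
  moreover have "t ^ n / S n - t ^ Suc n / S (Suc n) = t ^ n / (S n * S (Suc n))"
  proof -
    have "t ^ n / S n - t ^ Suc n / S (Suc n) = t ^ n * (S (Suc n) - t * S n) / (S n * S (Suc n))"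
      using Spos[OF n] Spos[of "Suc n"] by (simp add: field_simps)
    also have "S (Suc n) - t * S n = 1" using S[of n] S_Suc by (simp add: algebra_simps)
    finally show ?thesis by simp
  qed
  moreover have "1 / real n - 1 / (real n + 1) = 1 / (real n * (real n + 1))"
    using n by (simp add: field_simps)
  ultimately have "(1 / (real n + 1) - t ^ Suc n / S (Suc n)) / (1 - t) \<le> (1 / real n - t ^ n / S n) / (1 - t)"
    using t by (intro divide_right_mono) linarith+
  thus "b (Suc n) \<le> b n" using t n Spos[OF n] Spos[of "Suc n"]
    unfolding b_def S by (simp add: diff_divide_distrib mult.commute add.commute)
  have "S n \<ge> real n * t ^ n"
  proof -
    have "(\<Sum>i<n. t ^ n) \<le> S n" unfolding S_def using t by (intro sum_mono power_decreasing) auto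
    thus ?thesis by simp
  qed
  hence "t ^ n / S n \<le> 1 / real n" using Spos[OF n] n by (simp add: field_simps)
  hence "(1 / real n - t ^ n / S n) / (1 - t) \<ge> 0" using t by simp
  thus "b n \<ge> 0" using t n Spos[OF n]
    unfolding b_def S by (simp add: diff_divide_distrib mult.commute)
qed

context bounded_real_character
begin

text \<open>
  Monsky's argument: if \<open>L(1) = 0\<close>, the Lambert series \<open>\<Sum>\<eta>(n) t\<^sup>n/(1 - t\<^sup>n)\<close> stays bounded as
  \<open>t \<rightarrow> 1\<close>, although it dominates \<open>\<Sum>t^(k^2)\<close>.
\<close>

lemma L1_nonzero: "L1 \<noteq> 0"
proof
  assume L0: "L1 = 0"
  have bound: "real K * t ^ (K ^ 2) \<le> B" if t: "0 < t" "t < 1" for t :: real and K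
  proof (rule tendsto_lowerbound)
    define b where "b = (\<lambda>n. 1 / (real n * (1 - t)) - t ^ n / (1 - t ^ n))"
    \<comment> \<open>The three terms are the partial sum of \<open>L1\<close>, which tends to 0 by
      assumption; the bound \<open>B * b 1\<close> with \<open>b 1 = 1\<close>; and the cost of
      truncating \<open>M\<close> inner geometric series.\<close>
    show "(\<lambda>M. (\<Sum>n\<in>{1..M}. \<eta> n / real n) / (1 - t) + B + real M * t ^ M / (1 - t)) \<longlonglongrightarrow> B"
    proof -
      have "(\<lambda>M. \<Sum>n\<in>{1..M}. \<eta> n / real n) \<longlonglongrightarrow> L1"
      proof (rule Lim_transform_eventually)
        show "(\<lambda>M. \<Sum>n\<le>M. \<eta> n / real n) \<longlonglongrightarrow> L1" using L1_sums by (simp add: sums_def_le)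
        show "\<forall>\<^sub>F M in sequentially. (\<Sum>n\<le>M. \<eta> n / real n) = (\<Sum>n\<in>{1..M}. \<eta> n / real n)"
          by (intro always_eventually allI sum.mono_neutral_right) (auto simp: not_le)
      qed
      moreover have "(\<lambda>M. real M * t ^ M) \<longlonglongrightarrow> 0" using powser_times_n_limit_0[of t] t by simp
      ultimately have "(\<lambda>M. (\<Sum>n\<in>{1..M}. \<eta> n / real n) / (1 - t) + B + real M * t ^ M / (1 - t))
          \<longlonglongrightarrow> L1 / (1 - t) + B + 0 / (1 - t)"
        using t by (intro tendsto_intros) auto
      thus ?thesis using L0 by simp
    qed
    show "\<forall>\<^sub>F M in sequentially. real K * t ^ (K ^ 2) \<le>
            (\<Sum>n\<in>{1..M}. \<eta> n / real n) / (1 - t) + B + real M * t ^ M / (1 - t)"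
    proof (rule eventually_mono[OF eventually_ge_at_top[of "K ^ 2"]])
      fix M assume M: "K ^ 2 \<le> M"
      have "real K * t ^ (K ^ 2) = (\<Sum>k\<in>{1..K}. t ^ (K ^ 2))" by simp
      also have "\<dots> \<le> (\<Sum>k\<in>{1..K}. t ^ (k ^ 2))"
        using t by (intro sum_mono power_decreasing) auto
      also have "\<dots> \<le> (\<Sum>k\<in>{1..K}. (\<Sum>d | d dvd k ^ 2. \<eta> d) * t ^ (k ^ 2))"
        using divisor_sum_square t by (intro sum_mono) (auto simp: mult_le_cancel_right1)
      also have "\<dots> = (\<Sum>n\<in>(\<lambda>k. k ^ 2) ` {1..K}. (\<Sum>d | d dvd n. \<eta> d) * t ^ n)"
        by (subst sum.reindex) (auto simp: inj_on_def)
      \<comment> \<open>Passing from the squares to all \<open>n\<close> only adds nonnegative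
        terms.\<close>
      also have "\<dots> \<le> (\<Sum>n\<in>{1..M}. (\<Sum>d | d dvd n. \<eta> d) * t ^ n)"
      proof (intro sum_mono2 mult_nonneg_nonneg divisor_sum_nonneg)
        show "(\<lambda>k. k ^ 2) ` {1..K} \<subseteq> {1..M}"
          using M by (auto intro: order.trans[OF power_mono])
      qed (use t in auto)
      also have "\<dots> = (\<Sum>n\<in>{1..M}. \<Sum>d | d dvd n. \<eta> d * t ^ (d * (n div d)))"
        by (intro sum.cong) (auto simp: sum_distrib_right)
      also have "\<dots> = (\<Sum>d\<in>{1..M}. \<Sum>j\<in>{1..M div d}. \<eta> d * t ^ (d * j))"
        by (rule sum_divisors_swap)
      also have "\<dots> \<le> (\<Sum>d\<in>{1..M}. \<eta> d * (t ^ d / (1 - t ^ d)) + t ^ M / (1 - t))"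
      proof (rule sum_mono)
        fix d assume d: "d \<in> {1..M}"
        have td: "t ^ d \<le> t" "t ^ d < 1" using d t power_decreasing[of 1 d t] by auto
        define J where "J = M div d"
        have "(\<Sum>j\<in>{1..J}. t ^ (d * j)) = t ^ d / (1 - t ^ d) - t ^ (d * (J + 1)) / (1 - t ^ d)"
        proof -
          have "(\<Sum>j\<in>{1..J}. t ^ (d * j)) = (\<Sum>j\<in>{1..J}. (t ^ d) ^ j)" by (simp add: power_mult)
          also have "\<dots> = (t ^ d - (t ^ d) ^ Suc J) / (1 - t ^ d)"
            using td by (subst sum_gp) auto
          finally show ?thesis by (simp add: diff_divide_distrib power_add distrib_left mult_ac flip: power_mult)
        qed
        moreover have "t ^ (d * (J + 1)) / (1 - t ^ d) \<le> t ^ M / (1 - t)"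
        proof (rule frac_le)
          have "M \<le> d * (J + 1)" using dividend_less_times_div[of d M] d by (simp add: J_def)
          thus "t ^ (d * (J + 1)) \<le> t ^ M" using t by (intro power_decreasing) auto
        qed (use t td in auto)
        moreover have "t ^ (d * (J + 1)) / (1 - t ^ d) \<ge> 0" using t td by simp
        ultimately have "\<bar>(\<Sum>j\<in>{1..J}. t ^ (d * j)) - t ^ d / (1 - t ^ d)\<bar> \<le> t ^ M / (1 - t)"
          by linarith
        hence "\<bar>\<eta> d\<bar> * \<bar>(\<Sum>j\<in>{1..J}. t ^ (d * j)) - t ^ d / (1 - t ^ d)\<bar> \<le> 1 * (t ^ M / (1 - t))"
          by (intro mult_mono abs_eta_le) auto
        hence "\<eta> d * ((\<Sum>j\<in>{1..J}. t ^ (d * j)) - t ^ d / (1 - t ^ d)) \<le> t ^ M / (1 - t)"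
          unfolding abs_mult[symmetric] by linarith
        thus "(\<Sum>j\<in>{1..M div d}. \<eta> d * t ^ (d * j)) \<le> \<eta> d * (t ^ d / (1 - t ^ d)) + t ^ M / (1 - t)"
          by (simp add: J_def algebra_simps sum_distrib_left)
      qed
      also have "\<dots> = (\<Sum>d\<in>{1..M}. \<eta> d / real d) / (1 - t) - (\<Sum>d\<in>{1..M}. \<eta> d * b d) + real M * t ^ M / (1 - t)"
        by (simp add: b_def sum.distrib sum_divide_distrib algebra_simps sum_subtractf)
      also have "\<dots> \<le> (\<Sum>n\<in>{1..M}. \<eta> n / real n) / (1 - t) + B + real M * t ^ M / (1 - t)"
      proof -
        have "\<bar>\<Sum>d\<in>{1..M}. \<eta> d * b d\<bar> \<le> B * b 1"
          by (rule summation_by_parts_bound) (use eta_sum lambert_kernel_antimono[OF t] in \<open>auto simp: b_def\<close>)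
        moreover have "b 1 = 1" using t by (simp add: b_def field_simps)
        ultimately have "\<bar>\<Sum>d\<in>{1..M}. \<eta> d * b d\<bar> \<le> B" by simp
        thus ?thesis by linarith
      qed
      finally show "real K * t ^ (K ^ 2) \<le>
            (\<Sum>n\<in>{1..M}. \<eta> n / real n) / (1 - t) + B + real M * t ^ M / (1 - t)" .
    qed
  qed auto
  \<comment> \<open>With \<open>K\<close> fixed the bound survives \<open>t\<close> tending to 1 and
    becomes \<open>K \<le> B\<close>, whatever \<open>K\<close> is.\<close>
  obtain K :: nat where K: "real K > B" using reals_Archimedean2 by blast
  have "real K * 1 ^ (K ^ 2) \<le> B"
  proof (rule tendsto_upperbound)
    show "((\<lambda>t. real K * t ^ (K ^ 2)) \<longlongrightarrow> real K * 1 ^ (K ^ 2)) (at_left 1)"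
      by (intro tendsto_intros)
    have "\<forall>\<^sub>F t in at_left (1::real). t \<in> {0<..<1}" by (rule eventually_at_leftI[of 0]) auto
    thus "\<forall>\<^sub>F t in at_left 1. real K * t ^ (K ^ 2) \<le> B"
      by eventually_elim (use bound in auto)
  qed auto
  thus False using K by simp
qed

end

section \<open>Chebyshev and Mertens estimates\<close>

lemma ln_fact_eq_sum_mangoldt:
  "ln (fact N) = (\<Sum>d\<in>{1..N}. mangoldt d * real (N div d))"
proof -
  have "ln (fact N :: real) = (\<Sum>n\<in>{1..N}. ln (real n))"
    by (induction N) (auto simp: ln_mult)
  also have "\<dots> = (\<Sum>n\<in>{1..N}. \<Sum>d | d dvd n. mangoldt d)"
    by (intro sum.cong) (auto simp: mangoldt_sum)
  also have "\<dots> = (\<Sum>d\<in>{1..N}. \<Sum>j\<in>{1..N div d}. mangoldt d)"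
    by (rule sum_divisors_swap)
  finally show ?thesis by (simp add: mult.commute)
qed

text \<open>Chebyshev's argument: \<open>ln (2 * n choose n)\<close> is the sum of
  \<open>mangoldt d\<close> times \<open>2 * n div d - 2 * (n div d)\<close>. The second factor is
  nonnegative and equals 1 for \<open>n < d \<le> 2 * n\<close>; the binomial coefficient is at most
  \<open>4 ^ n\<close>, and \<open>ln 4 \<le> 2\<close>.\<close>

lemma sum_mangoldt_double:
  "(\<Sum>d\<in>{1..2*n}. mangoldt d) \<le> (\<Sum>d\<in>{1..n}. mangoldt d) + real n * 2"
proof -
  have "(\<Sum>d\<in>{1..2*n}. mangoldt d) = (\<Sum>d\<in>{1..n}. mangoldt d) + (\<Sum>d\<in>{n<..2*n}. mangoldt d :: real)"
    by (subst sum.union_disjoint[symmetric]) (auto intro!: sum.cong)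
  also have "(\<Sum>d\<in>{n<..2*n}. mangoldt d) \<le>
      (\<Sum>d\<in>{n<..2*n}. mangoldt d * (real (2 * n div d) - 2 * real (n div d)))"
  proof (rule sum_mono)
    fix d assume "d \<in> {n<..2*n}"
    hence "2 * n div d = 1" "n div d = 0" by (auto intro: div_nat_eqI)
    thus "mangoldt d \<le> mangoldt d * (real (2 * n div d) - 2 * real (n div d))" by simp
  qed
  also have "\<dots> \<le> (\<Sum>d\<in>{1..2*n}. mangoldt d * (real (2 * n div d) - 2 * real (n div d)))"
  proof (rule sum_mono2)
    fix d
    have "2 * (n div d) \<le> 2 * n div d"
      by (metis div_mult_self1_is_m div_times_less_eq_dividend less_eq_div_iff_mult_less_eq mult.assoc
          bot_nat_0.not_eq_extremum div_by_0 mult_0_right order_refl mult_le_mono2)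
    hence "2 * real (n div d) \<le> real (2 * n div d)"
      by (metis of_nat_le_iff of_nat_mult of_nat_numeral)
    thus "0 \<le> mangoldt d * (real (2 * n div d) - 2 * real (n div d))"
      by (intro mult_nonneg_nonneg mangoldt_nonneg) simp
  qed auto
  also have "\<dots> = ln (fact (2 * n)) - 2 * (\<Sum>d\<in>{1..2*n}. mangoldt d * real (n div d))"
    by (simp add: ln_fact_eq_sum_mangoldt sum_distrib_left sum_subtractf algebra_simps)
  also have "(\<Sum>d\<in>{1..2*n}. mangoldt d * real (n div d)) = ln (fact n)"
    unfolding ln_fact_eq_sum_mangoldt by (rule sum.mono_neutral_right) auto
  also have "ln (fact (2 * n)) - 2 * ln (fact n) \<le> real n * ln (4::real)"
  proof -
    have "fact (2 * n) = (fact n * fact n * real (2 * n choose n) :: real)"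
      using binomial_fact_lemma[of n "2 * n"] by (metis (mono_tags, opaque_lifting) add_diff_cancel_left' le_add1 mult_2 of_nat_fact of_nat_mult)
    hence "ln (fact (2 * n) :: real) = 2 * ln (fact n) + ln (real (2 * n choose n))"
      by (simp add: ln_mult)
    moreover have "ln (real (2 * n choose n)) \<le> ln (4 ^ n)"
    proof -
      have "real (2 * n choose n) \<le> 2 ^ (2 * n)"
        using binomial_le_pow2[of "2 * n" n] by (metis of_nat_le_iff of_nat_numeral of_nat_power)
      thus ?thesis by (simp add: power_mult)
    qed
    ultimately show ?thesis by (simp add: ln_realpow)
  qed
  also have "ln (4::real) \<le> 2"
  proof -
    have "ln (4::real) = 2 * ln 2" using ln_realpow[of 2 2] by simp
    thus ?thesis using ln_2_less_1 by simp
  qed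
  finally show ?thesis by (simp add: mult_left_mono)
qed

text \<open>The constant 4 closes the halving induction: \<open>4 * n + 2 * n = 6 * n\<close>
  suffices for \<open>N = 2 * n\<close>, and an odd \<open>N\<close> adds at most
  \<open>ln N \<le> N - 1 = 2 * n\<close>.\<close>

lemma sum_mangoldt_le: "(\<Sum>d\<in>{1..N}. mangoldt d) \<le> 4 * real N"
proof (induction N rule: less_induct)
  case (less N)
  show ?case
  proof (cases "N \<le> 1")
    case True
    thus ?thesis by (cases N) auto
  next
    case False
    define n where "n = N div 2"
    have IH: "(\<Sum>d\<in>{1..2*n}. mangoldt d) \<le> 6 * real n"
      using less.IH[of n] sum_mangoldt_double[of n] False by (simp add: n_def)
    consider "N = 2 * n" | "N = 2 * n + 1" unfolding n_def by linarith
    thus ?thesis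
    proof cases
      case 2
      have "mangoldt N \<le> ln (real N)" using False by (intro mangoldt_le) simp
      also have "\<dots> \<le> real N - 1" using False by (intro ln_le_minus_one) simp
      finally show ?thesis using IH 2 by simp
    qed (use IH in simp)
  qed
qed

text \<open>The decrease reduces to \<open>n * ln (1 + 1 / n) \<le> 1 \<le> ln n\<close>; the second
  inequality is where \<open>n\<close> must exceed Euler's number.\<close>

lemma ln_over_self_antimono:
  assumes "n \<ge> 3" shows "ln (real (Suc n)) / real (Suc n) \<le> ln (real n) / real n"
proof -
  have "real (Suc n) = real n * (1 + 1 / real n)" using assms by (simp add: field_simps)
  hence "ln (real (Suc n)) = ln (real n) + ln (1 + 1 / real n)"
    using assms by (simp only:) (rule ln_mult_pos, auto intro: add_pos_pos)
  hence "ln (real (Suc n)) - ln (real n) = ln (1 + 1 / real n)" by simp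
  also have "\<dots> \<le> 1 / real n" by (rule ln_add_one_self_le_self) simp
  finally have "real n * (ln (real (Suc n)) - ln (real n)) \<le> 1"
    using assms by (simp add: field_simps)
  also have "1 \<le> ln (real n)"
    using assms e_less_272 by (subst ln_ge_iff) auto
  finally show ?thesis using assms by (simp add: field_simps)
qed

text \<open>Only exponents \<open>k \<ge> 2\<close> occur, and the geometric series leaves
  \<open>ln p\<close> times at most \<open>2 / p ^ 2\<close>. With
  \<open>ln p \<le> 2 * sqrt p\<close> this is at most \<open>4 * p powr (-3/2)\<close>, whose sum
  converges.\<close>

lemma mangoldt_nonprime_bound:
  obtains C where "\<And>N. (\<Sum>n | n \<in> {1..N} \<and> \<not> prime n. mangoldt n / real n) \<le> C"
proof
  fix N
  define g where "g = (\<lambda>p. 4 * real p powr (-3/2))"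
  have "summable (\<lambda>p. real p powr (-3/2))" by (simp add: summable_real_powr_iff)
  hence sg: "summable g" unfolding g_def by (rule summable_mult)
  have "(\<Sum>n | n \<in> {1..N} \<and> \<not> prime n. mangoldt n / real n) =
        (\<Sum>n | n \<in> {1..N} \<and> primepow n \<and> \<not> prime n. mangoldt n / real n)"
    by (rule sum.mono_neutral_right) (auto simp: mangoldt_def)
  also have "\<dots> \<le> (\<Sum>n\<in>(\<lambda>(p, k). p ^ k) ` ({p\<in>{2..N}. prime p} \<times> {2..N}). mangoldt n / real n)"
  proof (intro sum_mono2 subsetI)
    fix n assume "n \<in> {n. n \<in> {1..N} \<and> primepow n \<and> \<not> prime n}"
    hence n: "n \<le> N" "primepow n" "\<not> prime n" by auto
    then obtain p k where pk: "prime p" "k > 0" "n = p ^ k" by (auto simp: primepow_def)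
    hence "k \<noteq> 1" using n by auto
    moreover have "p \<le> p ^ k" using pk prime_gt_0_nat by (intro self_le_power) (auto simp: Suc_le_eq)
    moreover have "k < p ^ k" using pk prime_gt_1_nat by (intro less_exp[THEN less_le_trans] power_mono) (auto simp: prime_ge_2_nat)
    ultimately show "n \<in> (\<lambda>(p, k). p ^ k) ` ({p\<in>{2..N}. prime p} \<times> {2..N})"
      using pk n by (intro image_eqI[of _ _ "(p, k)"]) (auto simp: prime_ge_2_nat)
  qed (auto simp: mangoldt_nonneg)
  also have "\<dots> \<le> (\<Sum>(p, k)\<in>{p\<in>{2..N}. prime p} \<times> {2..N}. mangoldt (p ^ k) / real (p ^ k))"
    using sum_image_le[of "{p\<in>{2..N}. prime p} \<times> {2..N}" "\<lambda>n. mangoldt n / real n" "\<lambda>(p, k). p ^ k"]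
    by (simp add: case_prod_unfold o_def mangoldt_nonneg)
  also have "\<dots> = (\<Sum>p | p \<in> {2..N} \<and> prime p. \<Sum>k\<in>{2..N}. ln (real p) * (1 / real p) ^ k)"
    by (subst sum.cartesian_product[symmetric])
       (auto intro!: sum.cong simp: power_divide)
  also have "\<dots> \<le> (\<Sum>p | p \<in> {2..N} \<and> prime p. g p)"
  proof (rule sum_mono)
    fix p assume p: "p \<in> {p. p \<in> {2..N} \<and> prime p}"
    define x where "x = 1 / real p"
    have x: "0 < x" "x \<le> 1 / 2" using p by (auto simp: x_def field_simps)
    have "(\<Sum>k\<in>{2..N}. x ^ k) \<le> x ^ 2 / (1 - x)"
      using x p by (subst sum_gp) (auto intro!: divide_right_mono)
    also have "\<dots> \<le> x ^ 2 / (1 / 2)" using x by (intro divide_left_mono) auto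
    finally have 1: "(\<Sum>k\<in>{2..N}. x ^ k) \<le> 2 * x ^ 2" by simp
    have "ln (real p) = 2 * ln (sqrt (real p))" using p by (simp add: ln_sqrt)
    also have "\<dots> \<le> 2 * sqrt (real p)" using ln_le_minus_one[of "sqrt (real p)"] p by simp
    finally have 2: "ln (real p) \<le> 2 * sqrt (real p)" .
    have "(\<Sum>k\<in>{2..N}. ln (real p) * x ^ k) \<le> (2 * sqrt (real p)) * (2 * x ^ 2)"
      unfolding sum_distrib_left[symmetric] using 1 2 x p
      by (intro mult_mono sum_nonneg) auto
    also have "\<dots> = 4 * (real p powr (1/2) * real p powr (-2))"
      using p by (simp add: x_def powr_half_sqrt powr_minus powr_numeral field_simps)
    also have "\<dots> = g p" by (simp add: g_def flip: powr_add)
    finally show "(\<Sum>k\<in>{2..N}. ln (real p) * (1 / real p) ^ k) \<le> g p" by (simp add: x_def)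
  qed
  also have "\<dots> \<le> suminf g"
    by (rule sum_le_suminf[OF sg]) (auto simp: g_def)
  finally show "(\<Sum>n | n \<in> {1..N} \<and> \<not> prime n. mangoldt n / real n) \<le> (\<Sum>p. 4 * real p powr (-3/2))"
    by (simp add: g_def)
qed

context bounded_real_character
begin

text \<open>The sum of \<open>\<eta> n * ln n / n\<close> is bounded by partial summation. Expanding
  \<open>ln n\<close> as the divisor sum of \<open>mangoldt\<close> shows it to be \<open>L1\<close>
  times the sought sum, up to a bounded error, and \<open>L1_nonzero\<close> allows the
  division.\<close>

lemma mertens_mangoldt:
  obtains C where "\<And>N. \<bar>\<Sum>d\<in>{1..N}. \<eta> d * mangoldt d / real d\<bar> \<le> C"
proof -
  define T where "T = (\<lambda>N. \<Sum>n\<in>{1..N}. \<eta> n * (ln (real n) / real n))"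
  define M where "M = (\<lambda>N. \<Sum>d\<in>{1..N}. \<eta> d * mangoldt d / real d)"
  \<comment> \<open>Since \<open>ln n / n\<close> decreases only from 3 on, the terms with
    \<open>n < 3\<close> are estimated crudely and the rest through
    \<open>tail_bound\<close>.\<close>
  define C1 where "C1 = 3 * ln 3 + 2 * B * (ln 3 / 3)"
  have T: "\<bar>T N\<bar> \<le> C1" for N
  proof -
    have "\<bar>T N\<bar> = \<bar>(\<Sum>n | n \<in> {1..N} \<and> n < 3. \<eta> n * (ln (real n) / real n)) +
                 (\<Sum>n\<in>{3..N}. \<eta> n * (ln (real n) / real n))\<bar>"
      unfolding T_def by (subst sum.union_disjoint[symmetric]) (auto intro!: sum.cong arg_cong[where f = abs])
    moreover have "\<bar>\<Sum>n\<in>{3..N}. \<eta> n * (ln (real n) / real n)\<bar> \<le> 2 * B * (ln 3 / 3)"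
      using tail_bound[of \<eta> B 3 "\<lambda>n. ln (real n) / real n" N] eta_sum ln_over_self_antimono by auto
    moreover have "\<bar>\<Sum>n | n \<in> {1..N} \<and> n < 3. \<eta> n * (ln (real n) / real n)\<bar> \<le>
        (\<Sum>n | n \<in> {1..N} \<and> n < 3. ln 3)"
    proof (rule order.trans[OF sum_abs sum_mono])
      fix n assume n: "n \<in> {n. n \<in> {1..N} \<and> n < 3}"
      hence "\<bar>\<eta> n\<bar> * (ln (real n) / real n) \<le> 1 * (ln 3 / 1)"
        by (intro mult_mono frac_le abs_eta_le) auto
      thus "\<bar>\<eta> n * (ln (real n) / real n)\<bar> \<le> ln 3" using n by (simp add: abs_mult)
    qed
    moreover have "(\<Sum>n | n \<in> {1..N} \<and> n < 3. ln (3::real)) \<le> 3 * ln 3"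
      using sum_mono2[of "{..<3::nat}" "{n. n \<in> {1..N} \<and> n < 3}" "\<lambda>_. ln (3::real)"] by auto
    ultimately show ?thesis unfolding C1_def by linarith
  qed
  \<comment> \<open>The error at \<open>d\<close> is at most \<open>2 * B * mangoldt d / N\<close>,
    since the rate in \<open>L1_approx\<close> compensates the denominator \<open>d\<close>;
    Chebyshev's bound \<open>4 * N\<close> then gives \<open>8 * B\<close>.\<close>
  have TM: "\<bar>T N - L1 * M N\<bar> \<le> 8 * B" for N
  proof (cases "N = 0")
    case False
    have "T N = (\<Sum>n\<in>{1..N}. \<Sum>d | d dvd n. (\<eta> d * mangoldt d / real d) * (\<eta> (n div d) / real (n div d)))"
      unfolding T_def
    proof (rule sum.cong[OF refl])
      fix n assume n: "n \<in> {1..N}"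
      have "\<eta> n * (ln (real n) / real n) = (\<Sum>d | d dvd n. \<eta> n / real n * mangoldt d)"
        using mangoldt_sum[of n, where 'a = real] n by (subst sum_distrib_left[symmetric]) simp
      also have "\<dots> = (\<Sum>d | d dvd n. (\<eta> d * mangoldt d / real d) * (\<eta> (n div d) / real (n div d)))"
      proof (rule sum.cong[OF refl])
        fix d assume d: "d \<in> {d. d dvd n}"
        then obtain j where j: "n = d * j" by auto
        hence "d > 0" "j > 0" using n by auto
        thus "\<eta> n / real n * mangoldt d = (\<eta> d * mangoldt d / real d) * (\<eta> (n div d) / real (n div d))"
          using j by (simp add: eta_mult)
      qed
      finally show "\<eta> n * (ln (real n) / real n) = \<dots>" .
    qed
    also have "\<dots> = (\<Sum>d\<in>{1..N}. \<Sum>j\<in>{1..N div d}. (\<eta> d * mangoldt d / real d) * (\<eta> j / real j))"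
      by (rule sum_divisors_swap)
    finally have "T N - L1 * M N =
      (\<Sum>d\<in>{1..N}. (\<eta> d * mangoldt d / real d) * ((\<Sum>j\<in>{1..N div d}. \<eta> j / real j) - L1))"
      by (simp add: M_def sum_distrib_left sum_subtractf algebra_simps)
    also have "\<bar>\<dots>\<bar> \<le> (\<Sum>d\<in>{1..N}. 2 * B / real N * mangoldt d)"
    proof (rule order.trans[OF sum_abs sum_mono])
      fix d assume d: "d \<in> {1..N}"
      have "N \<le> d * (N div d + 1)" using dividend_less_times_div[of d N] d by simp
      hence le: "real N \<le> real d * real (N div d + 1)" by (metis of_nat_le_iff of_nat_mult)
      have "\<bar>\<eta> d * mangoldt d / real d\<bar> * \<bar>(\<Sum>j\<in>{1..N div d}. \<eta> j / real j) - L1\<bar>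
          \<le> (mangoldt d / real d) * (2 * B / real (N div d + 1))"
      proof (intro mult_mono L1_approx)
        have "\<bar>\<eta> d\<bar> * mangoldt d \<le> 1 * mangoldt d" by (intro mult_mono abs_eta_le mangoldt_nonneg) auto
        thus "\<bar>\<eta> d * mangoldt d / real d\<bar> \<le> mangoldt d / real d"
          using d by (simp add: abs_mult divide_right_mono)
      qed (auto simp: mangoldt_nonneg)
      also have "\<dots> = 2 * B * mangoldt d / (real d * real (N div d + 1))" by simp
      also have "\<dots> \<le> 2 * B * mangoldt d / real N"
        using le B_ge_1 False d by (intro divide_left_mono mult_nonneg_nonneg mangoldt_nonneg) auto
      finally show "\<bar>(\<eta> d * mangoldt d / real d) * ((\<Sum>j\<in>{1..N div d}. \<eta> j / real j) - L1)\<bar>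
          \<le> 2 * B / real N * mangoldt d" unfolding abs_mult by simp
    qed
    also have "\<dots> = 2 * B / real N * (\<Sum>d\<in>{1..N}. mangoldt d)" by (simp add: sum_distrib_left)
    also have "\<dots> \<le> 2 * B / real N * (4 * real N)"
      using B_ge_1 by (intro mult_left_mono sum_mangoldt_le) auto
    finally show ?thesis using False by simp
  qed (use B_ge_1 in \<open>auto simp: T_def M_def\<close>)
  have "\<bar>M N\<bar> \<le> (C1 + 8 * B) / \<bar>L1\<bar>" for N
  proof -
    have "\<bar>L1\<bar> * \<bar>M N\<bar> \<le> C1 + 8 * B" using T[of N] TM[of N] unfolding abs_mult[symmetric] by linarith
    thus ?thesis using L1_nonzero by (simp add: field_simps)
  qed
  thus ?thesis using that unfolding M_def by blast
qed

lemma mertens_primes: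
  obtains C where "\<And>N. \<bar>\<Sum>n\<in>{1..N}. if prime n then \<eta> n * ln (real n) / real n else 0\<bar> \<le> C"
proof -
  obtain C1 where C1: "\<And>N. \<bar>\<Sum>d\<in>{1..N}. \<eta> d * mangoldt d / real d\<bar> \<le> C1"
    using mertens_mangoldt by blast
  obtain C2 where C2: "\<And>N. (\<Sum>n | n \<in> {1..N} \<and> \<not> prime n. mangoldt n / real n) \<le> C2"
    using mangoldt_nonprime_bound by blast
  have "\<bar>\<Sum>n\<in>{1..N}. if prime n then \<eta> n * ln (real n) / real n else 0\<bar> \<le> C1 + C2" for N
  proof -
    have "(\<Sum>n\<in>{1..N}. \<eta> n * mangoldt n / real n) =
        (\<Sum>n | n \<in> {1..N} \<and> prime n. \<eta> n * mangoldt n / real n) +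
        (\<Sum>n | n \<in> {1..N} \<and> \<not> prime n. \<eta> n * mangoldt n / real n)"
      by (subst sum.union_disjoint[symmetric]) (auto intro!: sum.cong)
    moreover have "(\<Sum>n | n \<in> {1..N} \<and> prime n. \<eta> n * mangoldt n / real n) =
        (\<Sum>n\<in>{1..N}. if prime n then \<eta> n * ln (real n) / real n else 0)"
      by (rule sum.mono_neutral_cong_left) auto
    moreover have "\<bar>\<Sum>n | n \<in> {1..N} \<and> \<not> prime n. \<eta> n * mangoldt n / real n\<bar> \<le>
        (\<Sum>n | n \<in> {1..N} \<and> \<not> prime n. mangoldt n / real n)"
    proof (rule order.trans[OF sum_abs sum_mono])
      fix n
      have "\<bar>\<eta> n\<bar> * mangoldt n \<le> 1 * mangoldt n" by (intro mult_mono abs_eta_le mangoldt_nonneg) auto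
      thus "\<bar>\<eta> n * mangoldt n / real n\<bar> \<le> mangoldt n / real n"
        by (simp add: abs_mult divide_right_mono)
    qed
    ultimately show ?thesis using C1[of N] C2[of N] by linarith
  qed
  thus ?thesis using that by blast
qed

end

section \<open>The Euler product at s = 1\<close>

lemma sum_inverse_squares_le:
  assumes "N \<ge> 2"
  shows "(\<Sum>n\<in>{N..M}. 1 / real n ^ 2) \<le> 1 / (real N - 1)"
proof (cases "N \<le> M")
  case True
  have "(\<Sum>n\<in>{N..M}. 1 / real n ^ 2) \<le> 1 / (real N - 1) - 1 / real M"
    using True
  proof (induction M rule: dec_induct)
    case base
    show ?case using assms by (simp add: field_simps power2_eq_square)
  next
    case (step m)
    have "1 / real (Suc m) ^ 2 \<le> 1 / (real m * real (Suc m))"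
      using step assms by (intro divide_left_mono) (auto simp: power2_eq_square)
    also have "\<dots> = 1 / real m - 1 / real (Suc m)"
      using step assms by (simp add: field_simps)
    finally have "1 / real (Suc m) ^ 2 \<le> 1 / real m - 1 / real (Suc m)" .
    thus ?case using step by simp
  qed
  thus ?thesis by (smt (verit) divide_nonneg_nonneg of_nat_0_le_iff)
qed (use assms in auto)

context bounded_real_character
begin

text \<open>
  Absolute convergence fails, but Mertens' estimate makes \<open>\<Sum>\<^sub>p ln (1 - \<eta>(p) p\<^sup>-\<^sup>s)\<close> converge
  uniformly for \<open>1 \<le> s \<le> 2\<close>; hence the Euler product extends continuously from \<open>s > 1\<close> to \<open>s = 1\<close>.
\<close>

lemma euler_product_at_one:
  "(\<lambda>N. \<Prod>p\<le>N. if prime p then 1 - \<eta> p / real p else 1) \<longlonglongrightarrow> 1 / L1"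
proof -
  define u where "u = (\<lambda>n s. if prime n then ln (1 - \<eta> n * real n powr (-s)) else 0)"
  define v where "v = (\<lambda>n s. \<eta> n * real n powr (-s))"
  define c where "c = (\<lambda>n. if prime n then \<eta> n * ln (real n) / real n else 0)"
  obtain C where C: "\<And>N. \<bar>\<Sum>n\<in>{1..N}. c n\<bar> \<le> C"
    using mertens_primes unfolding c_def by blast
  \<comment> \<open>The end 2 is arbitrary; the interval has to contain 1 and the points
    \<open>1 + 1 / (k + 1)\<close> through which \<open>s\<close> will tend to 1.\<close>
  define S where "S = {1..(2::real)}"
  have small: "\<bar>\<eta> n * real n powr (-s)\<bar> \<le> 1 / real n" if "n \<ge> 1" "s \<in> S" for n s
  proof -
    have "\<bar>\<eta> n\<bar> * real n powr (-s) \<le> 1 * real n powr (-1)"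
      using that by (intro mult_mono abs_eta_le powr_mono) (auto simp: S_def)
    thus ?thesis using that by (simp add: abs_mult powr_minus divide_inverse)
  qed
  have pos: "1 - \<eta> n * real n powr (-s) > 0" if "prime n" "s \<in> S" for n s
  proof -
    have "1 / real n < 1" using prime_gt_1_nat[OF that(1)] by simp
    thus ?thesis using small[of n s] that prime_gt_0_nat[OF that(1)] by linarith
  qed
  have vtail: "\<bar>\<Sum>n\<in>{N..M}. v n s\<bar> \<le> 2 * B / real N" if "N \<ge> 2" "s \<in> S" for N M s
  proof -
    have "\<bar>\<Sum>n\<in>{N..M}. v n s\<bar> \<le> 2 * B * real N powr (-s)"
      unfolding v_def using that
      by (intro tail_bound eta_sum) (auto simp: S_def intro!: powr_mono2')
    also have "\<dots> \<le> 2 * B * real N powr (-1)"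
      using that B_ge_1 by (intro mult_left_mono powr_mono) (auto simp: S_def)
    finally show ?thesis using that by (simp add: powr_minus divide_inverse)
  qed
  have utail: "\<bar>\<Sum>n\<in>{N..M}. u n s\<bar> \<le> 2 * C / ln (real N) + 2 / (real N - 1)"
    if N: "N \<ge> 2" and s: "s \<in> S" for N M s
  proof -
    \<comment> \<open>At primes \<open>c n * f n\<close> is \<open>v n s\<close>: the Mertens weight
      \<open>ln n\<close> is divided out again. From 2 on \<open>f\<close> decreases for every
      \<open>s\<close> in \<open>S\<close>, so the bound on the sums of \<open>c\<close> becomes a
      tail bound uniform in \<open>s\<close>.\<close>
    define f where "f = (\<lambda>n. real n powr (1 - s) / ln (real n))"
    have 1: "\<bar>\<Sum>n\<in>{N..M}. c n * f n\<bar> \<le> 2 * C * f N"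
    proof (rule tail_bound[OF C])
      fix n assume "n \<ge> N"
      hence n: "n \<ge> 2" using N by simp
      show "f (Suc n) \<le> f n" unfolding f_def using n s
        by (intro frac_le powr_mono2' powr_ge_zero) (auto simp: S_def)
      show "f n \<ge> 0" unfolding f_def using n by auto
    qed (use N in auto)
    have "C \<ge> 0" using C[of 0] by simp
    have "f N \<le> 1 / ln (real N)"
    proof -
      have "real N powr (1 - s) \<le> real N powr 0" using N s by (intro powr_mono) (auto simp: S_def)
      thus ?thesis unfolding f_def using N by (intro divide_right_mono) auto
    qed
    hence "2 * C * f N \<le> 2 * C / ln (real N)"
      using mult_left_mono[of "f N" "1 / ln (real N)" "2 * C"] \<open>C \<ge> 0\<close> by simp
    \<comment> \<open>What is left is \<open>ln (1 - z) + z\<close> with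
      \<open>\<bar>z\<bar> \<le> 1 / n \<le> 1 / 2\<close>. Its size is at most
      \<open>2 * z ^ 2\<close>, so this part converges absolutely and uniformly.\<close>
    moreover have 2: "\<bar>\<Sum>n\<in>{N..M}. u n s + c n * f n\<bar> \<le> 2 * (1 / (real N - 1))"
    proof -
      have "\<bar>\<Sum>n\<in>{N..M}. u n s + c n * f n\<bar> \<le> (\<Sum>n\<in>{N..M}. 2 * (1 / real n ^ 2))"
      proof (rule order.trans[OF sum_abs sum_mono])
        fix n assume "n \<in> {N..M}"
        hence n: "n \<ge> 2" using N by simp
        show "\<bar>u n s + c n * f n\<bar> \<le> 2 * (1 / real n ^ 2)"
        proof (cases "prime n")
          case True
          define z where "z = v n s"
          have "real n powr (1 - s) = real n * real n powr (-s)"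
            using n by (simp add: powr_diff powr_minus divide_inverse)
          hence cf: "c n * f n = z" using True n by (simp add: c_def f_def z_def v_def)
          have z: "\<bar>z\<bar> \<le> 1 / real n" using small[of n s] n s by (simp add: z_def v_def)
          also have "\<dots> \<le> 1 / 2" using n by simp
          finally have "\<bar>ln (1 + (-z)) - (-z)\<bar> \<le> 2 * (-z) ^ 2"
            by (intro abs_ln_one_plus_x_minus_x_bound) simp
          also have "(-z) ^ 2 = \<bar>z\<bar> ^ 2" by simp
          also have "\<bar>z\<bar> ^ 2 \<le> (1 / real n) ^ 2" using z by (intro power_mono) auto
          finally show ?thesis using True cf by (simp add: u_def z_def v_def power_divide)
        qed (simp add: u_def c_def)
      qed
      also have "\<dots> \<le> 2 * (1 / (real N - 1))"
        unfolding sum_distrib_left[symmetric] by (intro mult_left_mono sum_inverse_squares_le N) auto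
      finally show ?thesis .
    qed
    ultimately show ?thesis using 1 unfolding sum.distrib by simp
  qed
  have v: "continuous_on S (\<lambda>s. \<Sum>n. v n s)" "\<And>s. s \<in> S \<Longrightarrow> summable (\<lambda>n. v n s)"
  proof -
    have lim: "(\<lambda>N. 2 * B / real N) \<longlonglongrightarrow> 0" by (rule lim_const_over_n)
    have "continuous_on S (v n)" for n
      unfolding v_def by (cases "n = 0") (auto intro!: continuous_intros)
    thus "continuous_on S (\<lambda>s. \<Sum>n. v n s)" "\<And>s. s \<in> S \<Longrightarrow> summable (\<lambda>n. v n s)"
      using uniform_tail_continuous[where u = v and S = S and start = 2 and \<epsilon> = "\<lambda>N. 2 * B / real N",
          OF _ vtail lim] by blast+
  qed
  have u: "continuous_on S (\<lambda>s. \<Sum>n. u n s)" "\<And>s. s \<in> S \<Longrightarrow> summable (\<lambda>n. u n s)"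
  proof -
    have lim: "(\<lambda>N. 2 * C / ln (real N) + 2 / (real N - 1)) \<longlonglongrightarrow> 0" by real_asymp
    have "continuous_on S (u n)" for n
    proof (cases "prime n")
      case True
      thus ?thesis unfolding u_def using pos[OF True] prime_gt_0_nat[OF True]
        by (auto intro!: continuous_intros simp: less_imp_neq[symmetric])
    qed (simp add: u_def)
    thus "continuous_on S (\<lambda>s. \<Sum>n. u n s)" "\<And>s. s \<in> S \<Longrightarrow> summable (\<lambda>n. u n s)"
      using uniform_tail_continuous[where u = u and S = S and start = 2 and \<epsilon> = "\<lambda>N. 2 * C / ln (real N) + 2 / (real N - 1)",
          OF _ utail lim] by blast+
  qed
  have prod: "(\<lambda>N. \<Prod>p\<le>N. if prime p then 1 - v p s else 1) \<longlonglongrightarrow> exp (\<Sum>n. u n s)" if s: "s \<in> S" for s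
  proof -
    have "(\<lambda>N. \<Sum>n\<le>N. u n s) \<longlonglongrightarrow> (\<Sum>n. u n s)"
      using summable_sums[OF u(2)[OF s]] by (simp add: sums_def_le)
    hence "(\<lambda>N. exp (\<Sum>n\<le>N. u n s)) \<longlonglongrightarrow> exp (\<Sum>n. u n s)" by (rule tendsto_exp)
    moreover have "exp (u n s) = (if prime n then 1 - v n s else 1)" for n
      using pos[of n s] s by (simp add: u_def v_def)
    ultimately show ?thesis by (simp add: exp_sum)
  qed
  have eq: "(\<Sum>n. v n s) * exp (\<Sum>n. u n s) = 1" if s: "1 < s" "s \<le> 2" for s
  proof -
    have sS: "s \<in> S" using s by (simp add: S_def)
    have "summable (\<lambda>n. real n powr (-s))" using s by (simp add: summable_real_powr_iff)
    hence "summable (\<lambda>n. norm (v n s))"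
    proof (rule summable_comparison_test'[where N = 0])
      fix n
      have "\<bar>\<eta> n\<bar> * real n powr (-s) \<le> 1 * real n powr (-s)" by (intro mult_right_mono abs_eta_le) auto
      thus "norm (norm (v n s)) \<le> real n powr (-s)" by (simp add: v_def abs_mult)
    qed
    hence "(\<lambda>n. norm (v n s)) summable_on UNIV" "((\<lambda>n. v n s) has_sum (\<Sum>n. v n s)) UNIV"
      by (intro norm_summable_imp_summable_on norm_summable_imp_has_sum summable_sums v(2) sS; simp)+
    moreover from this(2) have "((\<lambda>n. v n s) has_sum (\<Sum>n. v n s)) {1..}"
      by (rule has_sum_cong_neutral[THEN iffD1, rotated -1]) (auto simp: v_def not_le)
    ultimately have "(\<lambda>n. norm (v n s)) summable_on {1..}" "(\<Sum>\<^sub>\<infinity>n\<in>{1..}. v n s) = (\<Sum>n. v n s)"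
      using summable_on_subset_banach[of "\<lambda>n. norm (v n s)" UNIV] by (auto intro: infsumI)
    moreover have "v (m * n) s = v m s * v n s" if "m > 0" "n > 0" for m n
      using that by (simp add: v_def eta_mult powr_mult)
    ultimately have "(\<lambda>N. (\<Sum>n. v n s) * (\<Prod>p\<le>N. if prime p then 1 - v p s else 1)) \<longlonglongrightarrow> 1"
      using euler_product[of "\<lambda>n. v n s"] by (simp add: v_def)
    moreover have "(\<lambda>N. (\<Sum>n. v n s) * (\<Prod>p\<le>N. if prime p then 1 - v p s else 1))
        \<longlonglongrightarrow> (\<Sum>n. v n s) * exp (\<Sum>n. u n s)"
      by (intro tendsto_intros prod sS)
    ultimately show ?thesis using LIMSEQ_unique by blast
  qed
  have "(\<Sum>n. v n 1) * exp (\<Sum>n. u n 1) = 1"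
  proof -
    have "continuous_on S (\<lambda>s. (\<Sum>n. v n s) * exp (\<Sum>n. u n s))"
      by (intro continuous_intros u v)
    moreover have "(\<lambda>k. 1 + 1 / real (Suc k)) \<longlonglongrightarrow> 1" by real_asymp
    ultimately have "(\<lambda>k. (\<Sum>n. v n (1 + 1 / real (Suc k))) * exp (\<Sum>n. u n (1 + 1 / real (Suc k))))
        \<longlonglongrightarrow> (\<Sum>n. v n 1) * exp (\<Sum>n. u n 1)"
      by (rule continuous_on_tendsto_compose) (auto simp: S_def field_simps)
    moreover have "(\<Sum>n. v n (1 + 1 / real (Suc k))) * exp (\<Sum>n. u n (1 + 1 / real (Suc k))) = 1" for k
      by (rule eq) (auto simp: field_simps)
    ultimately show ?thesis by (simp add: LIMSEQ_const_iff)
  qed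
  moreover have v1: "v n 1 = \<eta> n / real n" for n
    by (cases "n = 0") (auto simp: v_def powr_minus divide_inverse)
  ultimately have "exp (\<Sum>n. u n 1) = 1 / L1"
    using L1_nonzero by (simp add: L1_def field_simps)
  thus ?thesis using prod[of 1] unfolding v1 by (simp add: S_def)
qed

end

section \<open>The Kronecker symbol\<close>

lemma nat_prime_induct [consumes 1, case_names one prime_mult]:
  assumes "n > 0" "P (1::nat)" "\<And>p n. prime p \<Longrightarrow> n > 0 \<Longrightarrow> P n \<Longrightarrow> P (p * n)"
  shows "P n"
  using assms(1)
proof (induction n rule: less_induct)
  case (less n)
  show ?case
  proof (cases "n = 1")
    case False
    then obtain p where p: "prime p" "p dvd n" using prime_factor_nat by blast
    then obtain m where m: "n = p * m" by auto
    have "m > 0" "m < n" using m less.prems prime_gt_1_nat[OF p(1)] by (auto intro: Nat.gr0I)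
    thus ?thesis using assms(3)[OF p(1)] less.IH m by blast
  qed (use assms in simp)
qed

lemma Legendre_range: "Legendre a p \<in> {-1, 0, 1}"
  by (auto simp: Legendre_def)

lemma Legendre_cong: "[a = b] (mod p) \<Longrightarrow> Legendre a p = Legendre b p"
  unfolding Legendre_def QuadRes_def by (auto simp: cong_def)

text \<open>Euler's criterion gives the identity modulo \<open>p\<close>; both sides lie in {-1, 0,
  1}, so they differ by at most 2, which is less than \<open>p\<close>.\<close>

lemma Legendre_mult:
  assumes p: "prime p" "2 < p"
  shows "Legendre (a * b) (int p) = Legendre a (int p) * Legendre b (int p)"
proof -
  let ?e = "(p - 1) div 2"
  have "[Legendre (a * b) (int p) = (a * b) ^ ?e] (mod int p)" using euler_criterion[OF p] .
  also have "(a * b) ^ ?e = a ^ ?e * b ^ ?e" by (rule power_mult_distrib)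
  also have "[a ^ ?e * b ^ ?e = Legendre a (int p) * Legendre b (int p)] (mod int p)"
    using euler_criterion[OF p] by (intro cong_mult) (auto intro: cong_sym)
  finally have dvd: "int p dvd Legendre (a * b) (int p) - Legendre a (int p) * Legendre b (int p)"
    by (simp add: cong_iff_dvd_diff)
  have "\<bar>Legendre (a * b) (int p) - Legendre a (int p) * Legendre b (int p)\<bar> < int p"
    using Legendre_range[of "a * b" "int p"] Legendre_range[of a "int p"] Legendre_range[of b "int p"] p
    by auto
  thus ?thesis using dvd_imp_le_int[OF _ dvd] by force
qed

lemma kronecker_1 [simp]: "kronecker d (Suc 0) = 1"
  by (simp add: kronecker_def)

lemma kronecker_of_prime: "prime p \<Longrightarrow> kronecker d p = kronecker_prime d p"
  by (auto simp: kronecker_def prime_factorization_prime)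

lemma kronecker_odd_prime: "prime p \<Longrightarrow> p \<noteq> 2 \<Longrightarrow> kronecker d p = Legendre d (int p)"
  by (simp add: kronecker_of_prime kronecker_prime_def)

lemma kronecker_mult:
  assumes "m > 0" "n > 0"
  shows "kronecker d (m * n) = kronecker d m * kronecker d n"
proof -
  let ?P = "prime_factors m \<union> prime_factors n"
  have *: "kronecker d k = (\<Prod>p\<in>?P. kronecker_prime d p ^ multiplicity p k)"
    if "prime_factors k \<subseteq> ?P" "k > 0" for k
    unfolding kronecker_def using that
    by (auto intro!: prod.mono_neutral_left simp: in_prime_factors_iff not_dvd_imp_multiplicity_0)
  have "prime_factors (m * n) = ?P" using assms by (simp add: prime_factors_product)
  thus ?thesis using assms by (subst (1 2 3) *)
     (auto simp: prod.distrib[symmetric] power_add[symmetric] prime_elem_multiplicity_mult_distrib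
       in_prime_factors_iff intro!: prod.cong)
qed

lemma kronecker_range: "n > 0 \<Longrightarrow> kronecker d n \<in> {-1, 0, 1}"
proof (induction n rule: nat_prime_induct)
  case (prime_mult p n)
  have "kronecker_prime d p \<in> {-1, 0, 1}"
    using Legendre_range[of d "int p"] by (auto simp: kronecker_prime_def)
  thus ?case using prime_mult
    by (auto simp: kronecker_mult prime_gt_0_nat kronecker_of_prime)
qed simp

lemma kronecker_mult_top:
  assumes "odd n"
  shows "kronecker (a * b) n = kronecker a n * kronecker b n"
proof -
  have "n > 0" using assms by (auto intro: Nat.gr0I)
  thus ?thesis using assms
  proof (induction n rule: nat_prime_induct)
    case (prime_mult p n)
    hence "p \<noteq> 2" "2 < p" using prime_ge_2_nat[of p] by (auto simp: le_less)
    thus ?case using prime_mult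
      by (auto simp: kronecker_mult prime_gt_0_nat kronecker_odd_prime Legendre_mult)
  qed simp
qed

lemma kronecker_cong:
  assumes "odd n" "[a = b] (mod int n)"
  shows "kronecker a n = kronecker b n"
proof -
  have "n > 0" using assms by (auto intro: Nat.gr0I)
  thus ?thesis using assms
  proof (induction n rule: nat_prime_induct)
    case (prime_mult p n)
    hence "p \<noteq> 2" by auto
    moreover have "[a = b] (mod int n)" "[a = b] (mod int p)"
      using prime_mult.prems(2) by (auto intro: cong_dvd_modulus)
    ultimately show ?case using prime_mult
      by (auto simp: kronecker_mult prime_gt_0_nat kronecker_odd_prime intro: Legendre_cong)
  qed simp
qed

section \<open>Reciprocity and the supplementary laws\<close>

definition sign4 :: "nat \<Rightarrow> int" where
  "sign4 n = (if n mod 4 = 1 then 1 else -1)"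

text \<open>For odd \<open>n\<close>, \<open>sign4 n\<close> is (-1)^((n-1)/2) and
  \<open>sign8 n\<close> is (-1)^((n^2-1)/8), the values of (-1|n) and (2|n). Even arguments get -1,
  which has no meaning.\<close>

definition sign8 :: "nat \<Rightarrow> int" where
  "sign8 n = (if n mod 8 \<in> {1, 7} then 1 else -1)"

text \<open>For odd arguments this is (-1) to the power (m-1)/2 times (n-1)/2.\<close>

definition recip_sign :: "nat \<Rightarrow> nat \<Rightarrow> int" where
  "recip_sign m n = (if m mod 4 = 3 \<and> n mod 4 = 3 then -1 else 1)"

lemma odd_mod_4: "odd (n::nat) \<Longrightarrow> n mod 4 = 1 \<or> n mod 4 = 3"
  by presburger

lemma odd_mod_8: "odd (n::nat) \<Longrightarrow> n mod 8 \<in> {1, 3, 5, 7}"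
  by simp presburger

lemma minus_one_power_half: "odd n \<Longrightarrow> (-1) ^ ((n - Suc 0) div 2) = sign4 n"
proof -
  assume "odd n"
  then obtain k where k: "n = 2 * k + 1" by (auto elim: oddE)
  show ?thesis
  proof (cases "even k")
    case True
    hence "n mod 4 = 1" using k by presburger
    thus ?thesis using True k by (simp add: sign4_def)
  next
    case False
    hence "n mod 4 = 3" using k by presburger
    thus ?thesis using False k by (simp add: sign4_def)
  qed
qed

lemma mult_mod_4: "odd m \<Longrightarrow> odd n \<Longrightarrow> (m * n) mod 4 = (if m mod 4 = n mod 4 then 1 else 3 :: nat)"
proof -
  assume "odd m" "odd n"
  hence "m mod 4 = 1 \<or> m mod 4 = 3" "n mod 4 = 1 \<or> n mod 4 = 3" using odd_mod_4 by blast+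
  moreover have "(m * n) mod 4 = ((m mod 4) * (n mod 4)) mod 4" by (rule mod_mult_eq[symmetric])
  ultimately show ?thesis by (elim disjE) simp_all
qed

lemma sign4_mult: "odd m \<Longrightarrow> odd n \<Longrightarrow> sign4 (m * n) = sign4 m * sign4 n"
proof -
  assume o: "odd m" "odd n"
  show ?thesis using odd_mod_4[OF o(1)] odd_mod_4[OF o(2)]
    by (elim disjE; simp add: sign4_def mult_mod_4 o)
qed

lemma recip_sign_mult: "odd m \<Longrightarrow> odd n \<Longrightarrow> recip_sign k (m * n) = recip_sign k m * recip_sign k n"
proof -
  assume o: "odd m" "odd n"
  show ?thesis using odd_mod_4[OF o(1)] odd_mod_4[OF o(2)]
    by (elim disjE; simp add: recip_sign_def mult_mod_4 o)
qed

lemma recip_sign_commute: "recip_sign m n = recip_sign n m"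
  by (auto simp: recip_sign_def)

lemma kronecker_minus_one: 
  assumes "odd n" shows "kronecker (-1) n = sign4 n"
proof -
  have "n > 0" using assms by (auto intro: Nat.gr0I)
  thus ?thesis using assms
  proof (induction n rule: nat_prime_induct)
    case one
    show ?case by (simp add: sign4_def)
  next
    case (prime_mult p n)
    hence p: "p \<noteq> 2" "2 < p" "odd p" using prime_ge_2_nat[of p] by (auto simp: le_less)
    have "[Legendre (-1) (int p) = sign4 p] (mod int p)"
      using euler_criterion[of p "-1"] prime_mult p by (simp add: minus_one_power_half)
    hence dvd: "int p dvd Legendre (-1) (int p) - sign4 p" by (simp add: cong_iff_dvd_diff)
    have "\<bar>Legendre (-1) (int p) - sign4 p\<bar> < int p"
      using Legendre_range[of "-1" "int p"] p by (auto simp: sign4_def)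
    hence "Legendre (-1) (int p) = sign4 p" using dvd_imp_le_int[OF _ dvd] by force
    thus ?case using prime_mult p
      by (auto simp: kronecker_mult prime_gt_0_nat kronecker_odd_prime sign4_mult)
  qed
qed

text \<open>Reciprocity for two primes is extended multiplicatively in \<open>n\<close> with
  \<open>q\<close> fixed; a prime factor of \<open>n\<close> equal to \<open>q\<close> makes both
  symbols 0.\<close>

lemma kronecker_reciprocity_prime:
  assumes "odd n" "prime q" "q \<noteq> 2"
  shows "kronecker (int q) n = kronecker (int n) q * recip_sign q n"
proof -
  have "n > 0" using assms by (auto intro: Nat.gr0I)
  thus ?thesis using assms(1)
  proof (induction n rule: nat_prime_induct)
    case one
    have "\<not> [1 = 0] (mod int q)" "QuadRes (int q) 1"
      using prime_gt_1_nat[OF assms(2)] by (auto simp: cong_def QuadRes_def intro!: exI[of _ 1])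
    thus ?case using assms by (simp add: recip_sign_def kronecker_odd_prime Legendre_def)
  next
    case (prime_mult p n)
    hence p: "p \<noteq> 2" "2 < p" "odd p" "odd n" using prime_ge_2_nat[of p] by (auto simp: le_less)
    have q: "2 < q" "odd q" using assms prime_ge_2_nat[of q] primes_dvd_imp_eq[of 2 q] by (auto simp: le_less)
    have "Legendre (int q) (int p) = Legendre (int p) (int q) * recip_sign q p"
    proof (cases "p = q")
      case False
      have "Legendre (int p) (int q) * Legendre (int q) (int p) = (-1) ^ ((p - 1) div 2 * ((q - 1) div 2))"
        using Quadratic_Reciprocity prime_mult assms p q False by blast
      also have "\<dots> = (if even ((q - 1) div 2) then 1 else (-1) ^ ((p - 1) div 2))"
        by (simp add: minus_one_power_iff)
      also have "\<dots> = recip_sign q p"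
      proof -
        have "even ((q - 1) div 2) \<longleftrightarrow> q mod 4 = 1" using q by presburger
        thus ?thesis using odd_mod_4[OF q(2)] odd_mod_4[OF p(3)]
          by (auto simp: minus_one_power_half p sign4_def recip_sign_def)
      qed
      \<comment> \<open>As the product of the two symbols is 1 or -1, neither vanishes, and each is
        the other times the product.\<close>
      finally show ?thesis
        using Legendre_range[of "int p" "int q"] Legendre_range[of "int q" "int p"]
        by (auto simp: recip_sign_def split: if_splits)
    qed (simp add: Legendre_def cong_def)
    moreover have "kronecker (int (p * n)) q = kronecker (int p) q * kronecker (int n) q"
      using q by (simp add: kronecker_mult_top)
    moreover have "kronecker (int q) (p * n) = kronecker (int q) p * kronecker (int q) n"
      using prime_mult by (simp add: kronecker_mult prime_gt_0_nat)
    ultimately show ?case using prime_mult p q assms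
      by (simp add: kronecker_odd_prime recip_sign_mult)
  qed
qed

lemma kronecker_reciprocity:
  assumes "odd m" "odd n"
  shows "kronecker (int m) n = kronecker (int n) m * recip_sign m n"
proof -
  have "m > 0" using assms by (auto intro: Nat.gr0I)
  thus ?thesis using assms(1)
  proof (induction m rule: nat_prime_induct)
    case one
    \<comment> \<open>The symbol (1|n) equals its own square, so it is 1 as soon as it is
      nonzero.\<close>
    have "kronecker (1 * 1) n = kronecker 1 n * kronecker 1 n" by (rule kronecker_mult_top[OF assms(2)])
    moreover have "kronecker 1 n \<noteq> 0"
    proof -
      have "n > 0" using assms by (auto intro: Nat.gr0I)
      moreover have "kronecker_prime 1 p \<noteq> 0" if "prime p" for p
      proof -
        have "\<not> [1 = 0] (mod int p)" using prime_gt_1_nat[OF that] by (auto simp: cong_def)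
        thus ?thesis by (simp add: kronecker_prime_def Legendre_def)
      qed
      ultimately show ?thesis by (auto simp: kronecker_def in_prime_factors_iff)
    qed
    ultimately show ?case by (simp add: recip_sign_def)
  next
    case (prime_mult p m)
    hence "p \<noteq> 2" "odd p" "odd m" by auto
    thus ?case using prime_mult kronecker_reciprocity_prime[of n p] assms
      by (simp add: kronecker_mult prime_gt_0_nat kronecker_mult_top recip_sign_mult recip_sign_commute[of _ n])
  qed
qed

text \<open>
  The supplementary law for 2 follows by induction from reciprocity:
  \<open>(2|n) = (-1|n) (n-2|n) = (-1|n) (n|n-2) = (-1|n) (2|n-2)\<close>.
\<close>

lemma kronecker_two: "odd n \<Longrightarrow> kronecker 2 n = sign8 n"
proof (induction n rule: less_induct)
  case (less n)
  show ?case
  proof (cases "n = 1")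
    case False
    hence n: "n \<ge> 3" using less.prems by presburger
    define l where "l = n - 2"
    have l: "n = l + 2" "odd l" "l < n" using n less.prems by (auto simp: l_def)
    have "kronecker 2 n = kronecker (-1) n * kronecker (-2) n"
      using kronecker_mult_top[OF less.prems, of "-1" "-2"] by simp
    also have "kronecker (-2) n = kronecker (int l) n"
      by (rule kronecker_cong[OF less.prems], unfold cong_iff_dvd_diff, rule dvdI[of _ _ "-1"]) (simp add: l(1))
    also have "\<dots> = kronecker (int n) l * recip_sign l n"
      by (rule kronecker_reciprocity) (use l less.prems in auto)
    also have "kronecker (int n) l = kronecker 2 l"
      by (rule kronecker_cong[OF l(2)]) (simp add: l cong_iff_dvd_diff)
    \<comment> \<open>Of two consecutive odd numbers one is 1 modulo 4.\<close>
    also have "recip_sign l n = 1" using l by (auto simp: recip_sign_def) presburger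
    also have "kronecker 2 l = sign8 l" using less.IH[OF l(3,2)] .
    also have "kronecker (-1) n = sign4 n" by (rule kronecker_minus_one[OF less.prems])
    also have "sign4 n * (sign8 l * 1) = sign8 n"
    proof -
      have "l mod 8 mod 4 = l mod 4" by (rule mod_mod_cancel) simp
      hence "(l + 2) mod 8 = (l mod 8 + 2) mod 8" "(l + 2) mod 4 = (l mod 8 + 2) mod 4"
        by (simp add: mod_simps, metis mod_add_left_eq)
      thus ?thesis using odd_mod_8[OF l(2)] unfolding l(1) by (auto simp: sign4_def sign8_def)
    qed
    finally show ?thesis .
  qed (simp add: sign8_def)
qed

section \<open>Bounded partial sums of the Kronecker symbol\<close>

lemma bounded_sums_of_odd_periodic:
  fixes f :: "nat \<Rightarrow> int"
  assumes M: "M > 0" and period: "\<And>n. n > 0 \<Longrightarrow> f (n + M) = f n"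
    and antisym: "\<And>n. 0 < n \<Longrightarrow> n < M \<Longrightarrow> f (M - n) = - f n" and fM: "f M = 0"
    and le: "\<And>n. n > 0 \<Longrightarrow> \<bar>f n\<bar> \<le> 1"
  shows "\<bar>\<Sum>i\<in>{1..n}. f i\<bar> \<le> int M"
proof -
  \<comment> \<open>Pairing \<open>i\<close> with \<open>M - i\<close> makes a full period cancel,
    so only an incomplete period of fewer than \<open>M\<close> terms counts.\<close>
  have "(\<Sum>i\<in>{1..<M}. f i) = (\<Sum>i\<in>{1..<M}. f (M - i))"
    by (rule sum.reindex_bij_witness[of _ "\<lambda>i. M - i" "\<lambda>i. M - i"]) auto
  also have "\<dots> = - (\<Sum>i\<in>{1..<M}. f i)" by (simp add: antisym sum_negf)
  finally have "(\<Sum>i\<in>{1..<M}. f i) = 0" by simp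
  moreover have "{1..M} = insert M {1..<M}" using M by auto
  ultimately have full: "(\<Sum>i\<in>{1..M}. f i) = 0" using fM by simp
  show ?thesis
  proof (induction n rule: less_induct)
    case (less n)
    show ?case
    proof (cases "n < M")
      case True
      have "\<bar>\<Sum>i\<in>{1..n}. f i\<bar> \<le> (\<Sum>i\<in>{1..n}. 1)"
        by (rule order.trans[OF sum_abs sum_mono]) (use le in auto)
      thus ?thesis using True by simp
    next
      case False
      have "(\<Sum>i\<in>{1..n}. f i) = (\<Sum>i\<in>{1..M}. f i) + (\<Sum>i\<in>{M+1..n}. f i)"
        using False by (subst sum.union_disjoint[symmetric]) (auto intro!: sum.cong)
      also have "(\<Sum>i\<in>{M+1..n}. f i) = (\<Sum>i\<in>{1..n-M}. f (i + M))"
        by (rule sum.reindex_bij_witness[of _ "\<lambda>i. i + M" "\<lambda>i. i - M"]) auto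
      also have "\<dots> = (\<Sum>i\<in>{1..n-M}. f i)" using period by (intro sum.cong) auto
      finally show ?thesis using less.IH[of "n - M"] M False full by simp
    qed
  qed
qed

text \<open>With \<open>D = -d\<close>, which is 3 modulo 4, the factor (-1|p) cancels the
  reciprocity sign, and at 2 the supplementary law agrees with the convention in
  \<open>kronecker_prime\<close>. Now \<open>n\<close> stands on top, where only its class modulo
  \<open>D\<close> matters.\<close>

lemma kronecker_eq_transpose:
  assumes d: "d < 0" "d mod 4 = 1" and n: "n > 0"
  shows "kronecker d n = kronecker (int n) (nat (-d))"
proof -
  define D where "D = nat (-d)"
  have D: "d = - int D" using d by (simp add: D_def)
  have "D mod 4 = 3" using d(2) unfolding D by presburger
  hence "odd D" by presburger
  have "kronecker d p = kronecker (int p) D" if p: "prime p" for p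
  proof (cases "p = 2")
    case True
    have "d mod 8 \<in> {1, 7} \<longleftrightarrow> D mod 8 \<in> {1, 7}" unfolding D by simp presburger
    moreover have "odd d" using \<open>odd D\<close> by (simp add: D)
    ultimately show ?thesis using True kronecker_two[OF \<open>odd D\<close>] kronecker_of_prime[of 2 d]
      by (simp add: kronecker_prime_def sign8_def)
  next
    case False
    hence "odd p" using p primes_dvd_imp_eq[of 2 p] by auto
    have "kronecker d p = kronecker (-1) p * kronecker (int D) p"
      using kronecker_mult_top[OF \<open>odd p\<close>, of "-1" "int D"] by (simp add: D)
    also have "\<dots> = sign4 p * (kronecker (int p) D * recip_sign D p)"
      using kronecker_minus_one[OF \<open>odd p\<close>] kronecker_reciprocity[OF \<open>odd D\<close> \<open>odd p\<close>] by simp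
    also have "\<dots> = kronecker (int p) D"
      using \<open>D mod 4 = 3\<close> odd_mod_4[OF \<open>odd p\<close>] by (auto simp: sign4_def recip_sign_def)
    finally show ?thesis .
  qed
  with n have "kronecker d n = kronecker (int n) D"
  proof (induction n rule: nat_prime_induct)
    case one
    show ?case using kronecker_reciprocity[OF \<open>odd D\<close>, of 1] by (simp add: recip_sign_def)
  qed (simp_all add: kronecker_mult prime_gt_0_nat kronecker_mult_top \<open>odd D\<close>)
  thus ?thesis by (simp add: D_def)
qed

text \<open>The transposed symbol has period \<open>D = -d\<close>, and it is odd because (-1|D) =
  -1 for \<open>D\<close> congruent to 3 modulo 4.\<close>

lemma kronecker_bounded_sums_odd:
  assumes d: "d < 0" "d mod 4 = 1"
  shows "\<bar>\<Sum>i\<in>{1..n}. kronecker d i\<bar> \<le> \<bar>d\<bar>"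
proof -
  define D where "D = nat (-d)"
  have D: "d = - int D" "D > 0" using d by (auto simp: D_def)
  have D4: "D mod 4 = 3" using d(2) unfolding D by presburger
  hence "odd D" by presburger
  have eq: "kronecker d n = kronecker (int n) D" if "n > 0" for n
    using kronecker_eq_transpose[OF d that] by (simp add: D_def)
  have "\<bar>\<Sum>i\<in>{1..n}. kronecker d i\<bar> \<le> int D"
  proof (rule bounded_sums_of_odd_periodic[OF D(2)])
    fix n :: nat assume n: "n > 0"
    show "kronecker d (n + D) = kronecker d n"
      using n by (simp add: eq) (rule kronecker_cong[OF \<open>odd D\<close>], simp add: cong_def)
    show "\<bar>kronecker d n\<bar> \<le> 1" using kronecker_range[OF n, of d] by auto
    show "kronecker d (D - n) = - kronecker d n" if "n < D"
    proof -
      have "kronecker d (D - n) = kronecker (int D - int n) D" using that n by (simp add: eq of_nat_diff)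
      also have "\<dots> = kronecker (-1 * int n) D"
        by (rule kronecker_cong[OF \<open>odd D\<close>]) (simp add: cong_iff_dvd_diff)
      also have "\<dots> = - kronecker d n"
        using n D4 by (simp only: kronecker_mult_top[OF \<open>odd D\<close>] kronecker_minus_one[OF \<open>odd D\<close>])
          (simp add: sign4_def eq)
      finally show ?thesis .
    qed
  next
    \<comment> \<open>For \<open>D = 1\<close> the symbol would not vanish at the period; here
      \<open>D\<close> has an odd prime factor, which forces the value 0.\<close>
    have "D \<noteq> 1" using D4 by auto
    then obtain p where p: "prime p" "p dvd D" using prime_factor_nat by blast
    hence "p \<noteq> 2" using \<open>odd D\<close> by auto
    obtain l where l: "D = p * l" using p by auto
    hence "l > 0" using D by (auto intro: Nat.gr0I)
    have "kronecker d D = kronecker (int D) p * kronecker (int D) l"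
      using D eq[of D] p \<open>l > 0\<close> by (simp add: kronecker_mult prime_gt_0_nat l)
    also have "kronecker (int D) p = 0" using p \<open>p \<noteq> 2\<close>
      by (simp add: kronecker_odd_prime Legendre_def cong_0_iff)
    finally show "kronecker d D = 0" by simp
  qed
  thus ?thesis using D by simp
qed

text \<open>Write \<open>-d = 2 ^ e * l\<close> with \<open>l\<close> odd. At odd \<open>n\<close>
  reciprocity leaves signs depending on \<open>n\<close> modulo 8 and the symbol (n|l), so
  \<open>8 * l\<close> is a period. When \<open>n\<close> is replaced by \<open>8 * l - n\<close>,
  \<open>sign4\<close> flips, \<open>sign8\<close> stays, and the change of the reciprocity sign
  cancels the factor (-1|l).\<close>

lemma kronecker_bounded_sums_even:
  assumes d: "d < 0" "even d"
  shows "\<bar>\<Sum>i\<in>{1..n}. kronecker d i\<bar> \<le> 8 * \<bar>d\<bar>"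
proof -
  obtain e l where el: "nat (-d) = 2 ^ e * l" "odd l"
  proof -
    have "nat (-d) \<noteq> 0" "\<not> is_unit (2::nat)" using d by auto
    thus ?thesis using multiplicity_decompose'[of "nat (-d)" 2] that by metis
  qed
  have de: "d = - 1 * (2 ^ e * int l)"
    using d(1) arg_cong[OF el(1), of int] by simp
  have even: "kronecker d n = 0" if "even n" "n > 0" for n
  proof -
    obtain k where k: "n = 2 * k" using \<open>even n\<close> by auto
    hence "kronecker d n = kronecker d 2 * kronecker d k"
      using that by (simp add: kronecker_mult)
    thus ?thesis using d by (simp add: kronecker_of_prime kronecker_prime_def)
  qed
  have odd: "kronecker d n = sign4 n * (sign8 n ^ e * (kronecker (int n) l * recip_sign l n))" if "odd n" for n
  proof -
    have "kronecker (2 ^ e) n = sign8 n ^ e"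
    proof (induction e)
      case 0
      show ?case using kronecker_reciprocity[of 1 n] that by (simp add: recip_sign_def)
    next
      case (Suc e)
      thus ?case using that by (simp add: kronecker_mult_top kronecker_two)
    qed
    thus ?thesis unfolding de using that kronecker_minus_one[OF that]
      by (simp only: kronecker_mult_top[OF that] kronecker_reciprocity[OF el(2) that])
  qed
  have l: "l > 0" using el by (auto intro: Nat.gr0I)
  have "\<bar>\<Sum>i\<in>{1..n}. kronecker d i\<bar> \<le> int (8 * l)"
  proof (rule bounded_sums_of_odd_periodic)
    fix n :: nat assume n: "n > 0"
    show "kronecker d (n + 8 * l) = kronecker d n"
    proof (cases "even n")
      case False
      have "(n + 8 * l) mod 4 = n mod 4" "(n + 8 * l) mod 8 = n mod 8" by presburger+
      moreover have "kronecker (int (n + 8 * l)) l = kronecker (int n) l"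
        by (rule kronecker_cong[OF el(2)]) (simp add: cong_iff_dvd_diff)
      ultimately show ?thesis using False by (simp add: odd sign4_def sign8_def recip_sign_def)
    qed (use n even in auto)
    show "\<bar>kronecker d n\<bar> \<le> 1" using kronecker_range[OF n, of d] by auto
    show "kronecker d (8 * l - n) = - kronecker d n" if nl: "n < 8 * l"
    proof (cases "even n")
      case False
      define r where "r = 8 * l - n"
      have r: "r + n = 8 * l" "odd r" using nl False by (auto simp: r_def)
      have m4: "x mod 4 = c mod 4" if "x mod 8 = c" for x c :: nat
        using mod_mod_cancel[of 4 8 x] that by simp
      have "(r mod 8 + n mod 8) mod 8 = 0" using r(1) by (simp add: mod_simps)
      then consider "n mod 8 = 1" "r mod 8 = 7" | "n mod 8 = 3" "r mod 8 = 5"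
        | "n mod 8 = 5" "r mod 8 = 3" | "n mod 8 = 7" "r mod 8 = 1"
        using odd_mod_8[of n] odd_mod_8[OF r(2)] False by (auto dest: dvd_imp_le)
      hence s: "sign4 r = - sign4 n \<and> sign8 r = sign8 n \<and> recip_sign l r = sign4 l * recip_sign l n"
      proof cases
        case 1
        show ?thesis using m4[OF 1(1)] m4[OF 1(2)] 1 odd_mod_4[OF el(2)]
          by (auto simp: sign4_def sign8_def recip_sign_def)
      next
        case 2
        show ?thesis using m4[OF 2(1)] m4[OF 2(2)] 2 odd_mod_4[OF el(2)]
          by (auto simp: sign4_def sign8_def recip_sign_def)
      next
        case 3
        show ?thesis using m4[OF 3(1)] m4[OF 3(2)] 3 odd_mod_4[OF el(2)]
          by (auto simp: sign4_def sign8_def recip_sign_def)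
      next
        case 4
        show ?thesis using m4[OF 4(1)] m4[OF 4(2)] 4 odd_mod_4[OF el(2)]
          by (auto simp: sign4_def sign8_def recip_sign_def)
      qed
      have "int r + int n = 8 * int l" using r(1) by linarith
      hence "kronecker (int r) l = kronecker (-1 * int n) l"
        by (intro kronecker_cong[OF el(2)]) (simp add: cong_iff_dvd_diff)
      also have "\<dots> = sign4 l * kronecker (int n) l"
        by (simp only: kronecker_mult_top[OF el(2)] kronecker_minus_one[OF el(2)])
      moreover have "sign4 l * sign4 l = 1" by (simp add: sign4_def)
      ultimately show ?thesis using False unfolding r_def[symmetric]
        by (simp add: odd r(2) s)
    qed (use n nl even in auto)
  next
    show "kronecker d (8 * l) = 0" using even l by simp
  qed (use l in auto)
  also have "\<dots> \<le> 8 * \<bar>d\<bar>"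
    unfolding de by (simp add: abs_mult mult_le_cancel_right1)
  finally show ?thesis by simp
qed

lemma kronecker_bounded_sums:
  assumes "d < 0" "d mod 4 \<in> {0, 1}"
  shows "\<bar>\<Sum>i\<in>{1..n}. kronecker d i\<bar> \<le> 8 * \<bar>d\<bar>"
proof (cases "even d")
  case False
  hence "d mod 4 = 1" using assms(2) by auto
  thus ?thesis using kronecker_bounded_sums_odd[OF assms(1), of n] by linarith
qed (use assms kronecker_bounded_sums_even in auto)

section \<open>Quadratic exponential sums\<close>

definition additive_char :: "nat \<Rightarrow> int \<Rightarrow> complex" where
  "additive_char n x = cis (2 * pi * (of_int x / of_nat n))"

lemma additive_char_0 [simp]: "additive_char n 0 = 1"
  by (simp add: additive_char_def)

lemma additive_char_add: "additive_char n (x + y) = additive_char n x * additive_char n y"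
  by (simp add: additive_char_def cis_mult add_divide_distrib distrib_left)

lemma additive_char_sum: "additive_char n (\<Sum>i\<in>A. f i) = (\<Prod>i\<in>A. additive_char n (f i))"
  by (induction A rule: infinite_finite_induct) (auto simp: additive_char_add)

lemma additive_char_cancel: "m > 0 \<Longrightarrow> additive_char (m * n) (int m * x) = additive_char n x"
  by (simp add: additive_char_def)

lemma additive_char_cong:
  assumes "n > 0" "[x = y] (mod int n)"
  shows "additive_char n x = additive_char n y"
proof -
  obtain k where k: "x = y + int n * k"
    using assms(2) by (metis cong_iff_lin mult.commute cong_sym)
  have "additive_char n (int n * k) = 1"
    using assms(1) cis_multiple_2pi[of "of_int k"] by (simp add: additive_char_def)
  thus ?thesis by (simp add: k additive_char_add)
qed

lemma additive_char_eq_1_iff: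
  assumes "n > 0" shows "additive_char n x = 1 \<longleftrightarrow> int n dvd x"
proof
  assume "additive_char n x = 1"
  hence "cos (2 * pi * (of_int x / of_nat n)) = 1"
    unfolding additive_char_def by (metis cis.simps(1) one_complex.simps(1))
  then obtain k :: int where "2 * pi * (of_int x / of_nat n) = of_int k * 2 * pi"
    by (auto simp: cos_one_2pi_int)
  hence "real_of_int x = of_int (k * int n)" using assms by (simp add: field_simps)
  thus "int n dvd x" by (simp only: of_int_eq_iff) simp
next
  assume "int n dvd x"
  thus "additive_char n x = 1"
    using additive_char_cong[OF assms, of x 0] by (simp add: cong_0_iff)
qed

lemma additive_char_1 [simp]: "additive_char (Suc 0) x = 1"
  by (simp add: additive_char_eq_1_iff)

lemma residues_one [simp]: "{0..<1::int} = {0}"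
  by auto

text \<open>Change of variable in a sum over residues: on a finite set, injectivity modulo
  \<open>n\<close> already makes the reduction of \<open>g\<close> a permutation.\<close>

lemma sum_residues_permute:
  fixes f :: "int \<Rightarrow> 'a::comm_monoid_add"
  assumes n: "n > 0" and f: "\<And>x y. [x = y] (mod int n) \<Longrightarrow> f x = f y"
    and g: "\<And>x y. [g x = g y] (mod int n) \<Longrightarrow> [x = y] (mod int n)"
  shows "(\<Sum>x\<in>{0..<int n}. f (g x)) = (\<Sum>x\<in>{0..<int n}. f x)"
proof -
  have "inj_on (\<lambda>x. g x mod int n) {0..<int n}"
  proof (rule inj_onI)
    fix x y assume xy: "x \<in> {0..<int n}" "y \<in> {0..<int n}" "g x mod int n = g y mod int n"
    hence "[g x = g y] (mod int n)" by (simp only: cong_def)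
    hence "[x = y] (mod int n)" by (rule g)
    thus "x = y" using xy by (simp add: cong_def)
  qed
  moreover have "(\<lambda>x. g x mod int n) ` {0..<int n} \<subseteq> {0..<int n}" using n by auto
  ultimately have "bij_betw (\<lambda>x. g x mod int n) {0..<int n} {0..<int n}"
    by (simp add: bij_betw_def endo_inj_surj)
  hence "(\<Sum>x\<in>{0..<int n}. f x) = (\<Sum>x\<in>{0..<int n}. f (g x mod int n))"
    by (rule sum.reindex_bij_betw[symmetric])
  also have "\<dots> = (\<Sum>x\<in>{0..<int n}. f (g x))"
    by (intro sum.cong f) (auto simp: cong_def)
  finally show ?thesis by simp
qed

lemma sum_residues_split:
  fixes f :: "int \<Rightarrow> 'a::comm_monoid_add"
  assumes "a > 0"
  shows "(\<Sum>x\<in>{0..<int (a * b)}. f x) = (\<Sum>u\<in>{0..<int a}. \<Sum>v\<in>{0..<int b}. f (u + int a * v))"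
proof -
  have "(\<Sum>x\<in>{0..<int (a * b)}. f x) = (\<Sum>(u, v)\<in>{0..<int a} \<times> {0..<int b}. f (u + int a * v))"
  proof (rule sum.reindex_bij_witness[of _ "\<lambda>(u, v). u + int a * v" "\<lambda>x. (x mod int a, x div int a)"], goal_cases)
    case (2 x)
    hence x: "0 \<le> x" "x < int a * int b" by auto
    have "int a * (x div int a) \<le> x"
      using assms by (simp add: minus_mod_eq_mult_div[symmetric])
    hence "int a * (x div int a) < int a * int b" using x by linarith
    hence "x div int a < int b" using assms by simp
    thus ?case using assms x by (simp add: pos_imp_zdiv_nonneg_iff)
  next
    case (4 x)
    then obtain u v where x: "x = (u, v)" "0 \<le> u" "u < int a" "0 \<le> v" "v < int b" by auto
    have "u + int a * v < int a * (v + 1)" using x by (simp add: algebra_simps)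
    also have "\<dots> \<le> int a * int b" using x by (intro mult_left_mono) auto
    finally show ?case using x by auto
  qed (use assms in auto)
  thus ?thesis by (simp add: sum.cartesian_product)
qed

lemma sum_residues_periodic:
  fixes f :: "int \<Rightarrow> complex"
  assumes "a > 0" "\<And>x y. [x = y] (mod int a) \<Longrightarrow> f x = f y"
  shows "(\<Sum>x\<in>{0..<int (a * b)}. f x) = of_nat b * (\<Sum>x\<in>{0..<int a}. f x)"
proof -
  have "f (u + int a * v) = f u" for u v by (rule assms(2)) (simp add: cong_def)
  thus ?thesis by (simp add: sum_residues_split[OF assms(1)] sum_distrib_left del: of_nat_mult)
qed

lemma sum_residues_multiples:
  fixes f :: "int \<Rightarrow> 'a::comm_monoid_add"
  assumes "a > 0"
  shows "(\<Sum>x\<in>{0..<int (a * b)}. if int a dvd x then f x else 0) = (\<Sum>v\<in>{0..<int b}. f (int a * v))"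
proof -
  have "(\<Sum>x\<in>{0..<int (a * b)}. if int a dvd x then f x else 0) =
        (\<Sum>u\<in>{0..<int a}. \<Sum>v\<in>{0..<int b}. if u = 0 then f (u + int a * v) else 0)"
    unfolding sum_residues_split[OF assms]
  proof (intro sum.cong refl)
    fix u v assume "u \<in> {0..<int a}"
    hence "int a dvd u + int a * v \<longleftrightarrow> u = 0"
      by (auto simp: dvd_add_left_iff dest: zdvd_imp_le)
    thus "(if int a dvd u + int a * v then f (u + int a * v) else 0) = (if u = 0 then f (u + int a * v) else 0)"
      by simp
  qed
  also have "\<dots> = (\<Sum>u\<in>{0..<int a}. if u = 0 then (\<Sum>v\<in>{0..<int b}. f (int a * v)) else 0)"
    by (intro sum.cong) auto
  also have "\<dots> = (\<Sum>v\<in>{0..<int b}. f (int a * v))" using assms by (simp add: sum.delta)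
  finally show ?thesis .
qed

text \<open>Orthogonality: shifting \<open>x\<close> by 1 multiplies the sum by
  \<open>additive_char n c\<close>, which differs from 1 unless \<open>n\<close> divides
  \<open>c\<close>.\<close>

lemma sum_additive_char:
  assumes "n > 0"
  shows "(\<Sum>x\<in>{0..<int n}. additive_char n (c * x)) = (if int n dvd c then of_nat n else 0)"
proof (cases "int n dvd c")
  case True
  hence "additive_char n (c * x) = 1" for x using assms by (simp add: additive_char_eq_1_iff)
  thus ?thesis using True by simp
next
  case False
  let ?S = "\<Sum>x\<in>{0..<int n}. additive_char n (c * x)"
  have "?S = (\<Sum>x\<in>{0..<int n}. additive_char n (c * (x + 1)))"
    by (rule sum_residues_permute[symmetric, where g = "\<lambda>x. x + 1"])
       (use assms in \<open>auto intro!: additive_char_cong cong_mult simp: cong_add_rcancel\<close>)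
  also have "\<dots> = additive_char n c * ?S"
    by (simp add: distrib_left additive_char_add sum_distrib_left mult.commute)
  finally show ?thesis using False assms by (simp add: additive_char_eq_1_iff)
qed

section \<open>Gauss sums in one and two variables\<close>

definition gauss_sum :: "nat \<Rightarrow> int \<Rightarrow> complex" where
  "gauss_sum n c = (\<Sum>x\<in>{0..<int n}. additive_char n (c * x ^ 2))"

lemma gauss_sum_cong: "n > 0 \<Longrightarrow> [c = c'] (mod int n) \<Longrightarrow> gauss_sum n c = gauss_sum n c'"
  unfolding gauss_sum_def by (intro sum.cong additive_char_cong cong_mult) auto

definition binary_gauss_sum :: "(int \<Rightarrow> int \<Rightarrow> int) \<Rightarrow> nat \<Rightarrow> int \<Rightarrow> complex" where
  "binary_gauss_sum Q n c = (\<Sum>(x, y)\<in>{0..<int n} \<times> {0..<int n}. additive_char n (c * Q x y))"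

text \<open>Complete the square:
  \<open>4 * Q x y = (2 * x + t * y) ^ 2 - (t ^ 2 - 4 * q) * y ^ 2\<close>, with \<open>c'\<close> a
  quarter of \<open>c\<close>. Since 2 is invertible modulo the odd \<open>n\<close>,
  \<open>2 * x + t * y\<close> runs through all residues for each \<open>y\<close>.\<close>

lemma binary_gauss_sum_diagonalize:
  assumes n: "odd n" and c: "[c = 4 * c'] (mod int n)" and Q: "\<And>x y. Q x y = x ^ 2 + t * x * y + q * y ^ 2"
  shows "binary_gauss_sum Q n c = gauss_sum n c' * gauss_sum n (- c' * (t ^ 2 - 4 * q))"
proof -
  have n0: "n > 0" using n by (auto intro: Nat.gr0I)
  have "binary_gauss_sum Q n c = (\<Sum>y\<in>{0..<int n}. \<Sum>x\<in>{0..<int n}. additive_char n (c * Q x y))"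
    unfolding binary_gauss_sum_def by (subst sum.swap) (simp add: sum.cartesian_product)
  also have "\<dots> = (\<Sum>y\<in>{0..<int n}. \<Sum>x\<in>{0..<int n}.
      additive_char n (- c' * (t ^ 2 - 4 * q) * y ^ 2) * additive_char n (c' * (2 * x + t * y) ^ 2))"
  proof (intro sum.cong refl)
    fix x y
    have "additive_char n (c * Q x y) = additive_char n (4 * c' * Q x y)"
      by (intro additive_char_cong cong_mult n0 c) auto
    also have "4 * c' * Q x y = - c' * (t ^ 2 - 4 * q) * y ^ 2 + c' * (2 * x + t * y) ^ 2"
      unfolding Q by (simp add: power2_eq_square algebra_simps)
    finally show "additive_char n (c * Q x y) =
      additive_char n (- c' * (t ^ 2 - 4 * q) * y ^ 2) * additive_char n (c' * (2 * x + t * y) ^ 2)"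
      by (simp only: additive_char_add)
  qed
  also have "\<dots> = (\<Sum>y\<in>{0..<int n}. additive_char n (- c' * (t ^ 2 - 4 * q) * y ^ 2) * gauss_sum n c')"
  proof (intro sum.cong refl)
    fix y
    have "coprime 2 (int n)" using n by simp
    hence inj: "[x = x'] (mod int n)" if "[2 * x + t * y = 2 * x' + t * y] (mod int n)" for x x'
      using that by (simp add: cong_add_rcancel cong_mult_lcancel)
    have "(\<Sum>x\<in>{0..<int n}. additive_char n (c' * (2 * x + t * y) ^ 2)) = gauss_sum n c'"
      unfolding gauss_sum_def
      by (rule sum_residues_permute[where f = "\<lambda>x. additive_char n (c' * x ^ 2)", OF n0 _ inj])
         (auto intro!: additive_char_cong[OF n0] cong_mult cong_pow)
    thus "(\<Sum>x\<in>{0..<int n}. additive_char n (- c' * (t ^ 2 - 4 * q) * y ^ 2) * additive_char n (c' * (2 * x + t * y) ^ 2))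
        = additive_char n (- c' * (t ^ 2 - 4 * q) * y ^ 2) * gauss_sum n c'"
      by (simp flip: sum_distrib_left)
  qed
  also have "\<dots> = gauss_sum n (- c' * (t ^ 2 - 4 * q)) * gauss_sum n c'"
    by (simp only: gauss_sum_def[of n "- c' * (t ^ 2 - 4 * q)"] sum_distrib_right)
  finally show ?thesis by (simp only: mult.commute[of "gauss_sum n c'"])
qed

text \<open>Put \<open>x = u + p ^ (j + 1) * v\<close>. The square of the second part disappears
  modulo \<open>p ^ (j + 2)\<close>, the cross term is linear in \<open>v\<close> modulo
  \<open>p\<close>, and orthogonality keeps only the \<open>u\<close> divisible by \<open>p\<close>,
  where a factor \<open>p ^ 2\<close> cancels.\<close>

lemma gauss_sum_prime_power_step:
  assumes p: "prime p" "\<not> int p dvd 2 * c"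
  shows "gauss_sum (p ^ (j + 2)) c = of_nat p * gauss_sum (p ^ j) c"
proof -
  have p0: "p > 0" using p prime_gt_0_nat by blast
  let ?n = "p ^ (j + 2)" and ?a = "p ^ (j + 1)"
  have n: "?n = ?a * p" by simp
  have "gauss_sum ?n c = (\<Sum>u\<in>{0..<int ?a}. \<Sum>v\<in>{0..<int p}. additive_char ?n (c * (u + int ?a * v) ^ 2))"
    unfolding gauss_sum_def n by (rule sum_residues_split) (use p0 in simp)
  also have "\<dots> = (\<Sum>u\<in>{0..<int ?a}. if int p dvd u then of_nat p * additive_char ?n (c * u ^ 2) else 0)"
  proof (intro sum.cong refl)
    fix u
    have "additive_char ?n (c * (u + int ?a * v) ^ 2) =
        additive_char ?n (c * u ^ 2) * additive_char p (2 * c * u * v)" for v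
    proof -
      have "c * (u + int ?a * v) ^ 2 = c * u ^ 2 + int ?a * (2 * c * u * v) + int ?n * (c * int (p ^ j) * v ^ 2)"
        by (simp add: power2_eq_square algebra_simps power_add)
      hence "[c * (u + int ?a * v) ^ 2 = c * u ^ 2 + int ?a * (2 * c * u * v)] (mod int ?n)"
        by (simp add: cong_iff_dvd_diff)
      hence "additive_char ?n (c * (u + int ?a * v) ^ 2) = additive_char ?n (c * u ^ 2 + int ?a * (2 * c * u * v))"
        by (intro additive_char_cong) (use p0 in auto)
      also have "\<dots> = additive_char ?n (c * u ^ 2) * additive_char (?a * p) (int ?a * (2 * c * u * v))"
        unfolding n by (rule additive_char_add)
      finally show ?thesis using p0 by (simp only: additive_char_cancel zero_less_power)
    qed
    hence "(\<Sum>v\<in>{0..<int p}. additive_char ?n (c * (u + int ?a * v) ^ 2)) =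
        additive_char ?n (c * u ^ 2) * (\<Sum>v\<in>{0..<int p}. additive_char p ((2 * c * u) * v))"
      by (simp add: sum_distrib_left)
    also have "\<dots> = (if int p dvd u then of_nat p * additive_char ?n (c * u ^ 2) else 0)"
      using p sum_additive_char[OF p0, of "2 * c * u"] by (simp add: prime_dvd_mult_iff)
    finally show "(\<Sum>v\<in>{0..<int p}. additive_char ?n (c * (u + int ?a * v) ^ 2)) = \<dots>" .
  qed
  also have "\<dots> = (\<Sum>w\<in>{0..<int (p ^ j)}. of_nat p * additive_char ?n (c * (int p * w) ^ 2))"
    using sum_residues_multiples[OF p0, where b = "p ^ j" and f = "\<lambda>u. of_nat p * additive_char ?n (c * u ^ 2)"] by simp
  also have "\<dots> = of_nat p * gauss_sum (p ^ j) c"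
  proof -
    have n2: "?n = p ^ 2 * p ^ j" by (simp add: power_add power2_eq_square)
    have sq: "c * (int p * w) ^ 2 = int (p ^ 2) * (c * w ^ 2)" for w by (simp add: power_mult_distrib)
    have "additive_char ?n (c * (int p * w) ^ 2) = additive_char (p ^ j) (c * w ^ 2)" for w
      unfolding n2 sq by (rule additive_char_cancel) (use p0 in simp)
    thus ?thesis by (simp add: gauss_sum_def sum_distrib_left)
  qed
  finally show ?thesis .
qed

context
  fixes p :: nat
  assumes p: "prime p" "p \<noteq> 2"
begin

lemma odd_prime_pos: "p > 0"
  using p prime_gt_0_nat by blast

lemma odd_prime_not_dvd_2: "\<not> int p dvd 2"
  using p prime_ge_2_nat[OF p(1)] by (auto dest!: zdvd_imp_le)

lemma gauss_sum_mult_square: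
  assumes "\<not> int p dvd r" shows "gauss_sum p (c * r ^ 2) = gauss_sum p c"
proof -
  have "coprime r (int p)" using assms p by (metis coprime_commute prime_imp_coprime prime_nat_int_transfer)
  hence inj: "[x = y] (mod int p)" if "[r * x = r * y] (mod int p)" for x y
    using that by (simp add: cong_mult_lcancel)
  have "(\<Sum>x\<in>{0..<int p}. additive_char p (c * (r * x) ^ 2)) = gauss_sum p c"
    unfolding gauss_sum_def
    by (rule sum_residues_permute[where f = "\<lambda>x. additive_char p (c * x ^ 2)", OF odd_prime_pos _ inj])
       (auto intro!: additive_char_cong[OF odd_prime_pos] cong_mult cong_pow)
  thus ?thesis by (simp add: gauss_sum_def power_mult_distrib mult_ac)
qed

text \<open>In the double sum over \<open>u ^ 2 - v ^ 2\<close>, shifting \<open>u\<close> by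
  \<open>v\<close> removes the square of \<open>v\<close>; the sum over \<open>v\<close> becomes
  linear and leaves only \<open>u = 0\<close>.\<close>

lemma gauss_sum_mult_minus:
  assumes c: "\<not> int p dvd c" shows "gauss_sum p c * gauss_sum p (- c) = of_nat p"
proof -
  have "gauss_sum p c * gauss_sum p (- c) =
      (\<Sum>v\<in>{0..<int p}. \<Sum>u\<in>{0..<int p}. additive_char p (c * u ^ 2) * additive_char p (- c * v ^ 2))"
    by (subst sum.swap) (simp add: gauss_sum_def sum_product)
  also have "\<dots> = (\<Sum>v\<in>{0..<int p}. \<Sum>u\<in>{0..<int p}.
      additive_char p (c * (u + v) ^ 2) * additive_char p (- c * v ^ 2))"
    by (intro sum.cong refl sum_residues_permute[symmetric, where g = "\<lambda>u. u + v" for v] odd_prime_pos)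
       (auto intro!: additive_char_cong[OF odd_prime_pos] cong_mult cong_pow arg_cong2[where f = "(*)"] simp: cong_add_rcancel)
  also have "\<dots> = (\<Sum>u\<in>{0..<int p}. \<Sum>v\<in>{0..<int p}. additive_char p (c * u ^ 2) * additive_char p ((2 * c * u) * v))"
    by (subst sum.swap) (intro sum.cong refl, simp add: power2_eq_square algebra_simps flip: additive_char_add)
  also have "\<dots> = (\<Sum>u\<in>{0..<int p}. if int p dvd u then of_nat p * additive_char p (c * u ^ 2) else 0)"
    using p c odd_prime_not_dvd_2 by (intro sum.cong refl)
      (auto simp: sum_additive_char[OF odd_prime_pos] prime_dvd_mult_iff simp flip: sum_distrib_left)
  also have "\<dots> = of_nat p"
    using sum_residues_multiples[OF odd_prime_pos, where b = 1 and f = "\<lambda>u. of_nat p * additive_char p (c * u ^ 2)"] by simp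
  finally show ?thesis .
qed

text \<open>Let \<open>h c\<close> be the sum of the two Gauss sums at \<open>c\<close> and
  \<open>c * d\<close>. For a residue \<open>c\<close> these are the ones at 1 and \<open>d\<close>;
  for a nonresidue \<open>c * d\<close> is a residue and they trade places. So \<open>h\<close> is
  constant on units. Over all classes \<open>h\<close> sums to \<open>2 * p\<close>, which is
  already \<open>h 0\<close>, and the constant is 0.\<close>

lemma gauss_sum_nonresidue:
  assumes d: "Legendre d (int p) = -1" and c: "\<not> int p dvd c"
  shows "gauss_sum p (c * d) = - gauss_sum p c"
proof -
  let ?P = "{0..<int p}"
  define h where "h = (\<lambda>c. gauss_sum p c + gauss_sum p (c * d))"
  have nd: "\<not> int p dvd d" using d by (auto simp: Legendre_def cong_0_iff)
  have cop: "coprime d (int p)" using nd p by (metis coprime_commute prime_imp_coprime prime_nat_int_transfer)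
  have const: "h c = h 1" if c: "\<not> int p dvd c" for c
  proof (cases "QuadRes (int p) c")
    case True
    then obtain s where s: "[s ^ 2 = c] (mod int p)" by (auto simp: QuadRes_def)
    hence s': "[c = 1 * s ^ 2] (mod int p)" "[c * d = d * s ^ 2] (mod int p)"
      by (auto intro: cong_sym simp: cong_def mod_mult_right_eq) (metis mod_mult_left_eq mult.commute)
    have "\<not> int p dvd s" using s c by (metis cong_dvd_iff dvd_power zero_less_numeral dvd_trans)
    thus ?thesis unfolding h_def gauss_sum_cong[OF odd_prime_pos s'(1)] gauss_sum_cong[OF odd_prime_pos s'(2)]
      using gauss_sum_mult_square[of s 1] gauss_sum_mult_square[of s d] by simp
  next
    case False
    have p2: "2 < p" using p prime_ge_2_nat[OF p(1)] by simp
    have "Legendre c (int p) = -1" using False c by (simp add: Legendre_def cong_0_iff)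
    have "[Legendre (c * d) (int p) = c ^ ((p - 1) div 2) * d ^ ((p - 1) div 2)] (mod int p)"
      using euler_criterion[OF p(1) p2, of "c * d"] by (simp add: power_mult_distrib)
    also have "[c ^ ((p - 1) div 2) * d ^ ((p - 1) div 2) = Legendre c (int p) * Legendre d (int p)] (mod int p)"
      using euler_criterion[OF p(1) p2] by (intro cong_mult) (auto intro: cong_sym)
    finally have *: "[Legendre (c * d) (int p) = 1] (mod int p)"
      using d \<open>Legendre c (int p) = -1\<close> by simp
    have "QuadRes (int p) (c * d)"
    proof (rule ccontr)
      assume "\<not> QuadRes (int p) (c * d)"
      hence "Legendre (c * d) (int p) = -1 \<or> Legendre (c * d) (int p) = 0" by (simp add: Legendre_def)
      hence "int p dvd 2 \<or> int p dvd 1" using * by (auto simp: cong_iff_dvd_diff)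
      thus False using odd_prime_not_dvd_2 prime_gt_1_nat[OF p(1)] by auto
    qed
    then obtain s where s: "[s ^ 2 = c * d] (mod int p)" by (auto simp: QuadRes_def)
    hence s': "[c * d = 1 * s ^ 2] (mod int p)" by (auto intro: cong_sym)
    have "[c * d * d = s ^ 2 * d] (mod int p)" by (rule cong_mult[OF cong_sym[OF s] cong_refl])
    hence s'': "[c * d ^ 2 = d * s ^ 2] (mod int p)" by (simp add: power2_eq_square mult_ac)
    have "\<not> int p dvd c * d" using c nd p by (simp add: prime_dvd_mult_iff)
    hence ns: "\<not> int p dvd s" using s by (metis cong_dvd_iff dvd_power zero_less_numeral dvd_trans)
    have "gauss_sum p c = gauss_sum p (c * d ^ 2)" by (simp only: gauss_sum_mult_square[OF nd])
    also have "\<dots> = gauss_sum p d" unfolding gauss_sum_cong[OF odd_prime_pos s''] by (rule gauss_sum_mult_square[OF ns])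
    finally have "gauss_sum p c = gauss_sum p d" .
    moreover have "gauss_sum p (c * d) = gauss_sum p 1"
      unfolding gauss_sum_cong[OF odd_prime_pos s'] by (rule gauss_sum_mult_square[OF ns])
    ultimately show ?thesis by (simp add: h_def)
  qed
  have full: "(\<Sum>c\<in>?P. gauss_sum p c) = of_nat p"
  proof -
    have "(\<Sum>c\<in>?P. gauss_sum p c) = (\<Sum>x\<in>?P. \<Sum>c\<in>?P. additive_char p (x ^ 2 * c))"
      unfolding gauss_sum_def by (subst sum.swap) (simp add: mult.commute)
    also have "\<dots> = (\<Sum>x\<in>?P. if int p dvd x then of_nat p else 0)"
      using p by (simp add: sum_additive_char[OF odd_prime_pos] prime_dvd_power_iff)
    also have "\<dots> = of_nat p"
      using sum_residues_multiples[OF odd_prime_pos, where b = 1 and f = "\<lambda>u. of_nat p"] by simp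
    finally show ?thesis .
  qed
  moreover have "(\<Sum>c\<in>?P. gauss_sum p (c * d)) = (\<Sum>c\<in>?P. gauss_sum p c)"
    by (rule sum_residues_permute[OF odd_prime_pos])
       (auto intro: gauss_sum_cong[OF odd_prime_pos] simp: cong_mult_rcancel[OF cop])
  ultimately have "(\<Sum>c\<in>?P. h c) = 2 * of_nat p" by (simp add: h_def sum.distrib)
  moreover have "?P = insert 0 {1..<int p}" using odd_prime_pos by auto
  moreover have "h 0 = 2 * of_nat p" by (simp add: h_def gauss_sum_def)
  ultimately have "(\<Sum>c\<in>{1..<int p}. h c) = 0" by simp
  moreover have "(\<Sum>c\<in>{1..<int p}. h c) = (\<Sum>c\<in>{1..<int p}. h 1)"
    by (intro sum.cong refl const) (auto dest: zdvd_imp_le)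
  ultimately have "h 1 = 0" using prime_gt_1_nat[OF p(1)] by simp
  hence "h c = 0" using const[OF c] by simp
  thus ?thesis by (simp add: h_def add_eq_0_iff)
qed

text \<open>A residue \<open>d\<close> leaves the second factor alone and a nonresidue flips its
  sign, so no Gauss sum has to be evaluated by itself.\<close>

lemma gauss_sum_product_prime:
  assumes c: "\<not> int p dvd c" and d: "\<not> int p dvd d"
  shows "gauss_sum p c * gauss_sum p (- c * d) = of_int (Legendre d (int p)) * of_nat p"
proof (cases "QuadRes (int p) d")
  case True
  then obtain s where s: "[s ^ 2 = d] (mod int p)" by (auto simp: QuadRes_def)
  have "\<not> int p dvd s" using s d by (metis cong_dvd_iff dvd_power zero_less_numeral dvd_trans)
  moreover have "[- c * d = - c * s ^ 2] (mod int p)" by (intro cong_mult cong_sym[OF s]) auto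
  ultimately have "gauss_sum p (- c * d) = gauss_sum p (- c)"
    using gauss_sum_cong[OF odd_prime_pos] gauss_sum_mult_square by metis
  moreover have "Legendre d (int p) = 1" using True d by (simp add: Legendre_def cong_0_iff)
  ultimately show ?thesis using gauss_sum_mult_minus[OF c] by simp
next
  case False
  hence L: "Legendre d (int p) = -1" using d by (simp add: Legendre_def cong_0_iff)
  have "gauss_sum p (- c * d) = - gauss_sum p (- c)"
    by (rule gauss_sum_nonresidue[OF L]) (use c in simp)
  thus ?thesis using gauss_sum_mult_minus[OF c] L by simp
qed

text \<open>The exponent climbs by two, hence the base cases 0 and 1; each double step contributes
  \<open>p ^ 2\<close>, which is also the square of \<open>p\<close> times a sign.\<close>

lemma binary_gauss_sum_unit:
  assumes c: "\<not> int p dvd c" and d: "\<not> int p dvd t ^ 2 - 4 * q"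
    and Q: "\<And>x y. Q x y = x ^ 2 + t * x * y + q * y ^ 2"
  shows "binary_gauss_sum Q (p ^ j) c = (of_int (Legendre (t ^ 2 - 4 * q) (int p)) * of_nat p) ^ j"
proof -
  define d where "d = t ^ 2 - 4 * q"
  have nd: "\<not> int p dvd d" using d by (simp add: d_def)
  have main: "gauss_sum (p ^ j) c * gauss_sum (p ^ j) (- c * d) = (of_int (Legendre d (int p)) * of_nat p) ^ j"
    if c: "\<not> int p dvd c" for c
  proof (induction j rule: induct_nat_012)
    case 0
    show ?case by (simp add: gauss_sum_def)
  next
    case 1
    show ?case using gauss_sum_product_prime[OF c nd] by simp
  next
    case (ge2 j)
    have "\<not> int p dvd 2 * c" "\<not> int p dvd 2 * (- c * d)"
      using c nd odd_prime_not_dvd_2 p by (auto simp: prime_dvd_mult_iff)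
    hence "gauss_sum (p ^ Suc (Suc j)) c * gauss_sum (p ^ Suc (Suc j)) (- c * d) =
        of_nat p ^ 2 * (gauss_sum (p ^ j) c * gauss_sum (p ^ j) (- c * d))"
      using gauss_sum_prime_power_step[OF p(1), of c j] gauss_sum_prime_power_step[OF p(1), of "- c * d" j]
      by (simp add: power2_eq_square)
    also have "\<dots> = (of_int (Legendre d (int p)) * of_nat p) ^ Suc (Suc j)"
      using ge2 nd by (auto simp: power_mult_distrib Legendre_def cong_0_iff power2_eq_square)
    finally show ?case .
  qed
  have "coprime 4 (int (p ^ j))"
  proof -
    have "odd p" using p primes_dvd_imp_eq[of 2 p] by auto
    hence "coprime (2 ^ 2) (int (p ^ j))" by (subst coprime_power_left_iff) simp
    thus ?thesis by simp
  qed
  then obtain i where i: "[4 * i = 1] (mod int (p ^ j))" using cong_solve_coprime_int by blast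
  \<comment> \<open>Modulo \<open>p ^ 0\<close> the congruence for the quarter of \<open>c\<close>
    says nothing about divisibility by \<open>p\<close>, so \<open>j = 0\<close> is
    separate.\<close>
  show ?thesis
  proof (cases "j = 0")
    case True
    thus ?thesis by (simp add: binary_gauss_sum_def)
  next
    case False
    have c': "[c = 4 * (i * c)] (mod int (p ^ j))"
      using cong_mult[OF cong_sym[OF i] cong_refl[of c]] by (simp add: mult_ac)
    have "int p dvd int (p ^ j)" using False by (simp add: dvd_power)
    hence "[c = 4 * (i * c)] (mod int p)" using c' cong_dvd_modulus by blast
    hence "\<not> int p dvd i * c" using c by (metis cong_dvd_iff dvd_mult)
    moreover have "odd (p ^ j)" using p primes_dvd_imp_eq[of 2 p] by auto
    ultimately show ?thesis
      using binary_gauss_sum_diagonalize[OF _ c' Q] main by (simp add: d_def)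
  qed
qed

end

section \<open>Counting solutions by exponential sums\<close>

definition congruence_solutions ::
    "(int \<Rightarrow> int \<Rightarrow> int) \<Rightarrow> nat \<Rightarrow> (nat \<Rightarrow> int) \<Rightarrow> int \<Rightarrow> nat \<Rightarrow> (nat \<Rightarrow> int \<times> int) set" where
  "congruence_solutions Q m a k n =
     {z \<in> {1..m} \<rightarrow>\<^sub>E ({0..<int n} \<times> {0..<int n}). int n dvd (\<Sum>i\<in>{1..m}. a i * case_prod Q (z i)) - k}"

definition exponential_sum ::
    "(int \<Rightarrow> int \<Rightarrow> int) \<Rightarrow> nat \<Rightarrow> (nat \<Rightarrow> int) \<Rightarrow> int \<Rightarrow> nat \<Rightarrow> complex" where
  "exponential_sum Q m a k n =
     (\<Sum>c\<in>{0..<int n}. additive_char n (- c * k) * (\<Prod>i\<in>{1..m}. binary_gauss_sum Q n (c * a i)))"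

text \<open>Orthogonality in \<open>c\<close> detects the congruence at the price of the factor
  \<open>n\<close>; because the form is diagonal, the sum over tuples factors into binary
  sums.\<close>

lemma card_congruence_solutions:
  assumes "n > 0"
  shows "of_nat n * of_nat (card (congruence_solutions Q m a k n)) = exponential_sum Q m a k n"
proof -
  define A where "A = {1..m} \<rightarrow>\<^sub>E ({0..<int n} \<times> {0..<int n})"
  define F where "F = (\<lambda>z. (\<Sum>i\<in>{1..m}. a i * case_prod Q (z i)) - k)"
  have fin: "finite A" unfolding A_def by (intro finite_PiE) auto
  have "of_nat n * of_nat (card (congruence_solutions Q m a k n)) =
      (\<Sum>z\<in>A. if int n dvd F z then of_nat n else (0::complex))"
    using fin by (simp add: congruence_solutions_def A_def F_def sum.If_cases Int_def mult.commute)
  also have "\<dots> = (\<Sum>z\<in>A. \<Sum>c\<in>{0..<int n}. additive_char n (F z * c))"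
    by (simp add: sum_additive_char[OF assms])
  also have "\<dots> = (\<Sum>c\<in>{0..<int n}. \<Sum>z\<in>A. additive_char n (- c * k) *
      (\<Prod>i\<in>{1..m}. additive_char n (c * a i * case_prod Q (z i))))"
  proof (subst sum.swap, intro sum.cong refl)
    fix c z
    have "F z * c = - c * k + (\<Sum>i\<in>{1..m}. c * a i * case_prod Q (z i))"
      by (simp add: F_def algebra_simps sum_distrib_left)
    thus "additive_char n (F z * c) =
        additive_char n (- c * k) * (\<Prod>i\<in>{1..m}. additive_char n (c * a i * case_prod Q (z i)))"
      by (simp only: additive_char_add additive_char_sum)
  qed
  also have "\<dots> = (\<Sum>c\<in>{0..<int n}. additive_char n (- c * k) *
      (\<Prod>i\<in>{1..m}. \<Sum>w\<in>{0..<int n} \<times> {0..<int n}. additive_char n (c * a i * case_prod Q w)))"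
    unfolding A_def by (subst prod_sum_PiE) (auto simp: sum_distrib_left)
  also have "\<dots> = exponential_sum Q m a k n"
    by (simp add: exponential_sum_def binary_gauss_sum_def case_prod_unfold)
  finally show ?thesis .
qed

context
  fixes p :: nat and Q :: "int \<Rightarrow> int \<Rightarrow> int" and t q :: int
  assumes p: "prime p" "p \<noteq> 2" and p_ndvd: "\<not> int p dvd t ^ 2 - 4 * q"
    and Q: "\<And>x y. Q x y = x ^ 2 + t * x * y + q * y ^ 2"
begin

lemma binary_form_cong:
  assumes "[x = x'] (mod n)" "[y = y'] (mod n)" shows "[Q x y = Q x' y'] (mod n)"
  unfolding Q by (intro cong_add cong_mult cong_pow assms) auto

text \<open>With \<open>p\<close> cancelled the character depends only on \<open>x\<close> and
  \<open>y\<close> modulo \<open>p ^ j\<close>, and each of the two coordinates runs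
  \<open>p\<close> times over these residues.\<close>

lemma binary_gauss_sum_mult_p:
  "binary_gauss_sum Q (p ^ Suc j) (int p * c) = of_nat p ^ 2 * binary_gauss_sum Q (p ^ j) c"
proof -
  have p0: "p > 0" using p prime_gt_0_nat by blast
  hence pj: "p ^ j > 0" by simp
  let ?f = "\<lambda>x y. additive_char (p ^ j) (c * Q x y)"
  have n: "p ^ Suc j = p ^ j * p" by simp
  have e: "additive_char (p ^ j * p) (int p * c * Q x y) = ?f x y" for x y
    using additive_char_cancel[OF p0, of "p ^ j" "c * Q x y"] by (simp add: mult_ac)
  have cong: "?f x y = ?f x' y'" if "[x = x'] (mod int (p ^ j))" "[y = y'] (mod int (p ^ j))" for x y x' y'
    by (intro additive_char_cong[OF pj] cong_mult binary_form_cong that) auto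
  have "binary_gauss_sum Q (p ^ Suc j) (int p * c) =
      (\<Sum>x\<in>{0..<int (p ^ j * p)}. \<Sum>y\<in>{0..<int (p ^ j * p)}. ?f x y)"
    unfolding binary_gauss_sum_def n e by (simp only: sum.cartesian_product)
  also have "\<dots> = (\<Sum>x\<in>{0..<int (p ^ j * p)}. of_nat p * (\<Sum>y\<in>{0..<int (p ^ j)}. ?f x y))"
    by (intro sum.cong refl sum_residues_periodic[OF pj] cong) auto
  also have "\<dots> = of_nat p * (\<Sum>x\<in>{0..<int (p ^ j)}. of_nat p * (\<Sum>y\<in>{0..<int (p ^ j)}. ?f x y))"
    by (rule sum_residues_periodic[OF pj]) (intro sum.cong refl arg_cong2[where f = "(*)"] cong; simp)
  also have "\<dots> = of_nat p ^ 2 * binary_gauss_sum Q (p ^ j) c"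
    unfolding binary_gauss_sum_def sum_distrib_left[symmetric]
    by (simp add: power2_eq_square sum.cartesian_product mult.assoc)
  finally show ?thesis .
qed

text \<open>Multiples of \<open>p\<close> among the \<open>c\<close> reproduce the sum of level
  \<open>j\<close>. At units all binary sums have the same value, so only the Ramanujan sum of
  \<open>k\<close> remains, written as the full sum modulo \<open>p ^ Suc j\<close> minus the part
  over multiples of \<open>p\<close>.\<close>

lemma exponential_sum_Suc:
  assumes a: "\<And>i. i \<in> {1..m} \<Longrightarrow> \<not> int p dvd a i"
  shows "exponential_sum Q m a k (p ^ Suc j) =
    of_nat p ^ (2 * m) * exponential_sum Q m a k (p ^ j) +
    (of_int (Legendre (t ^ 2 - 4 * q) (int p)) * of_nat p) ^ (Suc j * m) *
      ((if int (p ^ Suc j) dvd k then of_nat (p ^ Suc j) else 0) - (if int (p ^ j) dvd k then of_nat (p ^ j) else 0))"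
proof -
  have p0: "p > 0" using p prime_gt_0_nat by blast
  hence pj: "p ^ j > 0" "p ^ Suc j > 0" by simp_all
  let ?n = "p ^ Suc j"
  let ?X = "(of_int (Legendre (t ^ 2 - 4 * q) (int p)) * of_nat p :: complex)"
  define f where "f = (\<lambda>c. additive_char ?n (- c * k))"
  define F where "F = (\<lambda>c. f c * (\<Prod>i\<in>{1..m}. binary_gauss_sum Q ?n (c * a i)))"
  have n: "?n = p * p ^ j" by simp
  have f_mult: "f (int p * w) = additive_char (p ^ j) (- w * k)" for w
    using additive_char_cancel[OF p0, of "p ^ j" "- w * k"] by (simp add: f_def mult_ac)
  have split: "(\<Sum>c\<in>{0..<int ?n}. g c) = (\<Sum>c\<in>{0..<int ?n}. if int p dvd c then 0 else g c) +
      (\<Sum>w\<in>{0..<int (p ^ j)}. g (int p * w))" for g :: "int \<Rightarrow> complex"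
    unfolding n sum_residues_multiples[OF p0, symmetric] sum.distrib[symmetric] by (intro sum.cong) auto
  have "exponential_sum Q m a k ?n = (\<Sum>c\<in>{0..<int ?n}. F c)"
    by (simp add: exponential_sum_def F_def f_def)
  also have "\<dots> = (\<Sum>c\<in>{0..<int ?n}. if int p dvd c then 0 else F c) + (\<Sum>w\<in>{0..<int (p ^ j)}. F (int p * w))"
    by (rule split)
  also have "(\<Sum>w\<in>{0..<int (p ^ j)}. F (int p * w)) = of_nat p ^ (2 * m) * exponential_sum Q m a k (p ^ j)"
  proof -
    have "F (int p * w) = of_nat p ^ (2 * m) *
        (additive_char (p ^ j) (- w * k) * (\<Prod>i\<in>{1..m}. binary_gauss_sum Q (p ^ j) (w * a i)))" for w
      using binary_gauss_sum_mult_p[of j "w * a i" for i]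
      by (simp only: F_def f_mult mult.assoc prod.distrib prod_constant card_atLeastAtMost power_mult)
         (simp add: mult_ac)
    thus ?thesis by (simp add: exponential_sum_def sum_distrib_left)
  qed
  also have "(\<Sum>c\<in>{0..<int ?n}. if int p dvd c then 0 else F c) =
      (\<Sum>c\<in>{0..<int ?n}. ?X ^ (Suc j * m) * (if int p dvd c then 0 else f c))"
  proof (intro sum.cong refl)
    fix c
    have "(\<Prod>i\<in>{1..m}. binary_gauss_sum Q ?n (c * a i)) = ?X ^ (Suc j * m)" if c: "\<not> int p dvd c"
    proof -
      have "binary_gauss_sum Q ?n (c * a i) = ?X ^ Suc j" if "i \<in> {1..m}" for i
        by (rule binary_gauss_sum_unit[OF p _ p_ndvd Q]) (use p c a[OF that] in \<open>simp add: prime_dvd_mult_iff\<close>)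
      hence "(\<Prod>i\<in>{1..m}. binary_gauss_sum Q ?n (c * a i)) = (\<Prod>i\<in>{1..m}. ?X ^ Suc j)"
        by (intro prod.cong) auto
      also have "\<dots> = ?X ^ (Suc j * m)" by (simp only: prod_constant card_atLeastAtMost power_mult) simp
      finally show ?thesis .
    qed
    thus "(if int p dvd c then 0 else F c) = ?X ^ (Suc j * m) * (if int p dvd c then 0 else f c)"
      by (simp add: F_def)
  qed
  also have "\<dots> = ?X ^ (Suc j * m) * (\<Sum>c\<in>{0..<int ?n}. if int p dvd c then 0 else f c)"
    by (simp only: sum_distrib_left)
  also have "(\<Sum>c\<in>{0..<int ?n}. if int p dvd c then 0 else f c) =
      (\<Sum>c\<in>{0..<int ?n}. f c) - (\<Sum>w\<in>{0..<int (p ^ j)}. f (int p * w))"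
    unfolding split[of f] by simp
  also have "(\<Sum>c\<in>{0..<int ?n}. f c) = (if int ?n dvd k then of_nat ?n else 0)"
    using sum_additive_char[OF pj(2), of "- k"] by (simp add: f_def mult.commute)
  also have "(\<Sum>w\<in>{0..<int (p ^ j)}. f (int p * w)) = (if int (p ^ j) dvd k then of_nat (p ^ j) else 0)"
    unfolding f_mult using sum_additive_char[OF pj(1), of "- k"] by (simp add: mult.commute)
  finally show ?thesis by (simp only: add.commute)
qed

text \<open>The recursion of \<open>exponential_sum_Suc\<close>, once normalized, adds nothing when
  \<open>j\<close> exceeds the exponent of \<open>p\<close> in \<open>k\<close>; the limit is
  therefore attained.\<close>

lemma congruence_solutions_density:
  assumes a: "\<And>i. i \<in> {1..m} \<Longrightarrow> \<not> int p dvd a i" and m: "m \<ge> 1" and k: "k \<noteq> 0"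
  defines "\<epsilon> \<equiv> real_of_int (Legendre (t ^ 2 - 4 * q) (int p)) ^ m"
  shows "(\<lambda>j. real (card (congruence_solutions Q m a k (p ^ j))) / real p ^ (j * (2 * m - 1)))
    \<longlonglongrightarrow> (1 - \<epsilon> / real p ^ m) * (\<Sum>i\<le>multiplicity (int p) k. (\<epsilon> / real p ^ (m - 1)) ^ i)"
proof -
  have p0: "p > 0" using p prime_gt_0_nat by blast
  define D where "D = (\<lambda>j. real (card (congruence_solutions Q m a k (p ^ j))) / real p ^ (j * (2 * m - 1)))"
  define Y where "Y = \<epsilon> / real p ^ m"
  define X where "X = \<epsilon> / real p ^ (m - 1)"
  define \<tau> where "\<tau> = multiplicity (int p) k"
  have XY: "X = real p * Y" using m p0 by (cases m) (auto simp: X_def Y_def)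
  have dvd_iff: "int (p ^ j) dvd k \<longleftrightarrow> j \<le> \<tau>" for j
    using power_dvd_iff_le_multiplicity[of k "int p" j] k prime_gt_1_nat[OF p(1)] by (auto simp: \<tau>_def)
  \<comment> \<open>The exponent \<open>2 * m * j\<close> absorbs the factor \<open>p ^ j\<close> by
    which the exponential sum exceeds the count.\<close>
  have D_eq: "complex_of_real (D j) = exponential_sum Q m a k (p ^ j) / of_nat p ^ (2 * m * j)" for j
  proof -
    have "j * (2 * m - 1) + j = 2 * m * j" using m by (cases m) (auto simp: algebra_simps)
    hence "of_nat p ^ (2 * m * j) = (of_nat p ^ (j * (2 * m - 1)) * of_nat p ^ j :: complex)"
      by (simp flip: power_add)
    thus ?thesis using p0 unfolding D_def
      by (simp add: card_congruence_solutions[symmetric] field_simps)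
  qed
  have D_Suc: "D (Suc j) = D j + Y ^ Suc j *
      ((if Suc j \<le> \<tau> then real p ^ Suc j else 0) - (if j \<le> \<tau> then real p ^ j else 0))" for j
  proof -
    let ?R = "(if Suc j \<le> \<tau> then real p ^ Suc j else 0) - (if j \<le> \<tau> then real p ^ j else 0)"
    let ?L = "complex_of_int (Legendre (t ^ 2 - 4 * q) (int p))"
    have R: "((if int (p ^ Suc j) dvd k then of_nat (p ^ Suc j) else 0) -
        (if int (p ^ j) dvd k then of_nat (p ^ j) else 0)) = complex_of_real ?R"
      unfolding dvd_iff by simp
    have "(?L * of_nat p) ^ (Suc j * m) / of_nat p ^ (2 * m * Suc j) = complex_of_real (Y ^ Suc j)"
    proof -
      have "2 * m * Suc j = Suc j * m + Suc j * m" by (simp add: algebra_simps)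
      hence "(?L * of_nat p) ^ (Suc j * m) / of_nat p ^ (2 * m * Suc j) = ?L ^ (Suc j * m) / of_nat p ^ (Suc j * m)"
        using p0 by (simp only: power_mult_distrib power_add) simp
      also have "\<dots> = (?L ^ m / of_nat p ^ m) ^ Suc j"
        by (simp only: power_divide mult.commute[of "Suc j"] power_mult)
      finally show ?thesis by (simp add: Y_def \<epsilon>_def)
    qed
    note Z = this
    have W: "of_nat p ^ (2 * m * Suc j) = (of_nat p ^ (2 * m) * of_nat p ^ (2 * m * j) :: complex)"
      by (simp add: power_add)
    have E: "of_nat p ^ (2 * m) * exponential_sum Q m a k (p ^ j) / of_nat p ^ (2 * m * Suc j) = complex_of_real (D j)"
      unfolding W D_eq using p0 by simp
    have S: "exponential_sum Q m a k (p ^ Suc j) =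
        of_nat p ^ (2 * m) * exponential_sum Q m a k (p ^ j) + (?L * of_nat p) ^ (Suc j * m) * complex_of_real ?R"
      unfolding R[symmetric] by (rule exponential_sum_Suc) (rule a)
    have "complex_of_real (D (Suc j)) =
        of_nat p ^ (2 * m) * exponential_sum Q m a k (p ^ j) / of_nat p ^ (2 * m * Suc j) +
        (?L * of_nat p) ^ (Suc j * m) / of_nat p ^ (2 * m * Suc j) * complex_of_real ?R"
      unfolding D_eq[of "Suc j"] S by (simp only: add_divide_distrib times_divide_eq_left)
    hence "complex_of_real (D (Suc j)) = complex_of_real (D j) + complex_of_real (Y ^ Suc j) * complex_of_real ?R"
      unfolding Z E .
    thus ?thesis unfolding of_real_mult[symmetric] of_real_add[symmetric] of_real_eq_iff .
  qed
  \<comment> \<open>With \<open>X = p * Y\<close>, a step adds \<open>X ^ Suc j\<close> as long as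
    \<open>Suc j \<le> \<tau>\<close> and subtracts \<open>Y * X ^ j\<close> as long as
    \<open>j \<le> \<tau>\<close>; hence the two cut-offs one apart.\<close>
  have closed: "D j = (\<Sum>i\<le>min j \<tau>. X ^ i) - Y * (\<Sum>i<min j (Suc \<tau>). X ^ i)" for j
  proof (induction j)
    case 0
    have "exponential_sum Q m a k 1 = 1"
      by (simp add: exponential_sum_def binary_gauss_sum_def)
    hence "complex_of_real (D 0) = 1" unfolding D_eq by simp
    thus ?case by simp
  next
    case (Suc j)
    consider "Suc j \<le> \<tau>" | "j = \<tau>" | "j > \<tau>" by linarith
    thus ?case
    proof cases
      case 1
      thus ?thesis using Suc by (simp add: D_Suc XY min_def power_mult_distrib algebra_simps)
    next
      case 2
      thus ?thesis using Suc by (simp add: D_Suc XY power_mult_distrib algebra_simps)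
    next
      case 3
      hence "min j \<tau> = \<tau>" "min (Suc j) \<tau> = \<tau>" "min j (Suc \<tau>) = Suc \<tau>" "min (Suc j) (Suc \<tau>) = Suc \<tau>"
        by auto
      thus ?thesis using Suc 3 by (simp only: D_Suc) simp
    qed
  qed
  have "D \<longlonglongrightarrow> (1 - Y) * (\<Sum>i\<le>\<tau>. X ^ i)"
  proof (rule tendsto_eventually, rule eventually_mono[OF eventually_ge_at_top[of "Suc \<tau>"]])
    fix j assume "Suc \<tau> \<le> j"
    thus "D j = (1 - Y) * (\<Sum>i\<le>\<tau>. X ^ i)"
      unfolding closed by (simp add: min_def lessThan_Suc_atMost left_diff_distrib)
  qed
  thus ?thesis unfolding D_def X_def Y_def \<tau>_def .
qed

end

section \<open>Imaginary quadratic fields\<close>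

lemma ipoly_add: "poly (map_poly of_int (p + q)) (z::complex) = poly (map_poly of_int p) z + poly (map_poly of_int q) z"
  by (induction p q rule: poly_induct2) (auto simp: map_poly_pCons algebra_simps)

lemma ipoly_smult: "poly (map_poly of_int (Polynomial.smult c p)) (z::complex) = of_int c * poly (map_poly of_int p) z"
  by (induction p) (auto simp: map_poly_pCons algebra_simps)

lemma ipoly_mult: "poly (map_poly of_int (p * q)) (z::complex) = poly (map_poly of_int p) z * poly (map_poly of_int q) z"
  by (induction p) (auto simp: map_poly_pCons ipoly_add ipoly_smult algebra_simps)

lemma quadratic_poly_eq:
  assumes "Polynomial.degree h \<le> 2" shows "h = [:Polynomial.coeff h 0, Polynomial.coeff h 1, Polynomial.coeff h 2:]"
proof (rule poly_eqI)
  fix n :: nat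
  consider "n = 0" | "n = 1" | "n = 2" | "n > 2" by linarith
  thus "Polynomial.coeff h n = Polynomial.coeff [:Polynomial.coeff h 0, Polynomial.coeff h 1, Polynomial.coeff h 2:] n"
    using assms by cases (auto simp: coeff_pCons numeral_2_eq_2 coeff_eq_0 split: nat.splits)
qed

text \<open>Gauss's lemma, applied to the primitive integer multiple of the minimal polynomial of \<open>z\<close>.\<close>

lemma algebraic_int_quadratic:
  fixes z :: complex
  assumes z: "Im z \<noteq> 0" and alg: "algebraic_int z"
    and T: "2 * Re z \<in> \<rat>" and N: "(cmod z)\<^sup>2 \<in> \<rat>"
  shows "2 * Re z \<in> \<int> \<and> (cmod z)\<^sup>2 \<in> \<int>"
proof -
  define T where "T = 2 * Re z"
  define N where "N = (cmod z)\<^sup>2"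
  have zz: "z ^ 2 = of_real T * z - of_real N"
    unfolding T_def N_def cmod_power2 by (auto simp: complex_eq_iff power2_eq_square)
  have indep: "x = 0 \<and> y = 0" if "of_real x + of_real y * z = 0" for x y :: real
    using that z by (auto simp: complex_eq_iff)
  obtain P where P: "poly (map_poly of_int P) z = 0" "lead_coeff P = 1"
    using alg by (auto simp: algebraic_int_altdef_ipoly)
  obtain a b where ab: "b > 0" "T = of_int a / of_int b"
    using T by (metis T_def Rats_cases')
  obtain c e where ce: "e > 0" "N = of_int c / of_int e"
    using N by (metis N_def Rats_cases')
  \<comment> \<open>This is \<open>b * e\<close> times the polynomial with root \<open>z\<close>,
    trace \<open>T = a / b\<close> and norm \<open>N = c / e\<close>.\<close>
  define g where "g = [:b * c, - (a * e), b * e:]"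
  define h where "h = primitive_part g"
  have g0: "g \<noteq> 0" "Polynomial.degree g = 2" using ab ce by (auto simp: g_def)
  have eval3: "poly (map_poly of_int [:x, y, w:]) z = of_int x + of_int y * z + of_int w * z ^ 2" for x y w
    by (simp add: map_poly_pCons power2_eq_square algebra_simps)
  have "poly (map_poly of_int g) z = 0"
  proof -
    have "of_int (b * e) * z ^ 2 = of_real (of_int b * T * of_int e) * z - of_real (of_int b * (of_int e * N))"
      unfolding zz by (simp add: algebra_simps)
    moreover have "of_int b * T = of_int a" "of_int e * N = of_int c" using ab ce by auto
    ultimately have "of_int (b * e) * z ^ 2 = of_real (of_int a * of_int e) * z - of_real (of_int b * of_int c)"
      by (simp only:)
    thus ?thesis unfolding g_def eval3 by simp
  qed
  moreover have gh: "g = Polynomial.smult (content g) h" by (simp add: h_def)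
  ultimately have hz: "poly (map_poly of_int h) z = 0" using g0
    by (metis content_eq_zero_iff ipoly_smult mult_eq_0_iff of_int_eq_0_iff)
  have h0: "h \<noteq> 0" "Polynomial.degree h = 2" using g0 by (auto simp: h_def)
  \<comment> \<open>Pseudo-division stays over the integers at the price of the factor
    \<open>l\<close>. The remainder has degree at most 1 and vanishes at the nonreal
    \<open>z\<close>, so it is zero.\<close>
  define s r where "s = fst (pseudo_divmod P h)" and "r = snd (pseudo_divmod P h)"
  define l where "l = lead_coeff h ^ (Suc (Polynomial.degree P) - Polynomial.degree h)"
  have l0: "l \<noteq> 0" using h0(1) unfolding l_def by simp
  have div: "Polynomial.smult l P = h * s + r" "r = 0 \<or> Polynomial.degree r < Polynomial.degree h"
    using pseudo_divmod[OF h0(1), of P s r] by (auto simp: s_def r_def l_def)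
  have "r = 0"
  proof -
    have "poly (map_poly of_int (Polynomial.smult l P)) z = (0 :: complex)" using P by (simp add: ipoly_smult)
    hence rz: "poly (map_poly of_int r) z = 0" unfolding div(1)
      using hz by (simp add: ipoly_add ipoly_mult)
    have "Polynomial.degree r \<le> 1" using div(2) h0 by auto
    hence "r = [:Polynomial.coeff r 0, Polynomial.coeff r 1, Polynomial.coeff r 2:]" "Polynomial.coeff r 2 = 0"
      using quadratic_poly_eq[of r] by (auto intro: coeff_eq_0)
    then obtain x y where r: "r = [:x, y:]" by auto
    have "of_real (of_int x) + of_real (of_int y) * z = 0" using rz by (simp add: r map_poly_pCons mult.commute)
    thus "r = 0" using indep[of "of_int x" "of_int y"] r by simp
  qed
  hence eq: "Polynomial.smult l P = h * s" using div by simp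
  \<comment> \<open>Contents are multiplicative: \<open>P\<close> is monic and \<open>h\<close>
    primitive, so \<open>l\<close> divides \<open>s\<close> and cancels. Then \<open>h\<close>
    divides the monic \<open>P\<close>, and its leading coefficient is a unit.\<close>
  have "content P = 1"
    using content_dvd_coeff[of P "Polynomial.degree P"] P(2) by (metis is_unit_normalize normalize_content)
  hence "content s = normalize l"
    using arg_cong[OF eq, of content] g0 by (simp add: content_mult h_def)
  hence "[:l:] dvd s" by (simp add: const_poly_dvd_iff_dvd_content)
  then obtain u where "s = Polynomial.smult l u" by (auto elim!: dvdE)
  hence "Polynomial.smult l P = Polynomial.smult l (h * u)" using eq by simp
  hence "P = h * u" using l0 by (metis poly_eq_iff coeff_smult mult_left_cancel)
  hence "lead_coeff h * lead_coeff u = 1" using P(2) by (simp add: lead_coeff_mult)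
  hence unit: "lead_coeff h = 1 \<or> lead_coeff h = -1" by (metis zmult_eq_1_iff)
  obtain x y w where h: "h = [:x, y, w:]" "w = lead_coeff h"
    using quadratic_poly_eq[of h] h0 by auto
  have "of_int x + of_int y * z + of_int w * z ^ 2 = 0" using hz unfolding h(1) eval3 .
  hence "of_real (of_int x - of_int w * N) + of_real (of_int y + of_int w * T) * z = 0"
    unfolding zz by (simp add: algebra_simps)
  from indep[OF this] have "of_int x = of_int w * N" "of_int w * T = - of_int y" by auto
  with unit h(2) have "N = of_int x \<or> N = - of_int x" "T = of_int y \<or> T = - of_int y" by auto
  thus ?thesis unfolding T_def[symmetric] N_def[symmetric] by (metis Ints_minus Ints_of_int)
qed


section \<open>Trace, norm and an integral basis\<close>

locale imaginary_quadratic =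
  fixes K :: "complex set"
  assumes K: "imaginary_quadratic_field K"
begin

lemma zero_in: "0 \<in> K" and one_in: "1 \<in> K"
  and diff_in: "x \<in> K \<Longrightarrow> y \<in> K \<Longrightarrow> x - y \<in> K"
  and mult_in: "x \<in> K \<Longrightarrow> y \<in> K \<Longrightarrow> x * y \<in> K"
  using K by (auto simp: imaginary_quadratic_field_def subfield_of_complex_def)

lemma generator:
  obtains \<theta> where "Im \<theta> \<noteq> 0" "K = {of_rat x + of_rat y * \<theta> | x y. True}"
  using K by (auto simp: imaginary_quadratic_field_def complex_is_Real_iff)

lemma of_rat_in: "of_rat x \<in> K"
proof -
  obtain \<theta> where "K = {of_rat x + of_rat y * \<theta> | x y. True}" using generator by blast
  thus ?thesis by simp (intro exI[of _ x] exI[of _ 0], simp)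
qed

lemma of_int_in: "of_int n \<in> K"
  using of_rat_in[of "of_int n"] by simp

lemma Re_of_rat [simp]: "Re (of_rat x) = of_rat x" and Im_of_rat [simp]: "Im (of_rat x) = 0"
proof -
  have "(of_rat x :: complex) = of_real (of_rat x)" by (cases x) (simp add: of_rat_rat)
  thus "Re (of_rat x) = of_rat x" "Im (of_rat x) = 0" by simp_all
qed

lemma real_in_K:
  assumes "z \<in> K" "Im z = 0" shows "z \<in> \<rat>"
proof -
  obtain \<theta> where t: "Im \<theta> \<noteq> 0" "K = {of_rat x + of_rat y * \<theta> | x y. True}" by (rule generator)
  then obtain x y where z: "z = of_rat x + of_rat y * \<theta>" using assms by blast
  hence "of_rat y * Im \<theta> = (0::real)" using assms by simp
  hence "y = 0" using t by simp
  thus ?thesis using z by simp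
qed

text \<open>The field contains the square of its generator, so
  \<open>\<theta> * \<theta> = u + v * \<theta>\<close> with rational \<open>u\<close>,
  \<open>v\<close>; imaginary parts give the trace \<open>v\<close>, real parts the norm
  \<open>- u\<close>.\<close>

lemma trace_norm_rational:
  assumes "z \<in> K" shows "2 * Re z \<in> \<rat>" "(cmod z)\<^sup>2 \<in> \<rat>"
proof -
  obtain \<theta> where t: "Im \<theta> \<noteq> 0" "K = {of_rat x + of_rat y * \<theta> | x y. True}" by (rule generator)
  have "\<theta> \<in> K" unfolding t(2) mem_Collect_eq by (intro exI[of _ 0] exI[of _ 1]) simp
  hence "\<theta> * \<theta> \<in> K" by (intro mult_in)
  then obtain u v where uv: "\<theta> * \<theta> = of_rat u + of_rat v * \<theta>" unfolding t(2) by blast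
  have "2 * Re \<theta> * Im \<theta> = of_rat v * Im \<theta>" using arg_cong[OF uv, of Im] by simp
  hence tr: "2 * Re \<theta> = of_rat v" using t by simp
  have nm: "(cmod \<theta>)\<^sup>2 = - of_rat u"
  proof -
    have "Re \<theta> * Re \<theta> - Im \<theta> * Im \<theta> = of_rat u + of_rat v * Re \<theta>" using arg_cong[OF uv, of Re] by simp
    thus ?thesis unfolding cmod_power2 tr[symmetric] by (simp add: power2_eq_square algebra_simps)
  qed
  obtain x y where z: "z = of_rat x + of_rat y * \<theta>" using assms t(2) by blast
  have "2 * Re z = of_rat (2 * x + y * v)" unfolding z using tr by (simp add: of_rat_add of_rat_mult algebra_simps)
  thus "2 * Re z \<in> \<rat>" by simp
  have "(cmod z)\<^sup>2 = (of_rat x)\<^sup>2 + of_rat x * of_rat y * (2 * Re \<theta>) + (of_rat y)\<^sup>2 * (cmod \<theta>)\<^sup>2"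
    unfolding cmod_power2 z by (simp add: power2_eq_square algebra_simps)
  also have "\<dots> = of_rat (x ^ 2 + x * y * v - y ^ 2 * u)"
    unfolding tr nm by (simp add: of_rat_add of_rat_mult of_rat_diff of_rat_power)
  finally show "(cmod z)\<^sup>2 \<in> \<rat>" by simp
qed

lemma cnj_in: "z \<in> K \<Longrightarrow> cnj z \<in> K"
proof -
  assume z: "z \<in> K"
  obtain x where "2 * Re z = of_rat x" using trace_norm_rational(1)[OF z] by (auto elim: Rats_cases)
  hence "cnj z = of_rat x - z" by (auto simp: complex_eq_iff)
  thus ?thesis using diff_in[OF of_rat_in z] by simp
qed

text \<open>One direction is that \<open>z\<close> is a root of the monic polynomial formed from
  trace and norm. The other is \<open>algebraic_int_quadratic\<close> for nonreal \<open>z\<close>;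
  a real \<open>z\<close> is rational, hence an ordinary integer.\<close>

lemma ring_of_integers_iff:
  "z \<in> ring_of_integers K \<longleftrightarrow> z \<in> K \<and> 2 * Re z \<in> \<int> \<and> (cmod z)\<^sup>2 \<in> \<int>"
proof safe
  assume z: "z \<in> ring_of_integers K"
  thus zK: "z \<in> K" by (simp add: ring_of_integers_def)
  have alg: "algebraic_int z" using z by (simp add: ring_of_integers_def)
  have "2 * Re z \<in> \<int> \<and> (cmod z)\<^sup>2 \<in> \<int>"
  proof (cases "Im z = 0")
    case True
    have "z \<in> \<int>" using rational_algebraic_int_is_int[OF alg real_in_K[OF zK True]] .
    then obtain n where "z = of_int n" by (auto elim: Ints_cases)
    thus ?thesis by (auto simp: cmod_power2)
  next
    case False
    thus ?thesis using algebraic_int_quadratic[OF False alg trace_norm_rational[OF zK]] by simp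
  qed
  thus "2 * Re z \<in> \<int>" "(cmod z)\<^sup>2 \<in> \<int>" by auto
next
  assume z: "z \<in> K" "2 * Re z \<in> \<int>" "(cmod z)\<^sup>2 \<in> \<int>"
  obtain t q where tq: "2 * Re z = of_int t" "(cmod z)\<^sup>2 = of_int q"
    using z by (auto elim!: Ints_cases)
  have "z ^ 2 - of_int t * z + of_int q = of_real ((cmod z)\<^sup>2) + z ^ 2 - of_real (2 * Re z) * z"
    unfolding tq by simp
  also have "\<dots> = 0" unfolding cmod_power2 by (simp add: complex_eq_iff power2_eq_square)
  finally have "poly (map_poly of_int [:q, - t, 1:]) z = 0"
    by (simp add: map_poly_pCons power2_eq_square algebra_simps)
  hence "algebraic_int z" unfolding algebraic_int_altdef_ipoly by (intro exI[of _ "[:q, - t, 1:]"]) simp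
  thus "z \<in> ring_of_integers K" using z by (simp add: ring_of_integers_def)
qed

text \<open>
  Writing \<open>z = (t + \<surd>-A)/2\<close> and \<open>w = (s + \<surd>-B)/2\<close>, the product \<open>c\<close> of the two square roots is
  rational with \<open>c\<^sup>2 = AB \<equiv> (ts)\<^sup>2\<close> modulo 4, so \<open>z cnj w\<close> has integral trace \<open>(ts + c)/2\<close>.
\<close>

lemma ring_of_integers_diff:
  assumes z: "z \<in> ring_of_integers K" and w: "w \<in> ring_of_integers K"
  shows "z - w \<in> ring_of_integers K"
proof -
  have zK: "z \<in> K" and wK: "w \<in> K" using z w by (auto simp: ring_of_integers_iff)
  obtain t q where tq: "2 * Re z = of_int t" "(cmod z)\<^sup>2 = of_int q"
    using z by (auto simp: ring_of_integers_iff elim!: Ints_cases)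
  obtain s r where sr: "2 * Re w = of_int s" "(cmod w)\<^sup>2 = of_int r"
    using w by (auto simp: ring_of_integers_iff elim!: Ints_cases)
  define c where "c = (2 * Im z) * (2 * Im w)"
  have A: "(2 * Im z)\<^sup>2 = of_int (4 * q - t ^ 2)" and B: "(2 * Im w)\<^sup>2 = of_int (4 * r - s ^ 2)"
    unfolding of_int_diff of_int_mult of_int_power tq[symmetric] sr[symmetric] cmod_power2
    by (simp_all add: power2_eq_square)
  have tr: "2 * (2 * Re (z * cnj w)) = of_int (t * s) + c"
    unfolding of_int_mult tq(1)[symmetric] sr(1)[symmetric] c_def by (simp add: algebra_simps)
  have "2 * Re (z * cnj w) \<in> \<rat>" by (intro trace_norm_rational(1) mult_in cnj_in zK wK)
  hence "2 * (2 * Re (z * cnj w)) \<in> \<rat>" by (rule Rats_mult[rotated]) simp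
  hence "2 * (2 * Re (z * cnj w)) - of_int (t * s) \<in> \<rat>" by (rule Rats_diff) (rule Rats_of_int)
  hence "c \<in> \<rat>" unfolding tr by simp
  moreover have c2: "c ^ 2 = of_int ((4 * q - t ^ 2) * (4 * r - s ^ 2))"
    unfolding c_def power_mult_distrib[of "2 * Im z"] A B by simp
  moreover have "algebraic_int c"
    unfolding algebraic_int_altdef_ipoly
    using c2 by (intro exI[of _ "[:- ((4 * q - t ^ 2) * (4 * r - s ^ 2)), 0, 1:]"])
      (simp add: map_poly_pCons power2_eq_square)
  ultimately have "c \<in> \<int>" using rational_algebraic_int_is_int by blast
  then obtain e where e: "c = of_int e" by (auto elim: Ints_cases)
  have "of_int (e ^ 2) = (of_int ((4 * q - t ^ 2) * (4 * r - s ^ 2)) :: real)" using c2 e by simp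
  hence "e ^ 2 = (4 * q - t ^ 2) * (4 * r - s ^ 2)" by (simp only: of_int_eq_iff)
  hence "even (e ^ 2) \<longleftrightarrow> even (t ^ 2 * s ^ 2)" by simp
  hence "even (t * s + e)" by simp
  then obtain f where f: "t * s + e = 2 * f" by (rule evenE)
  have "2 * (2 * Re (z * cnj w)) = of_int (t * s + e)" unfolding tr e by simp
  hence f': "2 * Re (z * cnj w) = of_int f" unfolding f by simp
  have "2 * Re (z - w) = of_int (t - s)" using tq sr by simp
  \<comment> \<open>The norm of a difference brings in just the trace of \<open>z * cnj w\<close>,
    which is why that trace had to be integral.\<close>
  moreover have "(cmod (z - w))\<^sup>2 = (cmod z)\<^sup>2 + (cmod w)\<^sup>2 - 2 * Re (z * cnj w)"
    unfolding cmod_power2 by (simp add: power2_eq_square algebra_simps)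
  hence "(cmod (z - w))\<^sup>2 = of_int (q + r - f)" unfolding tq sr f' by simp
  ultimately show ?thesis unfolding ring_of_integers_iff using diff_in[OF zK wK]
    by (simp only: Ints_of_int simp_thms)
qed

lemma ring_of_integers_int_mult:
  assumes z: "z \<in> ring_of_integers K" shows "of_int n * z \<in> ring_of_integers K"
proof -
  have 0: "0 \<in> ring_of_integers K" using zero_in by (simp add: ring_of_integers_iff)
  have nat: "of_nat n * w \<in> ring_of_integers K" if "w \<in> ring_of_integers K" for n w
  proof (induction n)
    case (Suc n)
    have "of_nat n * w - (0 - w) \<in> ring_of_integers K"
      by (intro ring_of_integers_diff Suc 0 that)
    thus ?case by (simp add: algebra_simps)
  qed (use 0 in simp)
  have "- z \<in> ring_of_integers K" using ring_of_integers_diff[OF 0 z] by simp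
  thus ?thesis using nat[OF z, of "nat n"] nat[of "- z" "nat (- n)"] by (cases "n \<ge> 0") auto
qed

lemma nonreal_integer: obtains z where "z \<in> ring_of_integers K" "Im z \<noteq> 0"
proof -
  obtain \<theta> where t: "Im \<theta> \<noteq> 0" "K = {of_rat x + of_rat y * \<theta> | x y. True}" by (rule generator)
  have th: "\<theta> \<in> K" unfolding t(2) mem_Collect_eq by (intro exI[of _ 0] exI[of _ 1]) simp
  obtain a b where ab: "b > 0" "2 * Re \<theta> = of_int a / of_int b"
    using trace_norm_rational(1)[OF th] by (metis Rats_cases')
  obtain c e where ce: "e > 0" "(cmod \<theta>)\<^sup>2 = of_int c / of_int e"
    using trace_norm_rational(2)[OF th] by (metis Rats_cases')
  define z where "z = of_int (b * e) * \<theta>"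
  have "z \<in> K" unfolding z_def by (intro mult_in th of_int_in)
  moreover have "2 * Re z = of_int (a * e)"
  proof -
    have "2 * Re z = of_int (b * e) * (2 * Re \<theta>)" by (simp add: z_def)
    thus ?thesis using ab by simp
  qed
  moreover have "(cmod z)\<^sup>2 = of_int (b ^ 2 * e * c)"
  proof -
    have "(cmod z)\<^sup>2 = of_int (b * e) ^ 2 * (cmod \<theta>)\<^sup>2"
      by (simp add: z_def norm_mult power_mult_distrib)
    thus ?thesis unfolding ce(2) using ce by (simp add: power2_eq_square)
  qed
  ultimately have "z \<in> ring_of_integers K" unfolding ring_of_integers_iff by (simp only: Ints_of_int simp_thms)
  moreover have "Im z \<noteq> 0" using t ab ce by (simp add: z_def)
  ultimately show ?thesis using that by blast
qed

text \<open>
  A nonreal integer with least imaginary part in absolute value completes \<open>1\<close> to an integral basis.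
\<close>

lemma integral_basis:
  obtains \<omega> t q where "ring_of_integers K = {of_int x + of_int y * \<omega> | x y. True}" "Im \<omega> \<noteq> 0"
    "2 * Re \<omega> = of_int t" "(cmod \<omega>)\<^sup>2 = of_int q"
proof -
  \<comment> \<open>On integers of the field the square of \<open>2 * Im z\<close> is the natural
    number \<open>4 * q - t ^ 2\<close>, so the floor changes nothing there and a least value
    exists.\<close>
  define f where "f = (\<lambda>z. nat \<lfloor>(2 * Im z)\<^sup>2\<rfloor>)"
  define P where "P = (\<lambda>z. z \<in> ring_of_integers K \<and> Im z \<noteq> 0)"
  have "\<exists>z. P z" using nonreal_integer unfolding P_def by metis
  then obtain \<omega> where w: "P \<omega>" "\<And>z. P z \<Longrightarrow> f \<omega> \<le> f z"
    using ex_has_least_nat[of P _ f] by blast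
  have wR: "\<omega> \<in> ring_of_integers K" "Im \<omega> \<noteq> 0" using w by (auto simp: P_def)
  have f: "real (f z) = (2 * Im z)\<^sup>2" if zR: "z \<in> ring_of_integers K" for z
  proof -
    obtain t q where tq: "2 * Re z = of_int t" "(cmod z)\<^sup>2 = of_int q"
      using zR by (auto simp: ring_of_integers_iff elim!: Ints_cases)
    have "(2 * Im z)\<^sup>2 = of_int (4 * q - t ^ 2)"
      unfolding of_int_diff of_int_mult of_int_power tq[symmetric] cmod_power2
      by (simp add: power2_eq_square)
    moreover have "(2 * Im z)\<^sup>2 \<ge> 0" by simp
    ultimately show ?thesis unfolding f_def by (metis floor_of_int of_int_0_le_iff of_nat_nat)
  qed
  have one: "1 \<in> ring_of_integers K" using one_in by (simp add: ring_of_integers_iff)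
  have "ring_of_integers K = {of_int x + of_int y * \<omega> | x y. True}"
  proof (intro equalityI subsetI)
    fix z assume zR: "z \<in> ring_of_integers K"
    \<comment> \<open>Rounding leaves at most half of \<open>Im \<omega>\<close>, so by minimality
      the remainder \<open>w\<close> is real, hence an ordinary integer.\<close>
    define y where "y = round (Im z / Im \<omega>)"
    define w where "w = z - of_int y * \<omega>"
    have wR': "w \<in> ring_of_integers K" unfolding w_def
      by (intro ring_of_integers_diff zR ring_of_integers_int_mult wR)
    have "Im w = (Im z / Im \<omega> - of_int y) * Im \<omega>" using wR by (simp add: w_def field_simps)
    hence "\<bar>Im w\<bar> = \<bar>of_int y - Im z / Im \<omega>\<bar> * \<bar>Im \<omega>\<bar>" by (simp add: abs_mult abs_minus_commute)
    also have "\<dots> \<le> 1 / 2 * \<bar>Im \<omega>\<bar>"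
      unfolding y_def by (intro mult_right_mono of_int_round_abs_le) auto
    also have "\<dots> < \<bar>Im \<omega>\<bar>" using wR by simp
    finally have "\<bar>2 * Im w\<bar> < \<bar>2 * Im \<omega>\<bar>" by (simp add: abs_mult)
    hence "(2 * Im w)\<^sup>2 < (2 * Im \<omega>)\<^sup>2" by (metis abs_ge_zero power2_abs power_strict_mono zero_less_numeral)
    hence "f w < f \<omega>" using f[OF wR'] f[OF wR(1)] by (metis of_nat_less_iff)
    hence "\<not> P w" using w(2)[of w] by linarith
    hence Im: "Im w = 0" using wR' by (simp add: P_def)
    have "w \<in> \<rat>" using real_in_K Im wR' by (auto simp: ring_of_integers_def)
    moreover have "algebraic_int w" using wR' by (simp add: ring_of_integers_def)
    ultimately obtain x where "w = of_int x" using rational_algebraic_int_is_int Ints_cases by metis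
    hence "z = of_int x + of_int y * \<omega>" by (simp add: w_def algebra_simps)
    thus "z \<in> {of_int x + of_int y * \<omega> | x y. True}" by blast
  next
    fix z assume "z \<in> {of_int x + of_int y * \<omega> | x y. True}"
    then obtain x y where z: "z = of_int x * 1 - of_int (- y) * \<omega>" by auto
    show "z \<in> ring_of_integers K" unfolding z
      by (intro ring_of_integers_diff ring_of_integers_int_mult one wR)
  qed
  moreover obtain t q where "2 * Re \<omega> = of_int t" "(cmod \<omega>)\<^sup>2 = of_int q"
    using wR by (auto simp: ring_of_integers_iff elim!: Ints_cases)
  ultimately show ?thesis using that wR by blast
qed

text \<open>Two bases express each other with integer coefficients, so the two determinants multiply
  to 1 and are 1 or -1; the square is the same for both. This makes the description in
  \<open>field_discriminant\<close> unique. The sign comes from \<open>t ^ 2 - 4 * q\<close> being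
  minus the square of \<open>2 * Im \<omega>\<close>.\<close>

lemma field_discriminant_eq:
  assumes R: "ring_of_integers K = {of_int x + of_int y * \<omega> | x y. True}" and w: "Im \<omega> \<noteq> 0"
    and tq: "2 * Re \<omega> = of_int t" "(cmod \<omega>)\<^sup>2 = of_int q"
  shows "field_discriminant K = t ^ 2 - 4 * q" "t ^ 2 - 4 * q < 0"
proof -
  let ?\<Delta> = "\<lambda>\<alpha> \<beta>. \<alpha> * cnj \<beta> - \<beta> * cnj \<alpha>"
  let ?gen = "\<lambda>\<alpha> \<beta>. ring_of_integers K = {of_int x * \<alpha> + of_int y * \<beta> | x y. True}"
  have d: "of_int (t ^ 2 - 4 * q) = (?\<Delta> 1 \<omega>)\<^sup>2"
  proof -
    have "of_int (t ^ 2 - 4 * q) = complex_of_real ((2 * Re \<omega>)\<^sup>2 - 4 * (cmod \<omega>)\<^sup>2)" unfolding tq by simp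
    also have "\<dots> = (?\<Delta> 1 \<omega>)\<^sup>2" unfolding cmod_power2 by (simp add: complex_eq_iff power2_eq_square)
    finally show ?thesis .
  qed
  have scale: "\<exists>n::int. ?\<Delta> \<gamma> \<delta> = of_int n * ?\<Delta> \<alpha> \<beta>"
    if ab: "?gen \<alpha> \<beta>" and gd: "?gen \<gamma> \<delta>" for \<alpha> \<beta> \<gamma> \<delta>
  proof -
    have "\<gamma> = of_int 1 * \<gamma> + of_int 0 * \<delta>" "\<delta> = of_int 0 * \<gamma> + of_int 1 * \<delta>" by auto
    hence "\<gamma> \<in> ring_of_integers K" "\<delta> \<in> ring_of_integers K" unfolding gd by blast+
    then obtain x y u v where "\<gamma> = of_int x * \<alpha> + of_int y * \<beta>" "\<delta> = of_int u * \<alpha> + of_int v * \<beta>"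
      unfolding ab by blast
    hence "?\<Delta> \<gamma> \<delta> = of_int (x * v - y * u) * ?\<Delta> \<alpha> \<beta>" by (simp add: algebra_simps)
    thus ?thesis by blast
  qed
  have gen1: "?gen 1 \<omega>" using R by simp
  have nz: "?\<Delta> 1 \<omega> \<noteq> 0" using w by (simp add: complex_eq_iff)
  show "field_discriminant K = t ^ 2 - 4 * q"
    unfolding field_discriminant_def
  proof (rule the_equality)
    show "\<exists>\<alpha> \<beta>. ?gen \<alpha> \<beta> \<and> of_int (t ^ 2 - 4 * q) = (?\<Delta> \<alpha> \<beta>)\<^sup>2" using gen1 d by blast
  next
    fix d' :: int assume "\<exists>\<alpha> \<beta>. ?gen \<alpha> \<beta> \<and> of_int d' = (?\<Delta> \<alpha> \<beta>)\<^sup>2"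
    then obtain \<alpha> \<beta> where ab: "?gen \<alpha> \<beta>" "of_int d' = (?\<Delta> \<alpha> \<beta>)\<^sup>2" by blast
    obtain n where n: "?\<Delta> \<alpha> \<beta> = of_int n * ?\<Delta> 1 \<omega>" using scale[OF gen1 ab(1)] by blast
    obtain l where l: "?\<Delta> 1 \<omega> = of_int l * ?\<Delta> \<alpha> \<beta>" using scale[OF ab(1) gen1] by blast
    have "?\<Delta> 1 \<omega> = of_int (l * n) * ?\<Delta> 1 \<omega>" using l unfolding n by (simp add: mult.assoc)
    hence "of_int (l * n) = (1::complex)" using nz by (metis mult_cancel_right1)
    hence "l * n = 1" by (metis of_int_eq_1_iff)
    hence "n = 1 \<or> n = -1" by (metis zmult_eq_1_iff)
    hence "(?\<Delta> \<alpha> \<beta>)\<^sup>2 = (?\<Delta> 1 \<omega>)\<^sup>2" unfolding n by (auto simp: power2_eq_square)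
    hence "of_int d' = (of_int (t ^ 2 - 4 * q) :: complex)" using ab(2) d by simp
    thus "d' = t ^ 2 - 4 * q" by (simp only: of_int_eq_iff)
  qed
  have "of_int (t ^ 2 - 4 * q) = (2 * Re \<omega>)\<^sup>2 - 4 * (cmod \<omega>)\<^sup>2" unfolding tq by simp
  also have "\<dots> = - (2 * Im \<omega>)\<^sup>2" unfolding cmod_power2 by (simp add: power2_eq_square)
  also have "\<dots> < 0" using w by simp
  finally show "t ^ 2 - 4 * q < 0" by (simp only: of_int_less_0_iff)
qed

end

section \<open>Residue classes in coordinates\<close>

context imaginary_quadratic
begin

context
  fixes \<omega> :: complex and t q :: int and R :: "complex set" and Q :: "int \<Rightarrow> int \<Rightarrow> int"
  assumes R: "R = {of_int x + of_int y * \<omega> | x y. True}" and w: "Im \<omega> \<noteq> 0"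
    and tq: "2 * Re \<omega> = of_int t" "(cmod \<omega>)\<^sup>2 = of_int q"
    and Q: "\<And>x y. Q x y = x ^ 2 + t * x * y + q * y ^ 2"
begin

lemma basis_eq_iff: "of_int x + of_int y * \<omega> = of_int x' + of_int y' * \<omega> \<longleftrightarrow> x = x' \<and> y = y'"
proof
  assume eq: "of_int x + of_int y * \<omega> = of_int x' + of_int y' * \<omega>"
  have "of_int y * Im \<omega> = of_int y' * Im \<omega>" using arg_cong[OF eq, of Im] by simp
  hence "y = y'" using w by simp
  thus "x = x' \<and> y = y'" using eq by simp
qed auto

lemma basis_in: "of_int x + of_int y * \<omega> \<in> R"
  unfolding R by blast

lemma basis_cases:
  assumes "z \<in> R" obtains x y where "z = of_int x + of_int y * \<omega>"
  using assms unfolding R by blast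

lemma norm_basis: "(cmod (of_int x + of_int y * \<omega>))\<^sup>2 = of_int (Q x y)"
proof -
  have "(cmod (of_int x + of_int y * \<omega>))\<^sup>2 =
      (of_int x)\<^sup>2 + of_int x * of_int y * (2 * Re \<omega>) + (of_int y)\<^sup>2 * (cmod \<omega>)\<^sup>2"
    unfolding cmod_power2 by (simp add: power2_eq_square algebra_simps)
  thus ?thesis unfolding tq Q by simp
qed

lemma in_cong_rel_iff:
  "(of_int x + of_int y * \<omega>, of_int x' + of_int y' * \<omega>) \<in> cong_rel R n \<longleftrightarrow>
    [x = x'] (mod int n) \<and> [y = y'] (mod int n)"
proof -
  have 1: "of_int x + of_int y * \<omega> \<in> R" for x y unfolding R by blast
  have "(of_int x + of_int y * \<omega>, of_int x' + of_int y' * \<omega>) \<in> cong_rel R n \<longleftrightarrow>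
      (\<exists>u v. of_int x + of_int y * \<omega> - (of_int x' + of_int y' * \<omega>) = of_nat n * (of_int u + of_int v * \<omega>))"
    using 1 by (auto simp: cong_rel_def R)
  also have "\<dots> \<longleftrightarrow> (\<exists>u v. of_int x + of_int y * \<omega> = of_int (x' + int n * u) + of_int (y' + int n * v) * \<omega>)"
    by (intro arg_cong[where f = Ex] ext) (simp add: algebra_simps diff_eq_eq)
  also have "\<dots> \<longleftrightarrow> [x = x'] (mod int n) \<and> [y = y'] (mod int n)"
    unfolding basis_eq_iff cong_iff_dvd_diff dvd_def by (simp add: diff_eq_eq add.commute)
  finally show ?thesis .
qed

definition residue_class :: "nat \<Rightarrow> int \<times> int \<Rightarrow> complex set" where
  "residue_class n = (\<lambda>(x, y). cong_rel R n `` {of_int x + of_int y * \<omega>})"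

lemma mem_residue_class_iff:
  "z \<in> residue_class n (x, y) \<longleftrightarrow>
    (\<exists>u v. z = of_int u + of_int v * \<omega> \<and> [x = u] (mod int n) \<and> [y = v] (mod int n))"
proof -
  have "z \<in> R" if "z \<in> residue_class n (x, y)" using that by (auto simp: residue_class_def cong_rel_def)
  thus ?thesis unfolding residue_class_def using in_cong_rel_iff[of x y _ _ n]
    by (auto simp: R)
qed

lemma self_in_residue_class: "of_int x + of_int y * \<omega> \<in> residue_class n (x, y)"
  unfolding mem_residue_class_iff by (intro exI[of _ x] exI[of _ y]) simp

lemma bij_betw_residue_class:
  assumes n: "n > 0"
  shows "bij_betw (residue_class n) ({0..<int n} \<times> {0..<int n}) (R // cong_rel R n)"
  unfolding bij_betw_def
proof
  show "inj_on (residue_class n) ({0..<int n} \<times> {0..<int n})"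
  proof (rule inj_onI, clarify)
    fix x y x' y'
    assume xy: "x \<in> {0..<int n}" "y \<in> {0..<int n}" "x' \<in> {0..<int n}" "y' \<in> {0..<int n}"
      and eq: "residue_class n (x, y) = residue_class n (x', y')"
    have "of_int x + of_int y * \<omega> \<in> residue_class n (x, y)" by (rule self_in_residue_class)
    hence "[x' = x] (mod int n) \<and> [y' = y] (mod int n)"
      unfolding eq mem_residue_class_iff by (auto simp: basis_eq_iff)
    thus "x = x' \<and> y = y'" using xy by (auto simp: cong_def)
  qed
  show "residue_class n ` ({0..<int n} \<times> {0..<int n}) = R // cong_rel R n"
  proof (intro equalityI subsetI)
    fix Z assume "Z \<in> residue_class n ` ({0..<int n} \<times> {0..<int n})"
    thus "Z \<in> R // cong_rel R n" by (auto simp: residue_class_def intro!: quotientI basis_in)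
  next
    fix Z assume "Z \<in> R // cong_rel R n"
    then obtain z where "z \<in> R" "Z = cong_rel R n `` {z}" by (rule quotientE)
    then obtain x y where Z: "Z = residue_class n (x, y)"
      by (elim basis_cases) (simp add: residue_class_def)
    have "Z = residue_class n (x mod int n, y mod int n)"
    proof -
      have "z \<in> residue_class n (x, y) \<longleftrightarrow> z \<in> residue_class n (x mod int n, y mod int n)" for z
        unfolding mem_residue_class_iff by (simp add: cong_def)
      thus ?thesis unfolding Z by blast
    qed
    moreover have "(x mod int n, y mod int n) \<in> {0..<int n} \<times> {0..<int n}" using n by simp
    ultimately show "Z \<in> residue_class n ` ({0..<int n} \<times> {0..<int n})" by blast
  qed
qed

text \<open>\<open>Q\<close> respects congruences, so the choice of representatives is immaterial;
  and an ordinary integer lies in \<open>n\<close> times \<open>R\<close> only if \<open>n\<close>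
  divides it, by uniqueness of coordinates.\<close>

lemma solution_condition:
  assumes n: "n > 0"
  shows "(\<exists>z. (\<forall>i\<in>{1..m}. z i \<in> residue_class n (s i)) \<and>
            (\<exists>w\<in>R. herm_form m a z - of_int k = of_nat n * w)) \<longleftrightarrow>
         int n dvd (\<Sum>i\<in>{1..m}. a i * case_prod Q (s i)) - k" (is "?L \<longleftrightarrow> ?R")
proof -
  let ?F = "\<lambda>s. (\<Sum>i\<in>{1..m}. a i * case_prod Q (s i)) - k"
  have herm: "herm_form m a z - of_int k = of_int (?F s')"
    if "\<And>i. i \<in> {1..m} \<Longrightarrow> z i = of_int (fst (s' i)) + of_int (snd (s' i)) * \<omega>" for z s'
  proof -
    have "of_int (a i) * complex_of_real ((cmod (z i))\<^sup>2) = of_int (a i * case_prod Q (s' i))" if i: "i \<in> {1..m}" for i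
      unfolding \<open>i \<in> {1..m} \<Longrightarrow> z i = _\<close>[OF i] norm_basis by (simp add: case_prod_unfold)
    hence "herm_form m a z = (\<Sum>i\<in>{1..m}. of_int (a i * case_prod Q (s' i)))"
      unfolding herm_form_def by (intro sum.cong refl)
    thus ?thesis by simp
  qed
  have dvd: "(\<exists>w\<in>R. of_int x = of_nat n * w) \<longleftrightarrow> int n dvd x" for x
  proof
    assume "\<exists>w\<in>R. of_int x = of_nat n * w"
    then obtain u v where "of_int x = of_nat n * (of_int u + of_int v * \<omega>)" unfolding R by blast
    hence "of_int x + of_int 0 * \<omega> = of_int (int n * u) + of_int (int n * v) * \<omega>" by (simp add: algebra_simps)
    thus "int n dvd x" unfolding basis_eq_iff by simp
  next
    assume "int n dvd x"
    then obtain u where "x = int n * u" by auto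
    hence "of_int x = of_nat n * (of_int u + of_int 0 * \<omega>)" by simp
    thus "\<exists>w\<in>R. of_int x = of_nat n * w" unfolding R by blast
  qed
  show ?thesis
  proof
    assume ?L
    then obtain z where z: "\<forall>i\<in>{1..m}. z i \<in> residue_class n (s i)"
      "\<exists>w\<in>R. herm_form m a z - of_int k = of_nat n * w" by blast
    have "\<exists>p. z i = of_int (fst p) + of_int (snd p) * \<omega> \<and> [fst (s i) = fst p] (mod int n) \<and>
        [snd (s i) = snd p] (mod int n)" if "i \<in> {1..m}" for i
      using z(1) that mem_residue_class_iff[of "z i" n "fst (s i)" "snd (s i)"] by auto
    then obtain s' where s': "\<And>i. i \<in> {1..m} \<Longrightarrow> z i = of_int (fst (s' i)) + of_int (snd (s' i)) * \<omega> \<and>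
        [fst (s i) = fst (s' i)] (mod int n) \<and> [snd (s i) = snd (s' i)] (mod int n)" by metis
    have h: "herm_form m a z - of_int k = of_int (?F s')" by (rule herm) (use s' in blast)
    have "int n dvd ?F s'" using z(2) unfolding h dvd .
    moreover have "[?F s = ?F s'] (mod int n)"
      using s' by (intro cong_diff cong_sum cong_mult) (auto simp: case_prod_unfold Q intro!: cong_add cong_mult cong_pow)
    ultimately show ?R using cong_dvd_iff by blast
  next
    assume r: ?R
    define z where "z = (\<lambda>i. of_int (fst (s i)) + of_int (snd (s i)) * \<omega>)"
    have "z i \<in> residue_class n (s i)" for i
      using self_in_residue_class[of "fst (s i)" "snd (s i)" n] by (simp add: z_def)
    moreover have "\<exists>w\<in>R. herm_form m a z - of_int k = of_nat n * w"
    proof -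
      have h: "herm_form m a z - of_int k = of_int (?F s)" by (rule herm) (simp add: z_def)
      show ?thesis using r unfolding h dvd .
    qed
    ultimately show ?L by blast
  qed
qed

text \<open>The box of coordinate pairs contains exactly one representative of each class, so tuples
  of pairs and tuples of classes correspond under \<open>f\<close>.\<close>

lemma card_solutions_mod:
  assumes n: "n > 0"
  shows "card (solutions_mod R m a k n) = card (congruence_solutions Q m a k n)"
proof -
  let ?D = "{0..<int n} \<times> {0..<int n}"
  define f where "f = (\<lambda>s. \<lambda>i\<in>{1..m}. residue_class n (s i))"
  have bij: "inj_on (residue_class n) ?D" "residue_class n ` ?D = R // cong_rel R n"
    using bij_betw_residue_class[OF n] by (auto simp: bij_betw_def)
  have inj: "inj_on f ({1..m} \<rightarrow>\<^sub>E ?D)"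
  proof (rule inj_onI)
    fix s s' assume s: "s \<in> {1..m} \<rightarrow>\<^sub>E ?D" "s' \<in> {1..m} \<rightarrow>\<^sub>E ?D" and eq: "f s = f s'"
    show "s = s'"
    proof (rule PiE_ext[OF s])
      fix i assume i: "i \<in> {1..m}"
      have "residue_class n (s i) = residue_class n (s' i)" using fun_cong[OF eq, of i] i by (simp add: f_def)
      moreover have "s i \<in> ?D" "s' i \<in> ?D" using s i by (auto dest: PiE_mem)
      ultimately show "s i = s' i" using bij(1) by (meson inj_onD)
    qed
  qed
  have "solutions_mod R m a k n = f ` congruence_solutions Q m a k n"
  proof (intro equalityI subsetI)
    fix Z assume Z: "Z \<in> solutions_mod R m a k n"
    define s where "s = (\<lambda>i\<in>{1..m}. inv_into ?D (residue_class n) (Z i))"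
    have Zi: "Z i \<in> residue_class n ` ?D" if "i \<in> {1..m}" for i
      using Z that unfolding solutions_mod_def bij(2) by (auto dest: PiE_mem)
    have sD: "s i \<in> ?D" "residue_class n (s i) = Z i" if "i \<in> {1..m}" for i
      using inv_into_into[OF Zi[OF that]] f_inv_into_f[OF Zi[OF that]] that by (simp_all only: s_def restrict_apply' )
    have "Z = f s"
    proof (rule ext)
      fix i show "Z i = f s i"
        using sD(2)[of i] Z by (cases "i \<in> {1..m}") (auto simp: f_def solutions_mod_def PiE_def extensional_def)
    qed
    moreover have "s \<in> congruence_solutions Q m a k n"
      unfolding congruence_solutions_def
    proof (intro CollectI conjI)
      show "s \<in> {1..m} \<rightarrow>\<^sub>E ?D" using sD(1) by (intro PiE_I) (auto simp: s_def)
      have "\<exists>z. (\<forall>i\<in>{1..m}. z i \<in> residue_class n (s i)) \<and> (\<exists>w\<in>R. herm_form m a z - of_int k = of_nat n * w)"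
        using Z sD(2) by (simp add: solutions_mod_def)
      thus "int n dvd (\<Sum>i\<in>{1..m}. a i * case_prod Q (s i)) - k" unfolding solution_condition[OF n] .
    qed
    ultimately show "Z \<in> f ` congruence_solutions Q m a k n" by blast
  next
    fix Z assume "Z \<in> f ` congruence_solutions Q m a k n"
    then obtain s where s: "s \<in> {1..m} \<rightarrow>\<^sub>E ?D" "int n dvd (\<Sum>i\<in>{1..m}. a i * case_prod Q (s i)) - k" "Z = f s"
      by (auto simp: congruence_solutions_def)
    have "f s i \<in> R // cong_rel R n" if "i \<in> {1..m}" for i
      using that PiE_mem[OF s(1) that] bij(2) by (auto simp: f_def simp del: mem_Times_iff)
    hence "f s \<in> {1..m} \<rightarrow>\<^sub>E R // cong_rel R n" by (intro PiE_I) (auto simp: f_def)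
    moreover have "\<exists>z. (\<forall>i\<in>{1..m}. z i \<in> f s i) \<and> (\<exists>w\<in>R. herm_form m a z - of_int k = of_nat n * w)"
      using s(2) unfolding solution_condition[OF n, symmetric] by (simp add: f_def)
    ultimately show "Z \<in> solutions_mod R m a k n" unfolding solutions_mod_def s(3) by blast
  qed
  moreover have "inj_on f (congruence_solutions Q m a k n)"
    using inj by (rule inj_on_subset) (auto simp: congruence_solutions_def)
  ultimately show ?thesis by (simp add: card_image)
qed

end

lemma local_density_eq:
  assumes p: "prime p" "p \<noteq> 2" "\<not> int p dvd field_discriminant K"
    and a: "\<And>i. i \<in> {1..m} \<Longrightarrow> \<not> int p dvd a i" and m: "m \<ge> 1" and k: "k \<noteq> 0"
  defines "\<epsilon> \<equiv> real_of_int (Legendre (field_discriminant K) (int p)) ^ m"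
  shows "local_density (ring_of_integers K) m a k p =
    (1 - \<epsilon> / real p ^ m) * (\<Sum>i\<le>multiplicity (int p) k. (\<epsilon> / real p ^ (m - 1)) ^ i)"
proof -
  obtain \<omega> t q where basis: "ring_of_integers K = {of_int x + of_int y * \<omega> | x y. True}" "Im \<omega> \<noteq> 0"
    "2 * Re \<omega> = of_int t" "(cmod \<omega>)\<^sup>2 = of_int q" by (rule integral_basis)
  define Q where "Q = (\<lambda>x y. x ^ 2 + t * x * y + q * y ^ 2)"
  have Q: "Q x y = x ^ 2 + t * x * y + q * y ^ 2" for x y by (simp add: Q_def)
  have d: "field_discriminant K = t ^ 2 - 4 * q" by (rule field_discriminant_eq[OF basis])
  have "card (solutions_mod (ring_of_integers K) m a k (p ^ j)) = card (congruence_solutions Q m a k (p ^ j))" for j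
    by (rule card_solutions_mod[OF basis Q]) (use p prime_gt_0_nat in auto)
  thus ?thesis
    unfolding local_density_def \<epsilon>_def d
    using congruence_solutions_density[OF p(1,2) p(3)[unfolded d] Q a m k] by (simp add: limI)
qed

text \<open>Negativity makes the Kronecker symbol odd and the congruence excludes 3 modulo 4; both
  feed \<open>kronecker_bounded_sums\<close>.\<close>

lemma field_discriminant_neg: "field_discriminant K < 0"
  and field_discriminant_mod_4: "field_discriminant K mod 4 \<in> {0, 1}"
proof -
  obtain \<omega> t q where basis: "ring_of_integers K = {of_int x + of_int y * \<omega> | x y. True}" "Im \<omega> \<noteq> 0"
    "2 * Re \<omega> = of_int t" "(cmod \<omega>)\<^sup>2 = of_int q" by (rule integral_basis)
  note d = field_discriminant_eq[OF basis]
  show "field_discriminant K < 0" using d by simp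
  have "field_discriminant K mod 4 = t ^ 2 mod 4" unfolding d by (simp add: mod_diff_right_eq[symmetric])
  also have "\<dots> \<in> {0, 1}"
  proof (cases "even t")
    case True
    then obtain s where "t = 2 * s" by auto
    thus ?thesis by (simp add: power2_eq_square)
  next
    case False
    then obtain s where "t = 2 * s + 1" by (auto elim: oddE)
    hence "t ^ 2 = 4 * (s ^ 2 + s) + 1" by (simp add: power2_eq_square algebra_simps)
    then obtain u where "t ^ 2 = 4 * u + 1" by blast
    hence "t ^ 2 mod 4 = 1" by presburger
    thus ?thesis by simp
  qed
  finally show "field_discriminant K mod 4 \<in> {0, 1}" .
qed

end

section \<open>The product of the local densities\<close>

lemma euler_product_power:
  fixes \<eta> :: "nat \<Rightarrow> real"
  assumes mult: "\<And>m n. m > 0 \<Longrightarrow> n > 0 \<Longrightarrow> \<eta> (m * n) = \<eta> m * \<eta> n" and one: "\<eta> 1 = 1"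
    and le: "\<And>n. n > 0 \<Longrightarrow> \<bar>\<eta> n\<bar> \<le> 1" and m: "m \<ge> 2"
  defines "L \<equiv> (\<Sum>n. \<eta> (Suc n) * real (Suc n) powr (- real m))"
  shows "(\<lambda>N. \<Prod>p\<le>N. if prime p then 1 - \<eta> p / real p ^ m else 1) \<longlonglongrightarrow> 1 / L" "L \<noteq> 0"
proof -
  define f where "f = (\<lambda>n. \<eta> n / real n ^ m)"
  have powr: "real (Suc n) powr (- real m) = 1 / real (Suc n) ^ m" for n
    by (simp add: powr_minus powr_realpow divide_inverse)
  have "summable (\<lambda>n. 1 / real n ^ m)" using m inverse_power_summable[of m, where 'a = real] by (simp add: divide_inverse)
  hence "summable (\<lambda>n. 1 / real (Suc n) ^ m)" by (subst summable_Suc_iff)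
  hence summ: "summable (\<lambda>n. norm (f (Suc n)))"
  proof (rule summable_comparison_test'[where N = 0])
    fix n show "norm (norm (f (Suc n))) \<le> 1 / real (Suc n) ^ m"
      using le[of "Suc n"] by (simp add: f_def abs_mult divide_right_mono)
  qed
  have range: "range Suc = {1..}" by (auto simp: image_iff Suc_le_eq gr0_conv_Suc)
  have "((\<lambda>n. f (Suc n)) has_sum (\<Sum>n. f (Suc n))) UNIV"
    by (rule norm_summable_imp_has_sum[OF summ summable_sums[OF summable_norm_cancel[OF summ]]])
  hence "(f has_sum (\<Sum>n. f (Suc n))) {1..}"
    unfolding range[symmetric] by (subst has_sum_reindex) (auto simp: o_def)
  moreover have "(\<Sum>n. f (Suc n)) = L" unfolding L_def f_def powr by simp
  ultimately have "infsum f {1..} = L" by (simp add: infsumI)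
  moreover have "(\<lambda>n. norm (f n)) summable_on {1..}"
  proof -
    have "(\<lambda>n. norm (f (Suc n))) summable_on UNIV" using summ by (intro norm_summable_imp_summable_on) simp
    thus ?thesis unfolding range[symmetric] by (subst summable_on_reindex) (auto simp: o_def)
  qed
  moreover have "f (i * j) = f i * f j" if "i > 0" "j > 0" for i j
    using that by (simp add: f_def mult power_mult_distrib)
  moreover have "f 1 = 1" using one by (simp add: f_def)
  ultimately have lim: "(\<lambda>N. L * (\<Prod>p\<le>N. if prime p then 1 - f p else 1)) \<longlonglongrightarrow> 1"
    using euler_product[of f] by simp
  \<comment> \<open>Nonvanishing is free here: with \<open>L = 0\<close> the sequence tending to 1
    would be constantly 0.\<close>
  show L: "L \<noteq> 0"
  proof
    assume "L = 0"
    thus False using lim by (simp add: LIMSEQ_const_iff)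
  qed
  show "(\<lambda>N. \<Prod>p\<le>N. if prime p then 1 - \<eta> p / real p ^ m else 1) \<longlonglongrightarrow> 1 / L"
    using tendsto_divide[OF lim tendsto_const[of L] L] L by (simp add: f_def cong: if_cong)
qed

lemma euler_product_zeta:
  assumes "m \<ge> 2"
  shows "(\<lambda>N. \<Prod>p\<le>N. if prime p then 1 - 1 / real p ^ m else 1) \<longlonglongrightarrow> 1 / zeta_real (real m)"
    "zeta_real (real m) \<noteq> 0"
  using euler_product_power[of "\<lambda>_. 1" m] assms by (simp_all add: zeta_real_def)

lemma euler_product_L_kronecker:
  assumes d: "d < 0" "d mod 4 \<in> {0, 1}" and m: "m \<ge> 1"
  shows "(\<lambda>N. \<Prod>p\<le>N. if prime p then 1 - of_int (kronecker d p) / real p ^ m else 1)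
      \<longlonglongrightarrow> 1 / L_kronecker (real m) d"
    "L_kronecker (real m) d \<noteq> 0"
proof -
  define \<eta> where "\<eta> = (\<lambda>n. real_of_int (kronecker d n))"
  have mult: "\<eta> (i * j) = \<eta> i * \<eta> j" if "i > 0" "j > 0" for i j
    using that by (simp add: \<eta>_def kronecker_mult)
  have range: "\<eta> n \<in> {-1, 0, 1}" if "n > 0" for n
    using kronecker_range[OF that, of d] by (auto simp: \<eta>_def)
  have "(\<lambda>N. \<Prod>p\<le>N. if prime p then 1 - \<eta> p / real p ^ m else 1) \<longlonglongrightarrow> 1 / L_kronecker (real m) d \<and>
    L_kronecker (real m) d \<noteq> 0"
  proof (cases "m = 1")
    case False
    have "\<bar>\<eta> n\<bar> \<le> 1" if "n > 0" for n using range[OF that] by auto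
    thus ?thesis using euler_product_power[of \<eta> m] mult m False
      by (simp add: L_kronecker_def \<eta>_def)
  next
    case True
    \<comment> \<open>By convention the symbol at 0 is 1 when \<open>\<bar>d\<bar> = 1\<close>; but
      -1 is 3 modulo 4.\<close>
    have "d \<noteq> -1" using d by auto
    hence zero: "\<eta> 0 = 0" using d by (simp add: \<eta>_def kronecker_def)
    interpret bounded_real_character \<eta> "8 * \<bar>real_of_int d\<bar>"
    proof
      fix n :: nat
      show "\<eta> n \<in> {-1, 0, 1}" using range[of n] zero by (cases "n = 0") auto
      have "\<bar>of_int (\<Sum>i\<in>{1..n}. kronecker d i)\<bar> \<le> (of_int (8 * \<bar>d\<bar>) :: real)"
        using kronecker_bounded_sums[OF d, of n] by (simp only: of_int_abs[symmetric] of_int_le_iff)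
      thus "\<bar>\<Sum>i\<in>{1..n}. \<eta> i\<bar> \<le> 8 * \<bar>real_of_int d\<bar>" by (simp add: \<eta>_def)
    qed (use zero mult in \<open>simp_all add: \<eta>_def\<close>)
    have "(\<lambda>n. \<eta> (Suc n) / real (Suc n)) sums L1"
      using L1_sums zero by (subst sums_Suc_iff) simp
    hence "(\<Sum>n. \<eta> (Suc n) / real (Suc n)) = L1" by (simp add: sums_iff)
    hence "L_kronecker 1 d = L1" by (simp add: L_kronecker_def \<eta>_def powr_minus divide_inverse)
    thus ?thesis using euler_product_at_one L1_nonzero True by (simp cong: if_cong)
  qed
  thus "(\<lambda>N. \<Prod>p\<le>N. if prime p then 1 - of_int (kronecker d p) / real p ^ m else 1)
      \<longlonglongrightarrow> 1 / L_kronecker (real m) d" "L_kronecker (real m) d \<noteq> 0"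
    unfolding \<eta>_def by blast+
qed

text \<open>\<open>has_prod\<close> demands a nonzero limit unless a factor vanishes, so
  \<open>f\<close> is written as \<open>u\<close> times a finitely supported correction. A factor of
  \<open>f\<close> on \<open>B\<close> may be zero, as can happen for the density at a bad
  prime.\<close>

lemma prodinf_modify_finite:
  fixes f u :: "nat \<Rightarrow> real"
  assumes u: "\<And>n. u n \<noteq> 0" and lim: "(\<lambda>N. \<Prod>n\<le>N. u n) \<longlonglongrightarrow> P" "P \<noteq> 0"
    and B: "finite B" and eq: "\<And>n. n \<notin> B \<Longrightarrow> f n = u n"
  shows "prodinf f = P * (\<Prod>n\<in>B. f n / u n)"
proof -
  have "u has_prod P" using lim by (simp add: has_prod_def raw_has_prod_def)
  moreover have "(\<lambda>n. if n \<in> B then f n / u n else 1) has_prod (\<Prod>n\<in>B. f n / u n)"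
    by (rule has_prod_If_finite_set[OF B])
  ultimately have "(\<lambda>n. u n * (if n \<in> B then f n / u n else 1)) has_prod (P * (\<Prod>n\<in>B. f n / u n))"
    by (rule has_prod_mult)
  also have "(\<lambda>n. u n * (if n \<in> B then f n / u n else 1)) = f" using u eq by auto
  finally show ?thesis using has_prod_unique by metis
qed

context imaginary_quadratic
begin

text \<open>Common frame for both parities: \<open>e\<close> will be the Kronecker symbol for odd
  \<open>m\<close> and 1 for even \<open>m\<close>. At bad primes its value cancels between
  \<open>1 / L\<close> and the first product.\<close>

lemma hermitian_density_eq:
  fixes e :: "nat \<Rightarrow> real" and m :: nat and a :: "nat \<Rightarrow> int" and k :: int
  defines "D \<equiv> (\<Prod>i\<in>{1..m}. a i)" and "d \<equiv> field_discriminant K"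
  assumes m: "m \<ge> 1" and a: "\<And>i. i \<in> {1..m} \<Longrightarrow> a i \<noteq> 0" and k: "k \<noteq> 0"
    and e: "\<And>p. prime p \<Longrightarrow> \<not> int p dvd 2 * d * D \<Longrightarrow> e p = of_int (Legendre d (int p)) ^ m"
    and e_le: "\<And>p. prime p \<Longrightarrow> \<bar>e p\<bar> \<le> 1"
    and lim: "(\<lambda>N. \<Prod>p\<le>N. if prime p then 1 - e p / real p ^ m else 1) \<longlonglongrightarrow> 1 / L" and L: "L \<noteq> 0"
  shows "hermitian_density (ring_of_integers K) m a k = 1 / L *
    (\<Prod>p | prime p \<and> int p dvd 2 * d * D.
       local_density (ring_of_integers K) m a k p / (1 - e p / real p ^ m)) *
    (\<Prod>p | prime p \<and> int p dvd k \<and> \<not> int p dvd 2 * d * D.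
       \<Sum>i\<le>multiplicity (int p) k. (e p / real p ^ (m - 1)) ^ i)"
proof -
  define u where "u = (\<lambda>p. if prime p then 1 - e p / real p ^ m else 1)"
  define f where "f = (\<lambda>p. if prime p then local_density (ring_of_integers K) m a k p else 1)"
  define B1 where "B1 = {p. prime p \<and> int p dvd 2 * d * D}"
  define B2 where "B2 = {p. prime p \<and> int p dvd k \<and> \<not> int p dvd 2 * d * D}"
  have "d \<noteq> 0" using field_discriminant_neg by (simp add: d_def)
  moreover have "D \<noteq> 0" using a by (simp add: D_def)
  ultimately have nz: "2 * d * D \<noteq> 0" by simp
  have fin: "finite {p. prime p \<and> int p dvd x}" if "x \<noteq> 0" for x
  proof (rule finite_subset)
    show "{p. prime p \<and> int p dvd x} \<subseteq> {..nat \<bar>x\<bar>}"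
      using that by (auto dest: dvd_imp_le_int)
  qed simp
  have fin1: "finite B1" unfolding B1_def by (rule fin[OF nz])
  have fin2: "finite B2" unfolding B2_def by (rule finite_subset[OF _ fin[OF k]]) auto
  \<comment> \<open>No factor vanishes, because \<open>\<bar>e p\<bar> \<le> 1\<close> while
    \<open>p ^ m\<close> is at least 2.\<close>
  have u0: "u p \<noteq> 0" for p
  proof (cases "prime p")
    case True
    have "real p ^ 1 \<le> real p ^ m"
      using prime_ge_2_nat[OF True] m by (intro power_increasing) auto
    moreover have "real p \<ge> 2" using prime_ge_2_nat[OF True] by simp
    ultimately have "real p ^ m \<ge> 2" unfolding power_one_right by linarith
    hence "e p \<noteq> real p ^ m" using e_le[OF True] by linarith
    thus ?thesis using True \<open>real p ^ m \<ge> 2\<close> by (simp add: u_def)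
  qed (simp add: u_def)
  have good: "f p = u p * (\<Sum>i\<le>multiplicity (int p) k. (e p / real p ^ (m - 1)) ^ i)"
    if p: "prime p" "\<not> int p dvd 2 * d * D" for p
  proof -
    have nd: "\<not> int p dvd 2" "\<not> int p dvd d" "\<not> int p dvd D" using p by (auto simp: prime_dvd_mult_iff)
    hence "p \<noteq> 2" by auto
    moreover have "\<not> int p dvd a i" if "i \<in> {1..m}" for i
      using nd(3) dvd_prodI[OF _ that, of a] dvd_trans unfolding D_def by blast
    ultimately show ?thesis using local_density_eq[of p m a k] p nd m k e[OF p]
      by (simp add: f_def u_def d_def)
  qed
  have "hermitian_density (ring_of_integers K) m a k = 1 / L * (\<Prod>p\<in>B1 \<union> B2. f p / u p)"
    unfolding hermitian_density_def f_def[symmetric]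
  proof (rule prodinf_modify_finite[OF u0])
    show "(\<lambda>N. \<Prod>n\<le>N. u n) \<longlonglongrightarrow> 1 / L" using lim by (simp add: u_def)
    fix p assume p: "p \<notin> B1 \<union> B2"
    show "f p = u p"
    proof (cases "prime p")
      case True
      hence "\<not> int p dvd 2 * d * D" "\<not> int p dvd k" using p by (auto simp: B1_def B2_def)
      thus ?thesis using good[OF True] by (simp add: not_dvd_imp_multiplicity_0)
    qed (simp add: f_def u_def)
  qed (use L fin1 fin2 in auto)
  also have "(\<Prod>p\<in>B1 \<union> B2. f p / u p) = (\<Prod>p\<in>B1. f p / u p) * (\<Prod>p\<in>B2. f p / u p)"
    by (rule prod.union_disjoint[OF fin1 fin2]) (auto simp: B1_def B2_def)
  also have "(\<Prod>p\<in>B1. f p / u p) = (\<Prod>p\<in>B1. local_density (ring_of_integers K) m a k p / (1 - e p / real p ^ m))"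
    by (intro prod.cong) (auto simp: B1_def f_def u_def)
  also have "(\<Prod>p\<in>B2. f p / u p) = (\<Prod>p\<in>B2. \<Sum>i\<le>multiplicity (int p) k. (e p / real p ^ (m - 1)) ^ i)"
    by (intro prod.cong) (auto simp: B2_def good u0)
  finally show ?thesis by (simp add: B1_def B2_def mult.assoc)
qed

end

text \<open>In the application ratio 1 arises only for exponent \<open>m - 1 = 0\<close> and symbol
  1, the case treated apart.\<close>

lemma geometric_sum_power:
  fixes e x :: real
  assumes "e / x ^ l \<noteq> 1"
  shows "(\<Sum>i\<le>n. (e / x ^ l) ^ i) = (1 - e ^ (n + 1) / x ^ ((n + 1) * l)) / (1 - e / x ^ l)"
proof -
  have "(\<Sum>i\<le>n. (e / x ^ l) ^ i) = (1 - (e / x ^ l) ^ Suc n) / (1 - e / x ^ l)"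
    by (simp only: sum_gp0 assms if_False)
  also have "(e / x ^ l) ^ Suc n = e ^ (n + 1) / x ^ ((n + 1) * l)"
    by (simp only: power_divide power_mult[symmetric] Suc_eq_plus1 mult.commute)
  finally show ?thesis .
qed

(* For m = 1 and a prime p with Kronecker symbol 1, the quotient in the last product of the odd case
   is 0/0; it is read as the geometric sum it stands for, namely tau_p + 1. *)
theorem theorem3p6:
  fixes K :: "complex set" and m :: nat and a :: "nat \<Rightarrow> int" and k :: int
  defines "R \<equiv> ring_of_integers K"
    and "d \<equiv> field_discriminant K"
    and "D \<equiv> (\<Prod>i\<in>{1..m}. a i)"
    and "\<tau> \<equiv> (\<lambda>p::nat. multiplicity (int p) k)"
  assumes "imaginary_quadratic_field K"
    and "m \<ge> 1"
    and "\<And>i. i \<in> {1..m} \<Longrightarrow> a i \<noteq> 0"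
    and "k \<noteq> 0"
  shows
    "(odd m \<longrightarrow>
        hermitian_density R m a k =
          1 / L_kronecker (real m) d *
          (\<Prod>p | prime p \<and> int p dvd 2 * d * D.
              local_density R m a k p / (1 - of_int (kronecker d p) / real p ^ m)) *
          (\<Prod>p | prime p \<and> int p dvd k \<and> \<not> int p dvd 2 * d * D.
              if m = 1 \<and> kronecker d p = 1 then real (\<tau> p + 1)
              else (1 - of_int (kronecker d p) ^ (\<tau> p + 1) / real p ^ ((\<tau> p + 1) * (m - 1))) /
                   (1 - of_int (kronecker d p) / real p ^ (m - 1)))) \<and>
     (even m \<longrightarrow>
        hermitian_density R m a k =
          1 / zeta_real (real m) *
          (\<Prod>p | prime p \<and> int p dvd 2 * d * D.
              local_density R m a k p / (1 - 1 / real p ^ m)) *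
          (\<Prod>p | prime p \<and> int p dvd k \<and> \<not> int p dvd 2 * d * D.
              (1 - 1 / real p ^ ((\<tau> p + 1) * (m - 1))) /
              (1 - 1 / real p ^ (m - 1))))"
proof -
  interpret imaginary_quadratic K by unfold_locales (rule assms)
  note a = \<open>\<And>i. i \<in> {1..m} \<Longrightarrow> a i \<noteq> 0\<close>
  have d: "d < 0" "d mod 4 \<in> {0, 1}" unfolding d_def by (rule field_discriminant_neg field_discriminant_mod_4)+
  have Legendre_sq: "Legendre d (int p) \<in> {-1, 1}" "p \<noteq> 2" if "prime p" "\<not> int p dvd 2 * d * D" for p
  proof -
    have "\<not> int p dvd d" using that by (auto simp: prime_dvd_mult_iff)
    thus "Legendre d (int p) \<in> {-1, 1}" by (auto simp: Legendre_def cong_0_iff)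
    show "p \<noteq> 2" using that by auto
  qed
  have power_gt: "1 < real p ^ (m - 1)" if "prime p" "m \<noteq> 1" for p
    using prime_gt_1_nat[OF that(1)] that(2) \<open>m \<ge> 1\<close> by (intro one_less_power) auto
  show ?thesis
  proof (intro conjI impI)
    assume odd: "odd m"
    have "hermitian_density (ring_of_integers K) m a k = 1 / L_kronecker (real m) d *
      (\<Prod>p | prime p \<and> int p dvd 2 * d * D.
         local_density (ring_of_integers K) m a k p / (1 - of_int (kronecker d p) / real p ^ m)) *
      (\<Prod>p | prime p \<and> int p dvd k \<and> \<not> int p dvd 2 * d * D.
         \<Sum>i\<le>multiplicity (int p) k. (of_int (kronecker d p) / real p ^ (m - 1)) ^ i)"
      unfolding d_def D_def
    proof (rule hermitian_density_eq; (fold d_def D_def)?)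
      fix p :: nat assume p: "prime p"
      show "\<bar>real_of_int (kronecker d p)\<bar> \<le> 1"
        using kronecker_range[of p d] prime_gt_0_nat[OF p] by auto
      assume p': "\<not> int p dvd 2 * d * D"
      \<comment> \<open>At a good prime the symbol is 1 or -1, so an odd power reproduces
        it.\<close>
      show "real_of_int (kronecker d p) = of_int (Legendre d (int p)) ^ m"
        using Legendre_sq[OF p p'] odd by (auto simp: kronecker_odd_prime[OF p])
    qed (use euler_product_L_kronecker[OF d \<open>m \<ge> 1\<close>] a \<open>m \<ge> 1\<close> \<open>k \<noteq> 0\<close> in auto)
    also have "(\<Prod>p | prime p \<and> int p dvd k \<and> \<not> int p dvd 2 * d * D.
         \<Sum>i\<le>multiplicity (int p) k. (of_int (kronecker d p) / real p ^ (m - 1)) ^ i) =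
       (\<Prod>p | prime p \<and> int p dvd k \<and> \<not> int p dvd 2 * d * D.
              if m = 1 \<and> kronecker d p = 1 then real (\<tau> p + 1)
              else (1 - of_int (kronecker d p) ^ (\<tau> p + 1) / real p ^ ((\<tau> p + 1) * (m - 1))) /
                   (1 - of_int (kronecker d p) / real p ^ (m - 1)))"
    proof (rule prod.cong[OF refl])
      fix p assume "p \<in> {p. prime p \<and> int p dvd k \<and> \<not> int p dvd 2 * d * D}"
      hence p: "prime p" by simp
      show "(\<Sum>i\<le>multiplicity (int p) k. (of_int (kronecker d p) / real p ^ (m - 1)) ^ i) =
          (if m = 1 \<and> kronecker d p = 1 then real (\<tau> p + 1)
              else (1 - of_int (kronecker d p) ^ (\<tau> p + 1) / real p ^ ((\<tau> p + 1) * (m - 1))) /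
                   (1 - of_int (kronecker d p) / real p ^ (m - 1)))"
      proof (cases "m = 1 \<and> kronecker d p = 1")
        case False
        \<comment> \<open>For \<open>m = 1\<close> the ratio is the symbol itself, here different
          from 1; for larger \<open>m\<close> its absolute value is below 1.\<close>
        have "of_int (kronecker d p) / real p ^ (m - 1) \<noteq> 1"
          using False power_gt[OF p] kronecker_range[of p d] prime_gt_0_nat[OF p] by (cases "m = 1") auto
        from geometric_sum_power[OF this] show ?thesis unfolding \<tau>_def using False by simp
      qed (simp add: \<tau>_def)
    qed
    finally show "hermitian_density R m a k = 1 / L_kronecker (real m) d *
          (\<Prod>p | prime p \<and> int p dvd 2 * d * D.
              local_density R m a k p / (1 - of_int (kronecker d p) / real p ^ m)) *
          (\<Prod>p | prime p \<and> int p dvd k \<and> \<not> int p dvd 2 * d * D.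
              if m = 1 \<and> kronecker d p = 1 then real (\<tau> p + 1)
              else (1 - of_int (kronecker d p) ^ (\<tau> p + 1) / real p ^ ((\<tau> p + 1) * (m - 1))) /
                   (1 - of_int (kronecker d p) / real p ^ (m - 1)))"
      unfolding R_def .
  next
    assume even: "even m"
    hence m: "m \<ge> 2" "m \<noteq> 1" using \<open>m \<ge> 1\<close> by (auto simp: numeral_2_eq_2 Suc_le_eq le_less)
    have "hermitian_density (ring_of_integers K) m a k = 1 / zeta_real (real m) *
      (\<Prod>p | prime p \<and> int p dvd 2 * d * D.
         local_density (ring_of_integers K) m a k p / (1 - 1 / real p ^ m)) *
      (\<Prod>p | prime p \<and> int p dvd k \<and> \<not> int p dvd 2 * d * D.
         \<Sum>i\<le>multiplicity (int p) k. (1 / real p ^ (m - 1)) ^ i)"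
      unfolding d_def D_def
    proof (rule hermitian_density_eq; (fold d_def D_def)?)
      fix p :: nat assume p: "prime p" "\<not> int p dvd 2 * d * D"
      \<comment> \<open>The symbol is 1 or -1 here, and the even power removes the sign.\<close>
      show "1 = real_of_int (Legendre d (int p)) ^ m"
        using Legendre_sq[OF p] even by auto
    qed (use euler_product_zeta[OF m(1)] a \<open>m \<ge> 1\<close> \<open>k \<noteq> 0\<close> in auto)
    also have "(\<Prod>p | prime p \<and> int p dvd k \<and> \<not> int p dvd 2 * d * D.
         \<Sum>i\<le>multiplicity (int p) k. (1 / real p ^ (m - 1)) ^ i) =
       (\<Prod>p | prime p \<and> int p dvd k \<and> \<not> int p dvd 2 * d * D.
              (1 - 1 / real p ^ ((\<tau> p + 1) * (m - 1))) / (1 - 1 / real p ^ (m - 1)))"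
    proof (rule prod.cong[OF refl])
      fix p assume "p \<in> {p. prime p \<and> int p dvd k \<and> \<not> int p dvd 2 * d * D}"
      hence p: "prime p" by simp
      have "1 / real p ^ (m - 1) \<noteq> 1" using power_gt[OF p m(2)] by auto
      from geometric_sum_power[OF this, of "multiplicity (int p) k"]
      show "(\<Sum>i\<le>multiplicity (int p) k. (1 / real p ^ (m - 1)) ^ i) =
          (1 - 1 / real p ^ ((\<tau> p + 1) * (m - 1))) / (1 - 1 / real p ^ (m - 1))"
        unfolding \<tau>_def by simp
    qed
    finally show "hermitian_density R m a k = 1 / zeta_real (real m) *
          (\<Prod>p | prime p \<and> int p dvd 2 * d * D.
              local_density R m a k p / (1 - 1 / real p ^ m)) *
          (\<Prod>p | prime p \<and> int p dvd k \<and> \<not> int p dvd 2 * d * D.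
              (1 - 1 / real p ^ ((\<tau> p + 1) * (m - 1))) / (1 - 1 / real p ^ (m - 1)))"
      unfolding R_def .
  qed
qed

end
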